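(* Let $r\geq 2$ and let $h\in\mathbb{C}\{s_1\}$ with $h(0)=h'(0)=0$. With the definitions of $\mathcal{G}_S$, $\mathcal{B}_{h,S}$, normalized isomorphism, opposite filtration $U$, and the functions $g_j^U$ $(1\le j\le r)$, $\widetilde g^{\,U}$ given in the context, the following hold. (i) (The ambiguity of $h$ under automorphisms of $S$ and $\mathcal{G}_S$ is the same as the one coming from the choice of the opposite filtration.) For each filtration $U$ on $H$ opposite to $F_0$ there is a unique $h^U\in\mathbb{C}\{x\}$ with $h^U(0)=(h^U)'(0)=0$ such that $\widetilde g^{\,U}=h^U(g_1^U)$ as germs at $0\in S$. Moreover, for $\widetilde h\in\mathbb{C}\{x\}$ with $\widetilde h(0)=\widetilde h'(0)=0$, there is a normalized isomorphism $(\rho,\phi)$ from $(\mathcal{G}_S,\mathcal{B}_{h,S})$ to $(\mathcal{G}_{\widetilde S},\mathcal{B}_{\widetilde h,\widetilde S})$ if and only if $\widetilde h=h^U$ for some filtration $U$ on $H$ opposite to $F_0$. (ii) (The ambiguity is finite dimensional, more precisely $3$-dimensional.) Let $(A_{i,j})_{0\le i,j\le r}$ be the lower triangular unipotent matrix attached to $U$, that is, $e_i=\sum_{j\le i}A_{i,j}\,\widetilde e_j$ for the basis $(\widetilde e_j)$ attached to $U$. Then $h^U$ depends only on the three parameters $(A_{1,0},A_{2,0},A_{2,1})$, and all values of $(A_{1,0},A_{2,0},A_{2,1})\in\mathbb{C}^3$ occur as $U$ varies.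
   Context: For a complex manifold $S$, $\mathcal{O}_S\{\!\{\partial_t^{-1}\}\!\}$ denotes the ring of series $\sum_{k\ge 0}g_k\partial_t^{-k}$ $(g_k\in\mathcal{O}_S)$ such that $\sum_k g_k x^k/k!$ is convergent (near $x=0$); for $S$ a point this is $\mathbb{C}\{\!\{\partial_t^{-1}\}\!\}$. Adding $[\partial_t]$ means inverting $\partial_t^{-1}$. Everything is considered for germs at $0$, i.e. after shrinking $S$. Let $H=\bigoplus_{j=0}^r\mathbb{C}e_j$ and $\mathcal{G}=\bigoplus_{j=0}^r\mathbb{C}\{\!\{\partial_t^{-1}\}\!\}[\partial_t]\,e_j$, with action of $t$ given by $t\,\partial_t^{-k}e_j=(k+1)\partial_t^{-k-1}e_j$ for all $k\in\mathbb{Z}$, $0\le j\le r$. Let $S$ be a sufficiently small open polydisk about $0$ in $\mathbb{C}^r$ with coordinates $s_1,\dots,s_r$, and let $\mathcal{G}_S=\bigoplus_{j=0}^r\mathcal{O}_S\{\!\{\partial_t^{-1}\}\!\}[\partial_t]\,e_j$ with $t$ acting $\mathcal{O}_S$-linearly by the same formula and with $\partial_{s_i}e_j=0$ for all $i,j$. For $h\in\mathbb{C}\{s_1\}$ with $h(0)=h'(0)=0$ put $$v_0=e_0+\sum_{j=1}^r s_j\partial_t^{1-j}e_j+h(s_1)e_2,\qquad v_j=\partial_t^{-1}\partial_{s_j}v_0\ (1\le j\le r),$$ so $v_1=\partial_t^{-1}e_1+h'(s_1)\partial_t^{-1}e_2$ and $v_j=\partial_t^{-j}e_j$ for $j\ge2$;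 and $\mathcal{B}_{h,S}=\sum_{j=0}^r\mathcal{O}_S\{\!\{\partial_t^{-1}\}\!\}v_j\subset\mathcal{G}_S$. It is stable under $t$, $\partial_t^{-1}$, $\partial_t^{-1}\partial_{s_i}$. Let $\widetilde S$ be a second such polydisk with coordinates $\widetilde s_1,\dots,\widetilde s_r$, and define $\mathcal{G}_{\widetilde S}$ and $\mathcal{B}_{\widetilde h,\widetilde S}$ in the same way, with $h,e_j,s_i$ replaced by $\widetilde h,\widetilde e_j,\widetilde s_i$. A normalized isomorphism from $(\mathcal{G}_S,\mathcal{B}_{h,S})$ to $(\mathcal{G}_{\widetilde S},\mathcal{B}_{\widetilde h,\widetilde S})$ is a pair $(\rho,\phi)$, where $\rho:(S,0)\to(\widetilde S,0)$ is an isomorphism of germs of complex manifolds and $\phi:\mathcal{G}_S\to\rho^*\mathcal{G}_{\widetilde S}$ is an isomorphism of $\mathcal{O}_S\{\!\{\partial_t^{-1}\}\!\}[\partial_t]$-modules compatible with the actions of $t$ and $\partial_{s_i}$, with $\phi(\mathcal{B}_{h,S})=\rho^*\mathcal{B}_{\widetilde h,\widetilde S}$, such that the matrix $(A_{i,j})$ defined by $\phi(e_i)=\sum_j A_{i,j}\widetilde e_j$ $(A_{i,j}\in\mathbb{C}$; it is automatically constant, and lower triangular$)$ satisfies $A_{i,i}=1$ for all $i$. Let $F_0$ be the increasing filtration on $H$ with $F_{0,p}H=\bigoplus_{0\le i\le p}\mathbb{C}e_i$. A decreasing filtration $U$ on $H$ is opposite to $F_0$ if $F_{0,p}H\oplus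 U^{p+1}H=H$ for all $p\in\mathbb{Z}$. To such $U$ attach the basis $(\widetilde e_j)_{0\le j\le r}$ of $H$ where $\widetilde e_j$ is the unique element of $U^jH\cap F_{0,j}H$ with $\widetilde e_j-e_j\in F_{0,j-1}H$; then $U^pH=\bigoplus_{i\ge p}\mathbb{C}\widetilde e_i$. Given $U$, let $v'_0\in\mathcal{B}_{h,S}$ be the unique element (after shrinking $S$) such that $$v'_0-\widetilde e_0\in\bigoplus_{k=1}^r\ \bigoplus_{i=k}^r\mathcal{O}_S\,\partial_t^{1-k}\widetilde e_i .$$ For $k\in\mathbb{Z}$ and $0\le i\le r$ the coefficient of $\partial_t^{1-k}\widetilde e_i$ of an element of $\mathcal{G}_S$ is taken with respect to its expansion in the elements $\partial_t^{1-k}\widetilde e_i$ with coefficients in $\mathcal{O}_S$. Define $g_j^U\in\mathcal{O}_S$ to be the coefficient of $\partial_t^{1-j}\widetilde e_j$ in $v'_0$ $(1\le j\le r)$, and $\widetilde g^{\,U}\in\mathcal{O}_S$ to be the coefficient of $\widetilde e_2$ in $v'_0$. *)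

theory Defs
  imports
    "HOL-Complex_Analysis.Complex_Analysis"
    "HOL-Computational_Algebra.Formal_Laurent_Series"
    "HOL-Library.Function_Algebras"
begin

no_notation fps_nth (infixl "$" 75)

section \<open>Holomorphic functions of several variables\<close>

definition holo_on :: "(complex^'n::finite \<Rightarrow> complex) \<Rightarrow> (complex^'n) set \<Rightarrow> bool" where
  "holo_on f S \<longleftrightarrow>
     (\<forall>z\<in>S. \<exists>f'. (f has_derivative f') (at z) \<and> (\<forall>c v. f' (c *s v) = c * f' v))"

definition polydisk :: "real \<Rightarrow> (complex^'n::finite) set" where
  "polydisk e = {s. \<forall>i. norm (s $ i) < e}"

definition holo_at0 :: "(complex^'n::finite \<Rightarrow> complex) \<Rightarrow> bool" where
  "holo_at0 f \<longleftrightarrow> (\<exists>e>0. holo_on f (polydisk e))"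

lemma open_polydisk: "open (polydisk e :: (complex^'n::finite) set)"
proof -
  have "polydisk e = (\<Inter>i. {s :: complex^'n. norm (s $ i) < e})"
    by (auto simp: polydisk_def)
  moreover have "open {s :: complex^'n. norm (s $ i) < e}" for i
    by (intro open_Collect_less continuous_intros)
  ultimately show ?thesis
    by (metis (mono_tags, lifting) finite open_INT)
qed

lemma zero_in_polydisk [simp]: "0 \<in> polydisk e \<longleftrightarrow> 0 < e"
  by (auto simp: polydisk_def)

lemma polydisk_mono: "d \<le> e \<Longrightarrow> polydisk d \<subseteq> polydisk e"
  unfolding polydisk_def by (auto intro: less_le_trans)

lemma convex_polydisk: "convex (polydisk e :: (complex^'n::finite) set)"
proof -
  have "polydisk e = (\<Inter>i. (\<lambda>s :: complex^'n. s $ i) -` ball 0 e)"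
    by (auto simp: polydisk_def)
  moreover have "convex ((\<lambda>s :: complex^'n. s $ i) -` ball 0 e)" for i
    by (intro convex_linear_vimage) (auto intro!: linearI)
  ultimately show ?thesis by (metis convex_INT)
qed

lemma polydisk_subset_ball:
  assumes "0 < d" shows "\<exists>e>0. (polydisk e :: (complex^'n::finite) set) \<subseteq> ball 0 d"
proof (intro exI conjI)
  let ?e = "d / (2 * real CARD('n))"
  show "0 < ?e" using assms by simp
  show "(polydisk ?e :: (complex^'n) set) \<subseteq> ball 0 d"
  proof
    fix s :: "complex^'n" assume s: "s \<in> polydisk ?e"
    have "norm s \<le> (\<Sum>i\<in>UNIV. norm (s $ i))" 
      unfolding norm_vec_def by (intro L2_set_le_sum) auto
    also have "\<dots> \<le> (\<Sum>i\<in>(UNIV :: 'n set). ?e)"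
      using s by (intro sum_mono) (auto simp: polydisk_def less_imp_le)
    also have "\<dots> < d" using assms by simp
    finally show "s \<in> ball 0 d" by simp
  qed
qed

lemma holo_at0_iff:
  "holo_at0 f \<longleftrightarrow>
     (\<forall>\<^sub>F z in nhds 0. \<exists>f'. (f has_derivative f') (at z) \<and> (\<forall>c v. f' (c *s v) = c * f' v))"
proof
  assume "holo_at0 f"
  then obtain e where "e > 0" "holo_on f (polydisk e)" by (auto simp: holo_at0_def)
  then show "\<forall>\<^sub>F z in nhds 0. \<exists>f'. (f has_derivative f') (at z) \<and> (\<forall>c v. f' (c *s v) = c * f' v)"
    unfolding eventually_nhds holo_on_def
    by (intro exI[of _ "polydisk e"]) (auto simp: open_polydisk)
next
  assume "\<forall>\<^sub>F z in nhds 0. \<exists>f'. (f has_derivative f') (at z) \<and> (\<forall>c v. f' (c *s v) = c * f' v)"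
  then obtain d where d: "d > 0" "holo_on f (ball 0 d)"
    unfolding eventually_nhds_metric holo_on_def by (auto simp: dist_commute)
  obtain e where "e > 0" "(polydisk e :: (complex^'a) set) \<subseteq> ball 0 d"
    using polydisk_subset_ball[OF d(1)] by blast
  then show "holo_at0 f"
    using d(2) unfolding holo_at0_def holo_on_def by blast
qed

lemma holo_at0_const [simp]: "holo_at0 (\<lambda>s. c)"
  unfolding holo_at0_iff by (intro always_eventually allI exI[of _ "\<lambda>v. 0"]) auto

lemma holo_at0_coord [simp]: "holo_at0 (\<lambda>s. s $ i)"
  unfolding holo_at0_iff
  by (intro always_eventually allI exI[of _ "\<lambda>v. v $ i"])
     (auto intro!: bounded_linear_imp_has_derivative bounded_linear_intros bounded_linear_vec_nth)

lemma holo_at0_add: "holo_at0 f \<Longrightarrow> holo_at0 g \<Longrightarrow> holo_at0 (\<lambda>s. f s + g s)"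
  unfolding holo_at0_iff
proof (erule (1) eventually_elim2, elim exE conjE)
  fix z f' g'
  assume "(f has_derivative f') (at z)" "\<forall>c v. f' (c *s v) = c * f' v"
    "(g has_derivative g') (at z)" "\<forall>c v. g' (c *s v) = c * g' v"
  then show "\<exists>f'. ((\<lambda>s. f s + g s) has_derivative f') (at z) \<and> (\<forall>c v. f' (c *s v) = c * f' v)"
    by (intro exI[of _ "\<lambda>v. f' v + g' v"]) (auto intro!: has_derivative_add simp: algebra_simps)
qed

lemma holo_at0_mult: "holo_at0 f \<Longrightarrow> holo_at0 g \<Longrightarrow> holo_at0 (\<lambda>s. f s * g s)"
  unfolding holo_at0_iff
proof (erule (1) eventually_elim2, elim exE conjE)
  fix z f' g'
  assume "(f has_derivative f') (at z)" "\<forall>c v. f' (c *s v) = c * f' v"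
    "(g has_derivative g') (at z)" "\<forall>c v. g' (c *s v) = c * g' v"
  then show "\<exists>f'. ((\<lambda>s. f s * g s) has_derivative f') (at z) \<and> (\<forall>c v. f' (c *s v) = c * f' v)"
    by (intro exI[of _ "\<lambda>v. f z * g' v + f' v * g z"])
       (auto intro!: has_derivative_mult simp: algebra_simps)
qed

lemma holo_at0_minus: "holo_at0 f \<Longrightarrow> holo_at0 (\<lambda>s. - f s)"
  using holo_at0_mult[of "\<lambda>s. -1" f] by simp

lemma holo_at0_diff: "holo_at0 f \<Longrightarrow> holo_at0 g \<Longrightarrow> holo_at0 (\<lambda>s. f s - g s)"
  using holo_at0_add[OF _ holo_at0_minus, of f g] by simp

lemma holo_at0_continuous: assumes "holo_at0 f" shows "isCont f 0"
proof -
  have "\<exists>f'. (f has_derivative f') (at 0) \<and> (\<forall>c v. f' (c *s v) = c * f' v)"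
    using assms unfolding holo_at0_iff by (rule eventually_nhds_x_imp_x)
  then show ?thesis using has_derivative_continuous by blast
qed

lemma bounded_linear_axis: "bounded_linear (axis i :: complex \<Rightarrow> complex^'n::finite)"
  by (subst linear_conv_bounded_linear[symmetric], rule linearI) (auto simp: axis_def vec_eq_iff)

lemma sum_axis_eq: "(\<Sum>i\<in>UNIV. axis i (f i :: complex)) = (\<chi> i. f i)"
  by (simp add: vec_eq_iff axis_def)

lemma axis_scale: "z *s axis i (1 :: complex) = axis i z"
  by (simp add: vec_eq_iff axis_def)

lemma tendsto_vec_lambda_holo:
  assumes "\<And>i. holo_at0 (\<rho> i)" "\<And>i. \<rho> i 0 = 0"
  shows "filterlim (\<lambda>s. \<chi> i. \<rho> i s) (nhds 0) (nhds 0)"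
proof -
  have "isCont (\<lambda>s. \<chi> i. \<rho> i s) 0"
    using holo_at0_continuous[OF assms(1)] by (auto simp: isCont_def intro!: vec_tendstoI)
  then show ?thesis
    using tendsto_at_iff_tendsto_nhds[of "\<lambda>s. \<chi> i. \<rho> i s" 0] assms(2)
    by (simp add: isCont_def flip: zero_vec_def)
qed

lemma holo_at0_compose:
  assumes "holo_at0 f" and \<rho>: "\<And>i. holo_at0 (\<rho> i)" "\<And>i. \<rho> i 0 = 0"
  shows "holo_at0 (\<lambda>s. f (\<chi> i. \<rho> i s))"
proof -
  have 1: "\<forall>\<^sub>F s in nhds 0. \<exists>f'. (f has_derivative f') (at (\<chi> i. \<rho> i s)) \<and> (\<forall>c v. f' (c *s v) = c * f' v)"
    using assms(1) unfolding holo_at0_iff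
    by (rule eventually_compose_filterlim) (rule tendsto_vec_lambda_holo[OF \<rho>])
  have 2: "\<forall>\<^sub>F s in nhds 0. \<forall>i. \<exists>f'. (\<rho> i has_derivative f') (at s) \<and> (\<forall>c v. f' (c *s v) = c * f' v)"
    using \<rho>(1) unfolding holo_at0_iff by (intro eventually_all_finite)
  show ?thesis
    unfolding holo_at0_iff using 1 2
  proof eventually_elim
    case (elim s)
    then obtain f' \<rho>' where f': "(f has_derivative f') (at (\<chi> i. \<rho> i s))" "\<And>c v. f' (c *s v) = c * f' v"
      and \<rho>': "\<And>i. (\<rho> i has_derivative \<rho>' i) (at s)" "\<And>i c v. \<rho>' i (c *s v) = c * \<rho>' i v"
      by metis
    have "((\<lambda>s. \<Sum>i\<in>UNIV. axis i (\<rho> i s)) has_derivative (\<lambda>v. \<Sum>i\<in>UNIV. axis i (\<rho>' i v))) (at s)"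
      by (intro has_derivative_sum bounded_linear.has_derivative[OF bounded_linear_axis] \<rho>')
    then have "((\<lambda>s. \<chi> i. \<rho> i s) has_derivative (\<lambda>v. \<chi> i. \<rho>' i v)) (at s)"
      by (simp add: sum_axis_eq)
    then have "((\<lambda>s. f (\<chi> i. \<rho> i s)) has_derivative (\<lambda>v. f' (\<chi> i. \<rho>' i v))) (at s)"
      using f'(1) by (rule has_derivative_compose)
    moreover have "f' (\<chi> i. \<rho>' i (c *s v)) = c * f' (\<chi> i. \<rho>' i v)" for c v
      using f'(2)[of c "\<chi> i. \<rho>' i v"] 
      by (simp only: \<rho>'(2)) (simp add: vector_scalar_mult_def)
    ultimately show ?case by blast
  qed
qed

lemma holo_at0_compose_field:
  assumes "h analytic_on {g 0}" "holo_at0 g"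
  shows "holo_at0 (\<lambda>s. h (g s))"
proof -
  obtain e where e: "e > 0" "h holomorphic_on ball (g 0) e"
    using assms(1) by (auto simp: analytic_on_def)
  have "isCont g 0" by (rule holo_at0_continuous[OF assms(2)])
  then have "filterlim g (nhds (g 0)) (nhds 0)"
    by (simp add: isCont_def tendsto_at_iff_tendsto_nhds)
  then have "\<forall>\<^sub>F s in nhds 0. g s \<in> ball (g 0) e"
    using e(1) 
    by (intro topological_tendstoD[of g "g 0"]) auto
  then show ?thesis
    using assms(2) unfolding holo_at0_iff
  proof eventually_elim
    case (elim s)
    then obtain g' where g': "(g has_derivative g') (at s)" "\<And>c v. g' (c *s v) = c * g' v" by blast
    obtain D where "(h has_field_derivative D) (at (g s))"
      using e(2) elim(1) by (metis at_within_open holomorphic_on_def open_ball field_differentiable_def)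
    then have "((\<lambda>s. h (g s)) has_derivative (\<lambda>v. D * g' v)) (at s)"
      using g'(1) unfolding has_field_derivative_def by (rule has_derivative_compose[rotated])
    then show ?case using g'(2) by (intro exI[of _ "\<lambda>v. D * g' v"]) auto
  qed
qed

definition partial_deriv :: "'n::finite \<Rightarrow> (complex^'n \<Rightarrow> complex) \<Rightarrow> complex^'n \<Rightarrow> complex" where
  "partial_deriv i f s = deriv (\<lambda>z. f (s + axis i z)) 0"

lemma has_field_derivative_along_axis:
  fixes f :: "complex^'n::finite \<Rightarrow> complex" and z :: complex
  assumes "(f has_derivative f') (at (s + axis i z))" "\<And>c v. f' (c *s v) = c * f' v"
  shows "((\<lambda>z. f (s + axis i z)) has_field_derivative f' (axis i 1)) (at z)"
proof -
  have "((\<lambda>z. s + axis i z) has_derivative axis i) (at z)"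
    using has_derivative_add[OF has_derivative_const[of s "at z"]
        bounded_linear_imp_has_derivative[OF bounded_linear_axis[of i], of "at z"]] by simp
  from has_derivative_compose[OF this assms(1)]
  show ?thesis
    unfolding has_field_derivative_def
  proof (rule has_derivative_eq_rhs)
    show "(\<lambda>v. f' (axis i v)) = (*) (f' (axis i 1))"
    proof
      fix v
      have "f' (axis i v) = f' (v *s axis i 1)" by (simp only: axis_scale)
      also have "\<dots> = f' (axis i 1) * v" by (simp only: assms(2) mult.commute)
      finally show "f' (axis i v) = f' (axis i 1) * v" .
    qed
  qed
qed

lemma partial_deriv_eq:
  assumes "(f has_derivative f') (at s)" "\<And>c v. f' (c *s v) = c * f' v"
  shows "partial_deriv i f s = f' (axis i 1)"
proof -
  have eq: "s + axis i 0 = s" by (simp add: vec_eq_iff axis_def)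
  show ?thesis
    unfolding partial_deriv_def
    by (rule DERIV_imp_deriv, rule has_field_derivative_along_axis, unfold eq) (rule assms)+
qed

lemma polydisk_shift:
  assumes "s \<in> polydisk a" "norm z \<le> b"
  shows "s + axis i z \<in> polydisk (a + b)"
  unfolding polydisk_def
proof (intro CollectI allI)
  fix j
  have "norm (axis i z $ j) \<le> b" using assms(2) norm_ge_zero[of z] by (auto simp: axis_def simp del: norm_ge_zero)
  moreover have "norm (s $ j) < a" using assms(1) by (simp add: polydisk_def)
  ultimately show "norm ((s + axis i z) $ j) < a + b"
    using norm_triangle_ineq[of "s $ j" "axis i z $ j"] by simp
qed

lemma partial_deriv_integral:
  fixes f :: "complex^'n::finite \<Rightarrow> complex"
  assumes f: "holo_on f (polydisk (a + b))" and s: "s \<in> polydisk a" and b: "b > 0"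
  defines "p \<equiv> (\<lambda>t::real. complex_of_real b * exp (2 * of_real pi * \<i> * of_real t))"
  shows "partial_deriv i f s = integral (cbox 0 1) (\<lambda>t. inverse (p t) * f (s + axis i (p t)))"
proof -
  have ex: "\<exists>D. ((\<lambda>z. f (s + axis i z)) has_field_derivative D) (at z)" if "norm z \<le> b" for z
  proof -
    have "s + axis i z \<in> polydisk (a + b)" using s that by (rule polydisk_shift)
    then have "\<exists>f'. (f has_derivative f') (at (s + axis i z)) \<and> (\<forall>c v. f' (c *s v) = c * f' v)"
      by (rule f[unfolded holo_on_def, rule_format])
    then obtain f' where f': "(f has_derivative f') (at (s + axis i z))" "\<forall>c v. f' (c *s v) = c * f' v"
      by (elim exE conjE)
    show ?thesis
      by (rule exI, rule has_field_derivative_along_axis[OF f'(1)]) (rule f'(2)[rule_format])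
  qed
  let ?g = "\<lambda>z. f (s + axis i z)"
  have "isCont ?g z" if "norm z \<le> b" for z
    using ex[OF that] by (elim exE) (rule DERIV_isCont)
  then have "continuous_on (cball 0 b) ?g"
    by (intro continuous_at_imp_continuous_on ballI) simp
  moreover have "?g holomorphic_on ball 0 b"
    unfolding holomorphic_on_def field_differentiable_def
  proof
    fix z :: complex assume "z \<in> ball 0 b"
    then obtain D where "(?g has_field_derivative D) (at z)" using ex[of z] by auto
    then show "\<exists>D. (?g has_field_derivative D) (at z within ball 0 b)"
      by (rule exI[where x = D, OF has_field_derivative_at_within])
  qed
  ultimately have "(?g has_field_derivative (1 / (2 * of_real pi * \<i>) *
      contour_integral (circlepath 0 b) (\<lambda>u. ?g u / (u - 0)^2))) (at 0)"
    by (rule Cauchy_derivative_integral_circlepath(2)) (use b in simp)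
  then have "partial_deriv i f s = 1 / (2 * of_real pi * \<i>) *
      contour_integral (circlepath 0 b) (\<lambda>u. ?g u / (u - 0)^2)"
    unfolding partial_deriv_def by (rule DERIV_imp_deriv)
  also have "\<dots> = integral {0..1} (\<lambda>t. 1 / (2 * of_real pi * \<i>) *
      (?g (p t) / (p t)^2 * (2 * of_real pi * \<i> * p t)))"
    unfolding contour_integral_integral
    unfolding vector_derivative_circlepath
    by (subst integral_mult_right) (simp_all add: circlepath p_def mult_ac)
  also have "\<dots> = integral {0..1} (\<lambda>t. inverse (p t) * ?g (p t))"
    using b by (intro integral_cong) (auto simp: field_simps power2_eq_square p_def)
  finally show ?thesis by simp
qed

lemma holo_on_imp_continuous_on: assumes "holo_on f S" shows "continuous_on S f"
proof (intro continuous_at_imp_continuous_on ballI)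
  fix z assume "z \<in> S"
  with assms obtain f' where "(f has_derivative f') (at z)" unfolding holo_on_def by blast
  then show "isCont f z" by (rule has_derivative_continuous)
qed

lemma continuous_on_axis [continuous_intros]:
  "continuous_on S f \<Longrightarrow> continuous_on S (\<lambda>x. axis i (f x) :: complex^'n::finite)"
  by (rule bounded_linear.continuous_on[OF bounded_linear_axis])

lemma continuous_on_partial_deriv:
  fixes f :: "complex^'n::finite \<Rightarrow> complex"
  assumes f: "holo_on f (polydisk (a + b))" and b: "b > 0"
  shows "continuous_on (polydisk a) (partial_deriv i f)"
proof -
  define p where "p = (\<lambda>t::real. complex_of_real b * exp (2 * of_real pi * \<i> * of_real t))"
  have [simp]: "norm (p t) = b" "p t \<noteq> 0" for t using b by (auto simp: p_def norm_mult)
  have p: "continuous_on S p" for S unfolding p_def by (intro continuous_intros)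
  have "continuous_on (polydisk a \<times> cbox 0 1) (\<lambda>(s, t). inverse (p t) * f (s + axis i (p t)))"
    unfolding split_beta
    by (intro continuous_intros continuous_on_compose2[OF p]
         continuous_on_compose2[OF holo_on_imp_continuous_on[OF f]])
       (auto intro: polydisk_shift)
  then have "continuous_on (polydisk a)
      (\<lambda>s. integral (cbox 0 1) (\<lambda>t. inverse (p t) * f (s + axis i (p t))))"
    by (rule integral_continuous_on_param)
  then show ?thesis
    using partial_deriv_integral[OF f _ b] unfolding p_def by (simp cong: continuous_on_cong)
qed

lemma holo_on_partial_deriv:
  fixes f :: "complex^'n::finite \<Rightarrow> complex"
  assumes f: "holo_on f (polydisk (a + b + b))" and b: "b > 0"
  shows "holo_on (partial_deriv i f) (polydisk a)"
proof -
  define p where "p = (\<lambda>t::real. complex_of_real b * exp (2 * of_real pi * \<i> * of_real t))"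
  have [simp]: "norm (p t) = b" "p t \<noteq> 0" for t using b by (auto simp: p_def norm_mult)
  have p: "continuous_on S p" for S unfolding p_def by (intro continuous_intros)
  have sub: "polydisk (a + b) \<subseteq> (polydisk (a + b + b) :: (complex^'n) set)"
    by (rule polydisk_mono) (use b in simp)
  have f': "holo_on f (polydisk (a + b))" using f sub unfolding holo_on_def by blast
  define D where "D s = Blinfun (\<lambda>v. \<Sum>j\<in>UNIV. v $ j * partial_deriv j f s)" for s
  have D_apply: "blinfun_apply (D s) = (\<lambda>v. \<Sum>j\<in>UNIV. v $ j * partial_deriv j f s)" for s
    unfolding D_def
    by (rule bounded_linear_Blinfun_apply)
       (rule bounded_linear_sum, rule bounded_linear_mult_const, rule bounded_linear_vec_nth)
  have D_lin: "blinfun_apply (D s) (c *s v) = c * blinfun_apply (D s) v" for s c v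
    by (simp add: D_apply sum_distrib_left mult.assoc)
  have D: "(f has_derivative blinfun_apply (D s)) (at s)" if s: "s \<in> polydisk (a + b)" for s
  proof -
    obtain f' where f': "(f has_derivative f') (at s)" "\<And>c v. f' (c *s v) = c * f' v"
      using f'[unfolded holo_on_def, rule_format, OF s] by blast
    have f'_eq: "f' v = (\<Sum>j\<in>UNIV. v $ j * f' (axis j 1))" for v
    proof -
      have "f' v = f' (\<Sum>j\<in>UNIV. v $ j *s axis j 1)"
        using sum_axis_eq[of "\<lambda>j. v $ j"] by (simp only: axis_scale vec_lambda_eta)
      also have "\<dots> = (\<Sum>j\<in>UNIV. f' (v $ j *s axis j 1))"
        by (rule linear_sum[OF has_derivative_linear[OF f'(1)]])
      finally show ?thesis by (simp only: f'(2))
    qed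
    have "f' = blinfun_apply (D s)"
      unfolding D_apply partial_deriv_eq[OF f'] using f'_eq by (rule ext)
    with f'(1) show ?thesis by simp
  qed
  have D_cont: "continuous_on (polydisk (a + b)) D"
    by (rule continuous_on_blinfun_componentwise)
       (auto simp: D_apply intro!: continuous_intros continuous_on_partial_deriv[OF f b])
  define E where "E s t = blinfun_mult_right (inverse (p t)) o\<^sub>L D (s + axis i (p t))" for s t
  have mem: "s + axis i (p t) \<in> polydisk (a + b)" if "s \<in> polydisk a" for s t
    using that by (rule polydisk_shift) simp
  have E_cont: "continuous_on (polydisk a \<times> cbox 0 1) (\<lambda>(s, t). E s t)"
    unfolding split_beta E_def
    by (intro continuous_intros continuous_on_compose2[OF p] continuous_on_compose2[OF D_cont]
          bounded_linear.continuous_on[OF bounded_linear_blinfun_mult_right])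
       (auto intro: mem)
  have deriv: "(partial_deriv i f has_derivative integral (cbox 0 1) (E s)) (at s)"
    if s: "s \<in> polydisk a" for s
  proof -
    have "((\<lambda>s. integral (cbox 0 1) (\<lambda>t. inverse (p t) * f (s + axis i (p t))))
        has_derivative integral (cbox 0 1) (E s)) (at s within polydisk a)"
    proof (rule leibniz_rule[OF _ _ E_cont s convex_polydisk])
      fix x :: "complex^'n" and t :: real assume x: "x \<in> polydisk a" "t \<in> cbox 0 1"
      have "((\<lambda>x. x + axis i (p t)) has_derivative (\<lambda>v. v)) (at x within polydisk a)"
        by (auto intro!: derivative_eq_intros)
      from has_derivative_compose[OF this D[OF mem[OF x(1)]]]
      show "((\<lambda>x. inverse (p t) * f (x + axis i (p t))) has_derivative blinfun_apply (E x t))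
          (at x within polydisk a)"
        unfolding E_def by (auto intro!: derivative_eq_intros)
    next
      fix x :: "complex^'n" assume x: "x \<in> polydisk a"
      show "(\<lambda>t. inverse (p t) * f (x + axis i (p t))) integrable_on cbox 0 1"
        by (intro integrable_continuous continuous_intros p
              continuous_on_compose2[OF holo_on_imp_continuous_on[OF f']])
           (auto intro: mem x)
    qed
    then have "(partial_deriv i f has_derivative integral (cbox 0 1) (E s)) (at s within polydisk a)"
      by (rule has_derivative_transform[OF s, rotated])
         (simp add: partial_deriv_integral[OF f' _ b] p_def)
    then show ?thesis using s open_polydisk by (metis at_within_open)
  qed
  have int: "E s integrable_on cbox 0 1" if s: "s \<in> polydisk a" for s
  proof (rule integrable_continuous)
    have "continuous_on (cbox 0 1) (Pair s)" by (intro continuous_intros)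
    from continuous_on_compose2[OF E_cont this] s show "continuous_on (cbox 0 1) (E s)"
      by (simp add: image_subset_iff)
  qed
  have int_apply: "blinfun_apply (integral (cbox 0 1) (E s)) v
      = integral (cbox 0 1) (\<lambda>t. blinfun_apply (E s t) v)" if "s \<in> polydisk a" for s v
    using integral_linear[OF int[OF that] blinfun.bounded_linear_left[of v]]
    unfolding o_def by (rule sym)
  have "blinfun_apply (integral (cbox 0 1) (E s)) (c *s v)
      = c * blinfun_apply (integral (cbox 0 1) (E s)) v" if s: "s \<in> polydisk a" for s c v
  proof -
    have "blinfun_apply (E s t) (c *s v) = c * blinfun_apply (E s t) v" for t
      by (simp add: E_def D_lin)
    then show ?thesis unfolding int_apply[OF s] by (simp only: integral_mult_right)
  qed
  then show ?thesis using deriv unfolding holo_on_def by blast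
qed

lemma holo_at0_partial_deriv:
  assumes "holo_at0 f" shows "holo_at0 (partial_deriv i f)"
proof -
  obtain e where e: "e > 0" "holo_on f (polydisk e)" using assms by (auto simp: holo_at0_def)
  have "holo_on (partial_deriv i f) (polydisk (e / 3))"
    by (rule holo_on_partial_deriv[where b = "e / 3"]) (use e in auto)
  then show ?thesis using e(1) unfolding holo_at0_def by (intro exI[of _ "e / 3"]) auto
qed

section \<open>The ring of germs at 0 of holomorphic functions\<close>

definition germ_rel :: "(complex^'n::finite \<Rightarrow> complex) \<Rightarrow> (complex^'n \<Rightarrow> complex) \<Rightarrow> bool" where
  "germ_rel f g \<longleftrightarrow> holo_at0 f \<and> holo_at0 g \<and> (\<forall>\<^sub>F s in nhds 0. f s = g s)"

lemma germ_rel_refl: "holo_at0 f \<Longrightarrow> germ_rel f f"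
  by (simp add: germ_rel_def)

lemma germ_rel_at0: "germ_rel f g \<Longrightarrow> f 0 = g 0"
  by (auto simp: germ_rel_def dest: eventually_nhds_x_imp_x)

quotient_type 'n hgerm = "complex^'n::finite \<Rightarrow> complex" / partial: germ_rel
proof (rule part_equivpI)
  show "\<exists>f. germ_rel f f" using germ_rel_refl[OF holo_at0_const] by blast
  show "symp germ_rel" by (auto simp: symp_def germ_rel_def elim: eventually_mono)
  show "transp germ_rel" by (auto simp: transp_def germ_rel_def elim: eventually_elim2)
qed

instantiation hgerm :: (finite) comm_ring_1
begin

lift_definition zero_hgerm :: "'a hgerm" is "\<lambda>s. 0" by (simp add: germ_rel_def)
lift_definition one_hgerm :: "'a hgerm" is "\<lambda>s. 1" by (simp add: germ_rel_def)

lift_definition plus_hgerm :: "'a hgerm \<Rightarrow> 'a hgerm \<Rightarrow> 'a hgerm" is "\<lambda>f g s. f s + g s"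
  unfolding germ_rel_def by (auto intro: holo_at0_add elim: eventually_elim2)

lift_definition times_hgerm :: "'a hgerm \<Rightarrow> 'a hgerm \<Rightarrow> 'a hgerm" is "\<lambda>f g s. f s * g s"
  unfolding germ_rel_def by (auto intro: holo_at0_mult elim: eventually_elim2)

lift_definition uminus_hgerm :: "'a hgerm \<Rightarrow> 'a hgerm" is "\<lambda>f s. - f s"
  unfolding germ_rel_def by (auto intro: holo_at0_minus elim: eventually_mono)

lift_definition minus_hgerm :: "'a hgerm \<Rightarrow> 'a hgerm \<Rightarrow> 'a hgerm" is "\<lambda>f g s. f s - g s"
  unfolding germ_rel_def
  by (auto intro: holo_at0_diff elim: eventually_elim2)

instance
proof
  fix a b c :: "'a hgerm"
  show "a + b + c = a + (b + c)"
    by transfer (auto intro!: germ_rel_refl holo_at0_add simp: add.assoc germ_rel_def)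
  show "a + b = b + a"
    by transfer (auto intro!: germ_rel_refl holo_at0_add simp: add.commute germ_rel_def)
  show "0 + a = a" by transfer simp
  show "- a + a = 0" by transfer (auto simp: germ_rel_def)
  show "a - b = a + - b" by transfer (auto intro!: holo_at0_diff holo_at0_add holo_at0_minus simp: germ_rel_def)
  show "a * b * c = a * (b * c)"
    by transfer (auto intro!: holo_at0_mult simp: mult.assoc germ_rel_def)
  show "a * b = b * a" by transfer (auto intro!: holo_at0_mult simp: mult.commute germ_rel_def)
  show "1 * a = a" by transfer simp
  show "(a + b) * c = a * c + b * c"
    by transfer (auto intro!: holo_at0_mult holo_at0_add simp: algebra_simps germ_rel_def)
  show "(0 :: 'a hgerm) \<noteq> 1" by transfer (auto simp: germ_rel_def dest: eventually_nhds_x_imp_x)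
qed

end

lift_definition germ_const :: "complex \<Rightarrow> 'n::finite hgerm" is "\<lambda>c s. c"
  by (simp add: germ_rel_def)

lift_definition germ_coord :: "'n::finite \<Rightarrow> 'n hgerm" is "\<lambda>i s. s $ i"
  by (simp add: germ_rel_def)

lift_definition germ_at0 :: "'n::finite hgerm \<Rightarrow> complex" is "\<lambda>f. f 0"
  by (rule germ_rel_at0)

lift_definition germ_partial :: "'n::finite \<Rightarrow> 'n hgerm \<Rightarrow> 'n hgerm" is partial_deriv
proof -
  fix i :: 'n and f g :: "complex^'n \<Rightarrow> complex" assume fg: "germ_rel f g"
  have "\<forall>\<^sub>F s in nhds 0. \<forall>\<^sub>F s' in nhds s. f s' = g s'"
    using fg by (simp add: germ_rel_def eventually_eventually)
  then have "\<forall>\<^sub>F s in nhds 0. partial_deriv i f s = partial_deriv i g s"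
  proof eventually_elim
    case (elim s)
    have eq: "s + axis i 0 = s" by (simp add: vec_eq_iff axis_def)
    have "isCont (\<lambda>z :: complex. s + axis i z) 0" 
      by (intro continuous_intros bounded_linear.continuous[OF bounded_linear_axis])
    then have "filterlim (\<lambda>z :: complex. s + axis i z) (nhds s) (nhds 0)"
      using tendsto_at_iff_tendsto_nhds[of "\<lambda>z :: complex. s + axis i z" 0]
      unfolding isCont_def eq by simp
    then have "\<forall>\<^sub>F z in nhds 0. f (s + axis i z) = g (s + axis i z)"
      by (rule eventually_compose_filterlim[OF elim])
    then show ?case unfolding partial_deriv_def by (rule deriv_cong_ev) simp
  qed
  with fg show "germ_rel (partial_deriv i f) (partial_deriv i g)"
    by (auto simp: germ_rel_def intro: holo_at0_partial_deriv)
qed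

lift_definition germ_comp :: "'n::finite hgerm \<Rightarrow> ('n \<Rightarrow> 'n hgerm) \<Rightarrow> 'n hgerm"
  is "\<lambda>f \<rho>. if \<forall>i. \<rho> i 0 = 0 then (\<lambda>s. f (\<chi> i. \<rho> i s)) else (\<lambda>s. 0)"
proof -
  fix f g :: "complex^'n \<Rightarrow> complex" and \<rho> \<sigma> :: "'n \<Rightarrow> complex^'n \<Rightarrow> complex"
  assume fg: "germ_rel f g" and \<rho>\<sigma>: "\<And>i. germ_rel (\<rho> i) (\<sigma> i)"
  have eq0: "\<rho> i 0 = \<sigma> i 0" for i using \<rho>\<sigma> by (rule germ_rel_at0)
  show "germ_rel (if \<forall>i. \<rho> i 0 = 0 then (\<lambda>s. f (\<chi> i. \<rho> i s)) else (\<lambda>s. 0))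
    (if \<forall>i. \<sigma> i 0 = 0 then (\<lambda>s. g (\<chi> i. \<sigma> i s)) else (\<lambda>s. 0))"
  proof (cases "\<forall>i. \<sigma> i 0 = 0")
    case True
    have holo: "holo_at0 f" "holo_at0 g" "\<And>i. holo_at0 (\<rho> i)" "\<And>i. holo_at0 (\<sigma> i)"
      using fg \<rho>\<sigma> by (auto simp: germ_rel_def)
    have "\<forall>\<^sub>F s in nhds 0. f (\<chi> i. \<rho> i s) = g (\<chi> i. \<rho> i s)"
      using fg holo(3) True eq0 unfolding germ_rel_def
      by (intro eventually_compose_filterlim[of "\<lambda>s. f s = g s", OF _ tendsto_vec_lambda_holo]) auto
    moreover have "\<forall>\<^sub>F s in nhds 0. \<forall>i. \<rho> i s = \<sigma> i s"
      using \<rho>\<sigma> unfolding germ_rel_def by (intro eventually_all_finite) auto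
    ultimately have "\<forall>\<^sub>F s in nhds 0. f (\<chi> i. \<rho> i s) = g (\<chi> i. \<sigma> i s)"
      by eventually_elim simp
    then show ?thesis
      using True eq0 holo by (auto simp: germ_rel_def intro!: holo_at0_compose)
  next
    case False
    then show ?thesis unfolding eq0 if_not_P[OF False] by (simp add: germ_rel_def)
  qed
qed

lift_definition germ_fps :: "complex fps \<Rightarrow> 'n::finite hgerm \<Rightarrow> 'n hgerm"
  is "\<lambda>h g. if ereal (norm (g 0)) < fps_conv_radius h then (\<lambda>s. eval_fps h (g s)) else (\<lambda>s. 0)"
proof -
  fix h :: "complex fps" and f g :: "complex^'n \<Rightarrow> complex" assume fg: "germ_rel f g"
  have "holo_at0 (\<lambda>s. eval_fps h (f s))" if "germ_rel f f'" "ereal (norm (f 0)) < fps_conv_radius h"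
    for f f' :: "complex^'n \<Rightarrow> complex"
  proof (rule holo_at0_compose_field[where h = "eval_fps h" and g = f])
    show "eval_fps h analytic_on {f 0}"
      by (rule analytic_on_eval_fps) (use that(2) in auto)
    show "holo_at0 f" using that(1) by (simp add: germ_rel_def)
  qed
  moreover have "germ_rel g f" using fg by (auto simp: germ_rel_def elim: eventually_mono)
  moreover have "\<forall>\<^sub>F s in nhds 0. eval_fps h (f s) = eval_fps h (g s)"
    using fg unfolding germ_rel_def by (auto elim: eventually_mono)
  ultimately show "germ_rel (if ereal (norm (f 0)) < fps_conv_radius h then (\<lambda>s. eval_fps h (f s)) else (\<lambda>s. 0))
    (if ereal (norm (g 0)) < fps_conv_radius h then (\<lambda>s. eval_fps h (g s)) else (\<lambda>s. 0))"
    using fg germ_rel_at0[OF fg] by (auto simp: germ_rel_def)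
qed

section \<open>Microdifferential coefficients\<close>

text \<open>
  Elements of \<open>\<O>\<^sub>S((\<partial>\<^sub>t\<^sup>-\<^sup>1))\<close> (germs at \<open>0 \<in> S\<close>) are formal Laurent series in the indeterminate
  \<open>fls_X = \<partial>\<^sub>t\<^sup>-\<^sup>1\<close> over the ring of germs: \<^term>\<open>fls_nth a k\<close> is the coefficient of \<open>\<partial>\<^sub>t\<^sup>-\<^sup>k\<close>.
\<close>

definition dt_pow :: "int \<Rightarrow> 'n::finite hgerm fls" where
  "dt_pow m = fls_X_intpow (- m)"

abbreviation scalar :: "'n::finite hgerm \<Rightarrow> 'n hgerm fls" where
  "scalar g \<equiv> fls_const g"

text \<open>
  Convergence of \<open>\<Sum> g\<^sub>k x\<^sup>k / k!\<close> is locally uniform convergence near \<open>(s, x) = (0, 0)\<close>, on a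
  polydisk on which all \<open>g\<^sub>k\<close> are defined.
\<close>

definition conv_ops0 :: "'n::finite hgerm fls set" where
  "conv_ops0 = {a. (\<forall>k<0. fls_nth a k = 0) \<and>
     (\<exists>d>0. \<exists>e>0. \<exists>G :: nat \<Rightarrow> complex^'n \<Rightarrow> complex.
        (\<forall>k. holo_on (G k) (polydisk d) \<and> fls_nth a (int k) = abs_hgerm (G k)) \<and>
        uniformly_convergent_on (polydisk d \<times> ball 0 e)
          (\<lambda>N (s, x). \<Sum>k<N. G k s * x ^ k / fact k))}"

definition conv_ops :: "'n::finite hgerm fls set" where
  "conv_ops = {a. \<exists>m::nat. fls_X ^ m * a \<in> conv_ops0}"

section \<open>The Gauss-Manin system and the Brieskorn lattice\<close>

text \<open>
  An element \<open>\<Sum> a\<^sub>j e\<^sub>j\<close> (\<open>0 \<le> j \<le> r\<close>) of \<open>\<G>\<^sub>S\<close> is the function \<open>j \<mapsto> a\<^sub>j\<close>, an element of \<open>H\<close> the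
  function of its coordinates with respect to \<open>e\<^sub>0, \<dots>, e\<^sub>r\<close>; both vanish beyond \<open>r\<close>.
\<close>

type_synonym 'n gm = "nat \<Rightarrow> 'n hgerm fls"

definition smul :: "'n::finite hgerm fls \<Rightarrow> 'n gm \<Rightarrow> 'n gm" where
  "smul a u = (\<lambda>j. a * u j)"

definition gm_carrier :: "nat \<Rightarrow> 'n::finite gm set" where
  "gm_carrier r = {u. (\<forall>j\<le>r. u j \<in> conv_ops) \<and> (\<forall>j>r. u j = 0)}"

text \<open>\<open>t \<partial>\<^sub>t\<^sup>-\<^sup>k = (k + 1) \<partial>\<^sub>t\<^sup>-\<^sup>k\<^sup>-\<^sup>1\<close> on each component, i.e. \<open>t = X \<circ> d/dX \<circ> X\<close> for \<open>X = \<partial>\<^sub>t\<^sup>-\<^sup>1\<close>.\<close>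

definition t_act :: "'n::finite gm \<Rightarrow> 'n gm" where
  "t_act u = (\<lambda>j. fls_X * fls_deriv (fls_X * u j))"

definition ds_act :: "'n::finite \<Rightarrow> 'n gm \<Rightarrow> 'n gm" where
  "ds_act i u = (\<lambda>j. Abs_fls (\<lambda>k. germ_partial i (fls_nth (u j) k)))"

definition pullback :: "('n::finite \<Rightarrow> 'n hgerm) \<Rightarrow> 'n gm \<Rightarrow> 'n gm" where
  "pullback \<rho> u = (\<lambda>j. Abs_fls (\<lambda>k. germ_comp (fls_nth (u j) k) \<rho>))"

definition evec :: "nat \<Rightarrow> nat \<Rightarrow> complex" where
  "evec j = (\<lambda>i. if i = j then 1 else 0)"

definition incl :: "(nat \<Rightarrow> complex) \<Rightarrow> 'n::finite gm" where
  "incl x = (\<lambda>j. scalar (germ_const (x j)))"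

lemma t_act_dt_pow:
  "t_act (smul (dt_pow (- k)) (incl (evec j))) =
     smul (of_int (k + 1) * dt_pow (- k - 1)) (incl (evec j))"
proof -
  have *: "x + (- k - 1) = 0 \<longleftrightarrow> x = k + 1" for x :: int by auto
  have "fls_X * fls_deriv (fls_X * (fls_X_intpow k * fls_const c)) =
      of_int (k + 1) * fls_X_intpow (k + 1) * fls_const c" for c :: "'a hgerm"
    by (rule fls_eqI)
       (auto simp: fls_X_times_conv_shift fls_X_intpow_times_conv_shift fls_of_int mult.assoc *)
  then show ?thesis
    by (simp add: t_act_def smul_def incl_def dt_pow_def add.commute)
qed

text \<open>The coordinate \<open>s\<^sub>j\<close> (\<open>1 \<le> j \<le> r\<close>) is the one with index \<open>ix j\<close>.\<close>

definition vsec0 :: "nat \<Rightarrow> (nat \<Rightarrow> 'n::finite) \<Rightarrow> complex fps \<Rightarrow> 'n gm" where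
  "vsec0 r ix h = incl (evec 0)
     + (\<Sum>j = 1..r. smul (scalar (germ_coord (ix j)) * dt_pow (1 - int j)) (incl (evec j)))
     + smul (scalar (germ_fps h (germ_coord (ix 1)))) (incl (evec 2))"

definition vsec :: "nat \<Rightarrow> (nat \<Rightarrow> 'n::finite) \<Rightarrow> complex fps \<Rightarrow> nat \<Rightarrow> 'n gm" where
  "vsec r ix h j =
     (if j = 0 then vsec0 r ix h else smul (dt_pow (-1)) (ds_act (ix j) (vsec0 r ix h)))"

definition brieskorn :: "nat \<Rightarrow> (nat \<Rightarrow> 'n::finite) \<Rightarrow> complex fps \<Rightarrow> 'n gm set" where
  "brieskorn r ix h =
     {(\<Sum>j = 0..r. smul (a j) (vsec r ix h j)) | a. \<forall>j\<le>r. a j \<in> conv_ops0}"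

text \<open>The convergent power series that vanish to order at least 2.\<close>

definition admissible :: "complex fps \<Rightarrow> bool" where
  "admissible h \<longleftrightarrow>
     fps_conv_radius h > 0 \<and> fps_nth h 0 = 0 \<and> fps_nth (fps_deriv h) 0 = 0"

section \<open>Normalized isomorphisms\<close>

text \<open>A germ of maps \<open>\<rho>\<close> is given by its components \<open>\<rho> (ix j)\<close>, the pullbacks of the coordinates.\<close>

definition germ_iso :: "('n::finite \<Rightarrow> 'n hgerm) \<Rightarrow> bool" where
  "germ_iso \<rho> \<longleftrightarrow> (\<forall>i. germ_at0 (\<rho> i) = 0) \<and>
     (\<exists>\<sigma>. (\<forall>i. germ_at0 (\<sigma> i) = 0) \<and>
        (\<forall>i. germ_comp (\<rho> i) \<sigma> = germ_coord i) \<and> (\<forall>i. germ_comp (\<sigma> i) \<rho> = germ_coord i))"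

text \<open>
  The sections \<open>\<rho>\<^sup>*e\<^sub>j\<close> are a horizontal basis of the pullback of \<open>\<G>\<^sub>S\<close>, which is thereby identified
  with \<open>\<G>\<^sub>S\<close>. The matrix entry \<open>A\<^sub>i\<^sub>j\<close> is the \<open>j\<close>-th component of \<open>\<phi>(e\<^sub>i)\<close>; that the matrix is
  constant and triangular follows from the other conditions and is not required.
\<close>

definition normalized_iso ::
  "nat \<Rightarrow> (nat \<Rightarrow> 'n::finite) \<Rightarrow> complex fps \<Rightarrow> complex fps \<Rightarrow>
     ('n \<Rightarrow> 'n hgerm) \<Rightarrow> ('n gm \<Rightarrow> 'n gm) \<Rightarrow> bool" where
  "normalized_iso r ix h h' \<rho> \<phi> \<longleftrightarrow>
     germ_iso \<rho> \<and>
     bij_betw \<phi> (gm_carrier r) (gm_carrier r) \<and>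
     (\<forall>u\<in>gm_carrier r. \<forall>v\<in>gm_carrier r. \<phi> (u + v) = \<phi> u + \<phi> v) \<and>
     (\<forall>a\<in>conv_ops. \<forall>u\<in>gm_carrier r. \<phi> (smul a u) = smul a (\<phi> u)) \<and>
     (\<forall>u\<in>gm_carrier r. \<phi> (t_act u) = t_act (\<phi> u)) \<and>
     (\<forall>i. \<forall>u\<in>gm_carrier r. \<phi> (ds_act i u) = ds_act i (\<phi> u)) \<and>
     \<phi> ` brieskorn r ix h = pullback \<rho> ` brieskorn r ix h' \<and>
     (\<forall>i\<le>r. \<phi> (incl (evec i)) i = 1)"

section \<open>Opposite filtrations\<close>

definition Hspace :: "nat \<Rightarrow> (nat \<Rightarrow> complex) set" where
  "Hspace r = {x. \<forall>i>r. x i = 0}"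

definition F0 :: "nat \<Rightarrow> int \<Rightarrow> (nat \<Rightarrow> complex) set" where
  "F0 r p = {x \<in> Hspace r. \<forall>i. int i > p \<longrightarrow> x i = 0}"

definition decreasing_filtration :: "nat \<Rightarrow> (int \<Rightarrow> (nat \<Rightarrow> complex) set) \<Rightarrow> bool" where
  "decreasing_filtration r U \<longleftrightarrow>
     (\<forall>p. module.subspace (\<lambda>c x i. c * x i) (U p) \<and> U p \<subseteq> Hspace r \<and> U (p + 1) \<subseteq> U p)"

definition opposite :: "nat \<Rightarrow> (int \<Rightarrow> (nat \<Rightarrow> complex) set) \<Rightarrow> bool" where
  "opposite r U \<longleftrightarrow> decreasing_filtration r U \<and>
     (\<forall>p. F0 r p \<inter> U (p + 1) = {0} \<and> {x + y | x y. x \<in> F0 r p \<and> y \<in> U (p + 1)} = Hspace r)"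

definition ebasis :: "nat \<Rightarrow> (int \<Rightarrow> (nat \<Rightarrow> complex) set) \<Rightarrow> nat \<Rightarrow> nat \<Rightarrow> complex" where
  "ebasis r U j =
     (THE x. x \<in> U (int j) \<inter> F0 r (int j) \<and> x - evec j \<in> F0 r (int j - 1))"

definition Amatrix ::
  "nat \<Rightarrow> (int \<Rightarrow> (nat \<Rightarrow> complex) set) \<Rightarrow> nat \<Rightarrow> nat \<Rightarrow> complex" where
  "Amatrix r U =
     (THE A. (\<forall>i j. \<not> (j \<le> i \<and> i \<le> r) \<longrightarrow> A i j = 0) \<and> (\<forall>i\<le>r. A i i = 1) \<and>
        (\<forall>i\<le>r. evec i = (\<Sum>j = 0..i. (\<lambda>l. A i j * ebasis r U j l))))"

definition vprime ::
  "nat \<Rightarrow> (nat \<Rightarrow> 'n::finite) \<Rightarrow> complex fps \<Rightarrow> (int \<Rightarrow> (nat \<Rightarrow> complex) set) \<Rightarrow> 'n gm" where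
  "vprime r ix h U =
     (THE v. v \<in> brieskorn r ix h \<and>
        (\<exists>c :: nat \<Rightarrow> nat \<Rightarrow> 'n hgerm. v - incl (ebasis r U 0) =
           (\<Sum>k = 1..r. \<Sum>i = k..r. smul (scalar (c k i) * dt_pow (1 - int k)) (incl (ebasis r U i)))))"

definition basis_components ::
  "nat \<Rightarrow> (int \<Rightarrow> (nat \<Rightarrow> complex) set) \<Rightarrow> 'n::finite gm \<Rightarrow> nat \<Rightarrow> 'n hgerm fls" where
  "basis_components r U u =
     (THE a. (\<forall>i>r. a i = 0) \<and> u = (\<Sum>i = 0..r. smul (a i) (incl (ebasis r U i))))"

text \<open>The coefficient of \<open>\<partial>\<^sub>t\<^sup>1\<^sup>-\<^sup>k\<close> times the \<open>i\<close>-th adapted basis vector.\<close>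

definition basis_coeff ::
  "nat \<Rightarrow> (int \<Rightarrow> (nat \<Rightarrow> complex) set) \<Rightarrow> int \<Rightarrow> nat \<Rightarrow> 'n::finite gm \<Rightarrow> 'n hgerm" where
  "basis_coeff r U k i u = fls_nth (basis_components r U u i) (k - 1)"

definition gU ::
  "nat \<Rightarrow> (nat \<Rightarrow> 'n::finite) \<Rightarrow> complex fps \<Rightarrow> (int \<Rightarrow> (nat \<Rightarrow> complex) set) \<Rightarrow> nat \<Rightarrow> 'n hgerm" where
  "gU r ix h U j = basis_coeff r U (int j) j (vprime r ix h U)"

definition gtildeU ::
  "nat \<Rightarrow> (nat \<Rightarrow> 'n::finite) \<Rightarrow> complex fps \<Rightarrow> (int \<Rightarrow> (nat \<Rightarrow> complex) set) \<Rightarrow> 'n hgerm" where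
  "gtildeU r ix h U = basis_coeff r U 1 2 (vprime r ix h U)"

definition hU ::
  "nat \<Rightarrow> (nat \<Rightarrow> 'n::finite) \<Rightarrow> complex fps \<Rightarrow> (int \<Rightarrow> (nat \<Rightarrow> complex) set) \<Rightarrow> complex fps" where
  "hU r ix h U = (THE k. admissible k \<and> gtildeU r ix h U = germ_fps k (gU r ix h U 1))"

end

theory Submission
  imports Defs
begin

text \<open>
  The idea is to describe the lattice by finitely many equations between coefficients and to follow these
  equations through a change of basis of \<open>H\<close>. A section of \<open>\<G>\<^sub>S\<close> with components \<open>u\<^sub>j\<close> in
  \<open>\<O>\<^sub>S{{\<partial>\<^sub>t\<^sup>-\<^sup>1}}\<close> lies in the lattice of \<open>h\<close> iff four kinds of equations hold
  (\<open>lattice_eqs\<close>, \<open>brieskorn_iff\<close>). They involve the coefficients of \<open>u\<^sub>0, u\<^sub>1, u\<^sub>2\<close> of orders \<open>0\<close> and \<open>1\<close>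
  and those of \<open>u\<^sub>j\<close>, \<open>j \<ge> 3\<close>, of orders below \<open>j\<close>.

  Let \<open>B\<close> be the unitriangular matrix of the basis adapted to a filtration \<open>U\<close>, so that \<open>B = A\<^sup>-\<^sup>1\<close>. Rewriting the
  equations in that basis gives equations of the same shape, with new functions
  \<open>S\<^sub>1' = p (s\<^sub>1 - B\<^sub>2\<^sub>1 h)\<close>, \<open>H' = p h\<close>, \<open>S\<^sub>2' = s\<^sub>2 p / Q\<close>, \<open>S\<^sub>j' = s\<^sub>j p\<close> (\<open>j \<ge> 3\<close>), where
  \<open>1/p = 1 - B\<^sub>1\<^sub>0 (s\<^sub>1 - B\<^sub>2\<^sub>1 h) - B\<^sub>2\<^sub>0 h\<close> and \<open>Q = 1 - B\<^sub>2\<^sub>0 (h - s\<^sub>1 h') - B\<^sub>2\<^sub>1 h'\<close> are units in \<open>s\<^sub>1\<close>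
  (\<open>lattice_eqs_base_change\<close>). The other entries of \<open>B\<close> only touch coefficients of orders that the equations leave
  free. Now \<open>S\<^sub>1'\<close> is a coordinate in one variable, so \<open>H' = k(S\<^sub>1')\<close> for a unique convergent series \<open>k\<close>, and
  the rewritten equations are those of the lattice of \<open>k\<close> pulled back along \<open>\<rho> = (S\<^sub>1', \<dots>, S\<^sub>r')\<close>.
  That the coefficient of the remaining equation is \<open>k'(S\<^sub>1')\<close> follows by differentiating
  (\<open>transformed_series_deriv\<close>).

  Everything follows from this. The section \<open>v'\<^sub>0\<close> has, in the adapted basis, just the coefficients that the
  equations prescribe (\<open>vprime_eq\<close>); hence \<open>g\<^sub>j\<^sup>U = S\<^sub>j'\<close> and the coefficient of the second adapted basis vector is \<open>H'\<close>, so
  \<open>h\<^sup>U = k\<close> depends only on \<open>B\<^sub>1\<^sub>0, B\<^sub>2\<^sub>0, B\<^sub>2\<^sub>1\<close>. The change of basis together with \<open>\<rho>\<close> is a normalized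
  isomorphism onto the lattice of \<open>h\<^sup>U\<close> (\<open>normalized_iso_of_filtration\<close>). Conversely, compatibility with \<open>t\<close> and
  the \<open>\<partial>\<^sub>s\<close> makes the matrix of a normalized isomorphism constant, the equations at \<open>s = 0\<close> make it
  triangular, and the rows of its inverse define a filtration \<open>U\<close>; the pullback of the section \<open>v\<^sub>0\<close> of the target is then \<open>v'\<^sub>0\<close>
  written in the adapted basis, whence the series of the target is \<open>h\<^sup>U\<close> (\<open>filtration_of_normalized_iso\<close>).
\<close>


section \<open>Convergent power series\<close>

lemma fps_conv_radius_pos_add:
  "fps_conv_radius F > 0 \<Longrightarrow> fps_conv_radius G > 0 \<Longrightarrow> fps_conv_radius (F + G :: complex fps) > 0"
  using fps_conv_radius_add[of F G] by (meson less_le_trans min_less_iff_conj)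

lemma fps_conv_radius_pos_diff:
  "fps_conv_radius F > 0 \<Longrightarrow> fps_conv_radius G > 0 \<Longrightarrow> fps_conv_radius (F - G :: complex fps) > 0"
  using fps_conv_radius_diff[of F G] by (meson less_le_trans min_less_iff_conj)

lemma fps_conv_radius_pos_mult:
  "fps_conv_radius F > 0 \<Longrightarrow> fps_conv_radius G > 0 \<Longrightarrow> fps_conv_radius (F * G :: complex fps) > 0"
  using fps_conv_radius_mult[of F G] by (meson less_le_trans min_less_iff_conj)

lemma fps_conv_radius_pos_deriv:
  "fps_conv_radius F > 0 \<Longrightarrow> fps_conv_radius (fps_deriv F :: complex fps) > 0"
  using fps_conv_radius_deriv[of F] by (meson less_le_trans)

lemma fps_compose_convergent:
  fixes F G :: "complex fps"
  assumes "fps_conv_radius F > 0" "fps_conv_radius G > 0" "fps_nth G 0 = 0"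
  shows "fps_conv_radius (F oo G) > 0"
    and "\<forall>\<^sub>F z in nhds 0. eval_fps (F oo G) z = eval_fps F (eval_fps G z)"
  using has_fps_expansion_compose[OF eval_fps_has_fps_expansion eval_fps_has_fps_expansion, of F G] assms
  by (auto simp: has_fps_expansion_def)

text \<open>
  The formal inverse under composition converges because a holomorphic function with nonzero
  derivative has a holomorphic local inverse, whose expansion must be the formal one.
\<close>

lemma fps_conv_radius_pos_fps_inv:
  fixes G :: "complex fps"
  assumes G: "fps_conv_radius G > 0" "fps_nth G 0 = 0" "fps_nth G 1 \<noteq> 0"
  shows "fps_conv_radius (fps_inv G) > 0"
proof -
  let ?g = "eval_fps G"
  have g0: "?g 0 = 0" using G(2) by (simp add: eval_fps_at_0)
  have hol: "?g holomorphic_on eball 0 (fps_conv_radius G)" by (rule holomorphic_on_eval_fps) simp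
  have d0: "deriv ?g 0 \<noteq> 0"
    using G eval_fps_deriv[of 0 G] by (simp add: eval_fps_at_0 zero_ereal_def)
  have z: "(0 :: complex) \<in> eball 0 (fps_conv_radius G)" using G(1) by (simp add: zero_ereal_def)
  obtain e where e: "e > 0" "ball (0 :: complex) e \<subseteq> eball 0 (fps_conv_radius G)" "open (?g ` ball 0 e)" "inj_on ?g (ball 0 e)"
    by (rule has_complex_derivative_locally_invertible[OF hol z open_eball d0])
  obtain k where k: "k holomorphic_on (?g ` ball 0 e)" "\<And>z. z \<in> ball 0 e \<Longrightarrow> k (?g z) = z"
    by (rule holomorphic_has_inverse[OF holomorphic_on_subset[OF hol e(2)] open_ball e(4)]) blast
  have img0: "0 \<in> ?g ` ball 0 e" using g0 e(1) by (metis centre_in_ball imageI)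
  have "k analytic_on {0}" using k(1) e(3) img0 analytic_at by blast
  then have I: "k has_fps_expansion fps_expansion k 0" by (rule analytic_at_imp_has_fps_expansion_0)
  define I where "I = fps_expansion k 0"
  have "(k \<circ> ?g) has_fps_expansion (I oo G)"
    unfolding I_def
    by (rule has_fps_expansion_compose[OF I eval_fps_has_fps_expansion[OF G(1)] G(2)])
  moreover have "\<forall>\<^sub>F z in nhds 0. (k \<circ> ?g) z = z"
    using eventually_nhds_in_open[of "ball 0 e" "0 :: complex"] e(1) k(2) by (auto elim: eventually_mono)
  then have "(k \<circ> ?g) has_fps_expansion fps_X"
    by (auto simp: has_fps_expansion_def elim: eventually_mono)
  ultimately have IG: "I oo G = fps_X" by (rule fps_expansion_unique_complex)
  have "I = I oo (G oo fps_inv G)" using fps_inv_right[OF G(2,3)] by simp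
  also have "\<dots> = (I oo G) oo fps_inv G" by (rule fps_compose_assoc) (use G(2) in \<open>auto simp: fps_inv_def\<close>)
  also have "\<dots> = fps_inv G" unfolding IG by (simp add: fps_X_fps_compose_startby0 fps_inv_def)
  finally show ?thesis using I by (simp add: I_def has_fps_expansion_def)
qed

section \<open>Germs of holomorphic functions\<close>

lemma germ_relI:
  "holo_at0 f \<Longrightarrow> holo_at0 g \<Longrightarrow> \<forall>\<^sub>F s in nhds 0. f s = g s \<Longrightarrow> germ_rel f g"
  by (simp add: germ_rel_def)

lemma germ_rel_imp_holo: "germ_rel f g \<Longrightarrow> holo_at0 f"
  by (simp add: germ_rel_def)

lemma eventually_compose_germ:
  fixes f :: "complex^'n::finite \<Rightarrow> complex"
  assumes "holo_at0 f" "f 0 = 0" "\<forall>\<^sub>F z in nhds 0. P z"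
  shows "\<forall>\<^sub>F s in nhds 0. P (f s)"
  using assms(2) holo_at0_continuous[OF assms(1)] tendsto_at_iff_tendsto_nhds[of f 0]
  by (intro eventually_compose_filterlim[OF assms(3)]) (simp add: isCont_def)

lemma holo_at0_eval_fps:
  "fps_conv_radius F > 0 \<Longrightarrow> holo_at0 f \<Longrightarrow> f 0 = 0 \<Longrightarrow> holo_at0 (\<lambda>s. eval_fps F (f s))"
  by (rule holo_at0_compose_field[OF analytic_on_eval_fps]) (auto simp: zero_ereal_def)

lemma eventually_in_conv_disk:
  "fps_conv_radius F > 0 \<Longrightarrow> \<forall>\<^sub>F z in nhds 0. ereal (norm (z :: complex)) < fps_conv_radius F"
  using eventually_nhds_in_open[of "eball 0 (fps_conv_radius F)" "0 :: complex"]
  by (auto simp: zero_ereal_def)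

subsection \<open>Evaluation and constants\<close>

lemma germ_at0_simps [simp]:
  "germ_at0 0 = 0" "germ_at0 1 = 1" "germ_at0 (germ_const c) = c" "germ_at0 (germ_coord i) = 0"
  "germ_at0 (f + g) = germ_at0 f + germ_at0 g" "germ_at0 (f * g) = germ_at0 f * germ_at0 g"
  "germ_at0 (f - g) = germ_at0 f - germ_at0 g" "germ_at0 (- f) = - germ_at0 f"
  by (transfer, simp)+

lemma germ_const_simps:
  "germ_const 0 = 0" "germ_const 1 = 1"
  "germ_const (c + d) = germ_const c + germ_const d" "germ_const (c * d) = germ_const c * germ_const d"
  "germ_const (c - d) = germ_const c - germ_const d" "germ_const (- c) = - germ_const c"
  by (transfer, simp add: germ_rel_def)+

lemma germ_const_inject: "germ_const c = germ_const d \<longleftrightarrow> c = d"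
  by (metis germ_at0_simps(3))

lemma germ_const_sum: "germ_const (sum c A) = (\<Sum>i\<in>A. germ_const (c i))"
  by (induction A rule: infinite_finite_induct) (auto simp: germ_const_simps)

lemma germ_const_of_int: "germ_const (of_int n) = of_int n"
proof -
  have "germ_const (of_nat m) = of_nat m" for m by (induction m) (auto simp: germ_const_simps)
  then show ?thesis by (cases n) (auto simp: germ_const_simps)
qed

subsection \<open>Representatives\<close>

lemma hgerm_cases:
  obtains F where "holo_at0 F" "f = abs_hgerm F"
  using Quotient_abs_rep[OF Quotient_hgerm, of f] germ_rel_imp_holo[OF Quotient_rep_reflp[OF Quotient_hgerm, of f]]
  by metis

lemma hgerm_family_cases:
  obtains F where "\<And>i. holo_at0 (F i)" "f = (\<lambda>i. abs_hgerm (F i))"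
proof -
  have "\<exists>F. \<forall>i. holo_at0 (F i) \<and> f i = abs_hgerm (F i)"
    by (intro choice allI) (metis hgerm_cases)
  then show thesis using that by (metis (no_types) ext)
qed

lemma abs_hgerm_eqI:
  "holo_at0 f \<Longrightarrow> holo_at0 g \<Longrightarrow> \<forall>\<^sub>F s in nhds 0. f s = g s \<Longrightarrow> abs_hgerm f = abs_hgerm g"
  by (rule Quotient_rel_abs[OF Quotient_hgerm]) (rule germ_relI)

lemma abs_hgerm_ops:
  assumes "holo_at0 f"
  shows "holo_at0 g \<Longrightarrow> abs_hgerm f + abs_hgerm g = abs_hgerm (\<lambda>s. f s + g s)"
    "holo_at0 g \<Longrightarrow> abs_hgerm f - abs_hgerm g = abs_hgerm (\<lambda>s. f s - g s)"
    "holo_at0 g \<Longrightarrow> abs_hgerm f * abs_hgerm g = abs_hgerm (\<lambda>s. f s * g s)"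
    "germ_at0 (abs_hgerm f) = f 0"
    "f 0 = 0 \<Longrightarrow> fps_conv_radius F > 0 \<Longrightarrow> germ_fps F (abs_hgerm f) = abs_hgerm (\<lambda>s. eval_fps F (f s))"
  using assms
  by (simp_all add: plus_hgerm.abs_eq minus_hgerm.abs_eq times_hgerm.abs_eq germ_at0.abs_eq germ_fps.abs_eq
        germ_rel_refl zero_ereal_def)

lemma germ_comp_abs_hgerm:
  assumes "holo_at0 f" "\<And>i. holo_at0 (\<rho> i)" "\<And>i. \<rho> i 0 = 0"
  shows "germ_comp (abs_hgerm f) (\<lambda>i. abs_hgerm (\<rho> i)) = abs_hgerm (\<lambda>s. f (\<chi> i. \<rho> i s))"
  using germ_comp.abs_eq[of f \<rho>] assms by (simp add: rel_fun_def germ_rel_refl comp_def)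

subsection \<open>Substitution into a power series\<close>

lemma germ_fps_simps:
  assumes z: "germ_at0 z = 0"
  shows "germ_fps (fps_const c) z = germ_const c" "germ_fps fps_X z = z" "germ_fps 0 z = 0" "germ_fps 1 z = 1"
    "fps_conv_radius F > 0 \<Longrightarrow> fps_conv_radius G > 0 \<Longrightarrow> germ_fps (F + G) z = germ_fps F z + germ_fps G z"
    "fps_conv_radius F > 0 \<Longrightarrow> fps_conv_radius G > 0 \<Longrightarrow> germ_fps (F - G) z = germ_fps F z - germ_fps G z"
    "fps_conv_radius F > 0 \<Longrightarrow> fps_conv_radius G > 0 \<Longrightarrow> germ_fps (F * G) z = germ_fps F z * germ_fps G z"
    "fps_conv_radius F > 0 \<Longrightarrow> germ_at0 (germ_fps F z) = fps_nth F 0"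
proof -
  obtain Z where Z: "holo_at0 Z" "z = abs_hgerm Z" by (rule hgerm_cases)
  have Z0: "Z 0 = 0" using z Z by (simp add: abs_hgerm_ops)
  note rep = abs_hgerm_ops(5)[OF Z(1) Z0] and holo = holo_at0_eval_fps[OF _ Z(1) Z0]
  show const: "germ_fps (fps_const c) z = germ_const c" for c
    by (simp add: Z rep germ_const.abs_eq)
  show "germ_fps 0 z = 0" "germ_fps 1 z = 1"
    using const[of 0] const[of 1] by (simp_all add: germ_const_simps)
  show "germ_fps fps_X z = z" by (simp add: Z rep)
  show "germ_at0 (germ_fps F z) = fps_nth F 0" if "fps_conv_radius F > 0"
    using that by (simp add: Z rep holo abs_hgerm_ops Z0 eval_fps_at_0)
  assume F: "fps_conv_radius F > 0" and G: "fps_conv_radius G > 0"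
  have ev: "\<forall>\<^sub>F s in nhds 0. ereal (norm (Z s)) < fps_conv_radius F \<and> ereal (norm (Z s)) < fps_conv_radius G"
    by (rule eventually_compose_germ[OF Z(1) Z0 eventually_conj[OF eventually_in_conv_disk[OF F] eventually_in_conv_disk[OF G]]])
  show "germ_fps (F + G) z = germ_fps F z + germ_fps G z"
    unfolding Z(2) rep[OF F] rep[OF G] rep[OF fps_conv_radius_pos_add[OF F G]] abs_hgerm_ops(1)[OF holo[OF F] holo[OF G]]
    by (rule abs_hgerm_eqI[OF holo[OF fps_conv_radius_pos_add[OF F G]] holo_at0_add[OF holo[OF F] holo[OF G]]
          eventually_mono[OF ev]]) (simp add: eval_fps_add)
  show "germ_fps (F - G) z = germ_fps F z - germ_fps G z"
    unfolding Z(2) rep[OF F] rep[OF G] rep[OF fps_conv_radius_pos_diff[OF F G]] abs_hgerm_ops(2)[OF holo[OF F] holo[OF G]]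
    by (rule abs_hgerm_eqI[OF holo[OF fps_conv_radius_pos_diff[OF F G]] holo_at0_diff[OF holo[OF F] holo[OF G]]
          eventually_mono[OF ev]]) (simp add: eval_fps_diff)
  show "germ_fps (F * G) z = germ_fps F z * germ_fps G z"
    unfolding Z(2) rep[OF F] rep[OF G] rep[OF fps_conv_radius_pos_mult[OF F G]] abs_hgerm_ops(3)[OF holo[OF F] holo[OF G]]
    by (rule abs_hgerm_eqI[OF holo[OF fps_conv_radius_pos_mult[OF F G]] holo_at0_mult[OF holo[OF F] holo[OF G]]
          eventually_mono[OF ev]]) (simp add: eval_fps_mult)
qed

lemma germ_fps_compose:
  assumes "germ_at0 z = 0" "fps_conv_radius F > 0" and G: "fps_conv_radius G > 0" "fps_nth G 0 = 0"
  shows "germ_fps (F oo G) z = germ_fps F (germ_fps G z)"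
proof -
  obtain Z where Z: "holo_at0 Z" "z = abs_hgerm Z" by (rule hgerm_cases)
  have Z0: "Z 0 = 0" using assms(1) Z by (simp add: abs_hgerm_ops)
  note FG = fps_compose_convergent[OF assms(2) G]
  have GZ: "holo_at0 (\<lambda>s. eval_fps G (Z s))" "eval_fps G (Z 0) = 0"
    using holo_at0_eval_fps[OF G(1) Z(1) Z0] by (simp_all add: Z0 eval_fps_at_0 G(2))
  show ?thesis
    unfolding Z(2) abs_hgerm_ops(5)[OF Z(1) Z0 FG(1)] abs_hgerm_ops(5)[OF Z(1) Z0 G(1)] abs_hgerm_ops(5)[OF GZ assms(2)]
    by (rule abs_hgerm_eqI[OF holo_at0_eval_fps[OF FG(1) Z(1) Z0] holo_at0_eval_fps[OF assms(2) GZ]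
          eventually_compose_germ[OF Z(1) Z0 FG(2)]])
qed

lemma germ_fps_coord_inject:
  assumes "fps_conv_radius F > 0" "fps_conv_radius G > 0"
    and "germ_fps F (germ_coord i) = germ_fps G (germ_coord i)"
  shows "F = G"
proof -
  have "\<forall>\<^sub>F s in nhds (0 :: complex^'a). eval_fps F (s $ i) = eval_fps G (s $ i)"
    using assms by transfer (simp add: germ_rel_def zero_ereal_def)
  moreover have "filterlim (axis i :: complex \<Rightarrow> complex^'a) (nhds 0) (nhds 0)"
  proof -
    have axis0: "axis i 0 = (0 :: complex^'a)" by (simp add: vec_eq_iff axis_def)
    have "isCont (axis i :: complex \<Rightarrow> complex^'a) 0"
      by (intro bounded_linear.continuous[OF bounded_linear_axis] continuous_ident)
    then show ?thesis
      using tendsto_at_iff_tendsto_nhds[of "axis i :: complex \<Rightarrow> complex^'a" 0]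
      unfolding isCont_def axis0 by simp
  qed
  ultimately have "\<forall>\<^sub>F z in nhds 0. eval_fps F (axis i z $ i) = eval_fps G (axis i z $ i)"
    by (rule eventually_compose_filterlim)
  then show ?thesis using assms(1,2) by (intro eval_fps_eqD) (auto simp: axis_def)
qed

subsection \<open>Pullback along a map germ\<close>

lemma germ_comp_simps:
  assumes \<rho>0: "\<And>i. germ_at0 (\<rho> i) = 0"
  shows "germ_comp (f + g) \<rho> = germ_comp f \<rho> + germ_comp g \<rho>"
    "germ_comp (f * g) \<rho> = germ_comp f \<rho> * germ_comp g \<rho>"
    "germ_comp (f - g) \<rho> = germ_comp f \<rho> - germ_comp g \<rho>"
    "germ_comp (germ_const c) \<rho> = germ_const c"
    "germ_comp 0 \<rho> = 0" "germ_comp 1 \<rho> = 1"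
    "germ_comp (germ_coord i) \<rho> = \<rho> i"
    "germ_at0 (germ_comp f \<rho>) = germ_at0 f"
proof -
  obtain F where F: "holo_at0 F" "f = abs_hgerm F" by (rule hgerm_cases)
  obtain G where G: "holo_at0 G" "g = abs_hgerm G" by (rule hgerm_cases)
  obtain R where R: "\<And>i. holo_at0 (R i)" "\<rho> = (\<lambda>i. abs_hgerm (R i))" by (rule hgerm_family_cases) blast
  have R0: "R i 0 = 0" for i using \<rho>0[of i] R by (simp add: abs_hgerm_ops)
  note comp = germ_comp_abs_hgerm[OF _ R(1) R0]
  have FR: "holo_at0 (\<lambda>s. F (\<chi> i. R i s))" and GR: "holo_at0 (\<lambda>s. G (\<chi> i. R i s))"
    by (rule holo_at0_compose[OF F(1) R(1) R0], rule holo_at0_compose[OF G(1) R(1) R0])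
  show "germ_comp (f + g) \<rho> = germ_comp f \<rho> + germ_comp g \<rho>"
    by (simp add: F G R(2) comp abs_hgerm_ops FR GR holo_at0_add)
  show "germ_comp (f * g) \<rho> = germ_comp f \<rho> * germ_comp g \<rho>"
    by (simp add: F G R(2) comp abs_hgerm_ops FR GR holo_at0_mult)
  show "germ_comp (f - g) \<rho> = germ_comp f \<rho> - germ_comp g \<rho>"
    by (simp add: F G R(2) comp abs_hgerm_ops FR GR holo_at0_diff)
  show const: "germ_comp (germ_const c) \<rho> = germ_const c" for c
    by (simp add: R(2) comp germ_const.abs_eq)
  show "germ_comp 0 \<rho> = 0" "germ_comp 1 \<rho> = 1"
    using const[of 0] const[of 1] by (simp_all add: germ_const_simps)
  show "germ_comp (germ_coord i) \<rho> = \<rho> i"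
    by (simp add: R(2) comp germ_coord.abs_eq)
  show "germ_at0 (germ_comp f \<rho>) = germ_at0 f"
    by (simp add: F R(2) comp abs_hgerm_ops FR R0 flip: zero_vec_def)
qed

lemma germ_comp_germ_fps:
  assumes "\<And>i. germ_at0 (\<rho> i) = 0" "germ_at0 z = 0" "fps_conv_radius F > 0"
  shows "germ_comp (germ_fps F z) \<rho> = germ_fps F (germ_comp z \<rho>)"
proof -
  obtain Z where Z: "holo_at0 Z" "z = abs_hgerm Z" by (rule hgerm_cases)
  obtain R where R: "\<And>i. holo_at0 (R i)" "\<rho> = (\<lambda>i. abs_hgerm (R i))" by (rule hgerm_family_cases) blast
  have R0: "R i 0 = 0" for i using assms(1)[of i] R by (simp add: abs_hgerm_ops)
  have Z0: "Z 0 = 0" using assms(2) Z by (simp add: abs_hgerm_ops)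
  have ZR: "holo_at0 (\<lambda>s. Z (\<chi> i. R i s))" "Z (\<chi> i. R i 0) = 0"
    using holo_at0_compose[OF Z(1) R(1) R0] by (simp_all add: R0 Z0 flip: zero_vec_def)
  have "germ_fps F (germ_comp z \<rho>) = abs_hgerm (\<lambda>s. eval_fps F (Z (\<chi> i. R i s)))"
    by (simp add: Z R(2) germ_comp_abs_hgerm[OF Z(1) R(1) R0] abs_hgerm_ops(5)[OF ZR assms(3)])
  also have "\<dots> = germ_comp (abs_hgerm (\<lambda>s. eval_fps F (Z s))) \<rho>"
    by (simp add: R(2) germ_comp_abs_hgerm[OF holo_at0_eval_fps[OF assms(3) Z(1) Z0] R(1) R0])
  finally show ?thesis by (simp add: Z abs_hgerm_ops Z0 assms(3))
qed

lemma germ_comp_assoc: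
  assumes "\<And>i. germ_at0 (\<rho> i) = 0" "\<And>i. germ_at0 (\<sigma> i) = 0"
  shows "germ_comp (germ_comp f \<rho>) \<sigma> = germ_comp f (\<lambda>i. germ_comp (\<rho> i) \<sigma>)"
proof -
  obtain F where F: "holo_at0 F" "f = abs_hgerm F" by (rule hgerm_cases)
  obtain R where R: "\<And>i. holo_at0 (R i)" "\<rho> = (\<lambda>i. abs_hgerm (R i))" by (rule hgerm_family_cases) blast
  obtain S where S: "\<And>i. holo_at0 (S i)" "\<sigma> = (\<lambda>i. abs_hgerm (S i))" by (rule hgerm_family_cases) blast
  have R0: "R i 0 = 0" for i using assms(1)[of i] R by (simp add: abs_hgerm_ops)
  have S0: "S i 0 = 0" for i using assms(2)[of i] S by (simp add: abs_hgerm_ops)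
  have RS: "holo_at0 (\<lambda>s. R i (\<chi> i. S i s))" "R i (\<chi> i. S i 0) = 0" for i
    using holo_at0_compose[OF R(1) S(1) S0] by (simp_all add: S0 R0 flip: zero_vec_def)
  show ?thesis
    by (simp add: F R(2) S(2) germ_comp_abs_hgerm[OF F(1) R(1) R0] germ_comp_abs_hgerm[OF R(1) S(1) S0]
        germ_comp_abs_hgerm[OF holo_at0_compose[OF F(1) R(1) R0] S(1) S0] germ_comp_abs_hgerm[OF F(1) RS])
qed

lemma germ_comp_coord: "germ_comp f germ_coord = f"
  by transfer (simp add: vec_lambda_eta)

subsection \<open>Partial derivatives\<close>

lemma holo_at0_eventually_linear_derivative:
  assumes "holo_at0 f"
  shows "\<forall>\<^sub>F s in nhds 0. \<exists>f'. (f has_derivative f') (at s) \<and> (\<forall>c v. f' (c *s v) = c * f' v)"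
  using assms unfolding holo_at0_iff .

lemma germ_partial_simps:
  "germ_partial i (f + g) = germ_partial i f + germ_partial i g"
  "germ_partial i (germ_const c) = 0" "germ_partial i 0 = 0" "germ_partial i 1 = 0"
  "germ_partial i (germ_const c * f) = germ_const c * germ_partial i f"
  "germ_partial i (germ_coord j) = (if i = j then 1 else 0)"
proof -
  show const: "germ_partial i (germ_const c) = 0" for c
  proof -
    have "partial_deriv i (\<lambda>s :: complex^'a. c) = (\<lambda>s. 0)" by (simp add: partial_deriv_def fun_eq_iff)
    then show ?thesis by (simp add: germ_const_def germ_partial.abs_eq germ_rel_refl zero_hgerm_def)
  qed
  show "germ_partial i 0 = 0" "germ_partial i 1 = 0"
    using const[of 0] const[of 1] by (simp_all add: germ_const_simps)
  show "germ_partial i (f + g) = germ_partial i f + germ_partial i g"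
  proof transfer
    fix i :: 'a and f g :: "complex^'a \<Rightarrow> complex"
    assume "germ_rel f f" "germ_rel g g"
    then have h: "holo_at0 f" "holo_at0 g" by (auto simp: germ_rel_def)
    have "\<forall>\<^sub>F s in nhds 0. partial_deriv i (\<lambda>s. f s + g s) s = partial_deriv i f s + partial_deriv i g s"
      using holo_at0_eventually_linear_derivative[OF h(1)] holo_at0_eventually_linear_derivative[OF h(2)]
    proof eventually_elim
      case (elim s)
      then obtain f' g' where f': "(f has_derivative f') (at s)" "\<And>c v. f' (c *s v) = c * f' v"
        and g': "(g has_derivative g') (at s)" "\<And>c v. g' (c *s v) = c * g' v" by metis
      have "partial_deriv i (\<lambda>s. f s + g s) s = (\<lambda>v. f' v + g' v) (axis i 1)"
        by (rule partial_deriv_eq[OF has_derivative_add[OF f'(1) g'(1)]]) (simp add: f'(2) g'(2) distrib_left)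
      then show ?case by (simp add: partial_deriv_eq[OF f'] partial_deriv_eq[OF g'])
    qed
    then show "germ_rel (partial_deriv i (\<lambda>s. f s + g s)) (\<lambda>s. partial_deriv i f s + partial_deriv i g s)"
      by (intro germ_relI holo_at0_partial_deriv holo_at0_add h)
  qed
  show "germ_partial i (germ_const c * f) = germ_const c * germ_partial i f"
  proof transfer
    fix i :: 'a and c and f :: "complex^'a \<Rightarrow> complex"
    assume "germ_rel f f"
    then have h: "holo_at0 f" by (auto simp: germ_rel_def)
    have "\<forall>\<^sub>F s in nhds 0. partial_deriv i (\<lambda>s. c * f s) s = c * partial_deriv i f s"
      using holo_at0_eventually_linear_derivative[OF h]
    proof eventually_elim
      case (elim s)
      then obtain f' where f': "(f has_derivative f') (at s)" "\<And>c v. f' (c *s v) = c * f' v" by metis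
      have "partial_deriv i (\<lambda>s. c * f s) s = (\<lambda>v. c * f' v) (axis i 1)"
        by (rule partial_deriv_eq[OF has_derivative_mult_right[OF f'(1)]]) (simp add: f'(2))
      then show ?case by (simp add: partial_deriv_eq[OF f'])
    qed
    then show "germ_rel (partial_deriv i (\<lambda>s. c * f s)) (\<lambda>s. c * partial_deriv i f s)"
      by (intro germ_relI holo_at0_partial_deriv holo_at0_mult holo_at0_const h)
  qed
  show "germ_partial i (germ_coord j) = (if i = j then 1 else 0)"
  proof transfer
    fix i j :: 'a
    have "partial_deriv i (\<lambda>s. s $ j) s = (if i = j then 1 else 0)" for s :: "complex^'a"
    proof -
      have "partial_deriv i (\<lambda>s. s $ j) s = (axis i 1 :: complex^'a) $ j"
        by (rule partial_deriv_eq) (auto intro!: bounded_linear_imp_has_derivative bounded_linear_vec_nth)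
      then show ?thesis by (simp add: axis_def)
    qed
    then have "partial_deriv i (\<lambda>s :: complex^'a. s $ j) = (if i = j then (\<lambda>s. 1) else (\<lambda>s. 0))" by auto
    then show "germ_rel (partial_deriv i (\<lambda>s. s $ j)) (if i = j then (\<lambda>s. 1) else (\<lambda>s. 0))"
      by (simp add: germ_rel_refl)
  qed
qed

lemma germ_partial_germ_fps_coord:
  assumes "fps_conv_radius F > 0"
  shows "germ_partial i (germ_fps F (germ_coord j)) = (if i = j then germ_fps (fps_deriv F) (germ_coord j) else 0)"
  using assms fps_conv_radius_pos_deriv[OF assms]
proof transfer
  fix i j :: 'a and F :: "complex fps"
  assume F: "0 < fps_conv_radius F" "0 < fps_conv_radius (fps_deriv F)"
  have hF: "holo_at0 (\<lambda>s. eval_fps F (s $ j))" and hF': "holo_at0 (\<lambda>s. eval_fps (fps_deriv F) (s $ j))"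
    by (intro holo_at0_eval_fps F; simp)+
  have "\<forall>\<^sub>F s in nhds (0 :: complex^'a). ereal (norm (s $ j)) < fps_conv_radius F"
    by (rule eventually_compose_germ[OF _ _ eventually_in_conv_disk[OF F(1)]]) auto
  then have "\<forall>\<^sub>F s in nhds (0 :: complex^'a). partial_deriv i (\<lambda>s. eval_fps F (s $ j)) s =
      (if i = j then eval_fps (fps_deriv F) (s $ j) else 0)"
  proof eventually_elim
    case (elim s)
    have "(eval_fps F has_field_derivative eval_fps (fps_deriv F) (s $ j)) (at (s $ j))"
      using elim by (rule has_field_derivative_eval_fps)
    then have "((\<lambda>s. eval_fps F (s $ j)) has_derivative (\<lambda>v. eval_fps (fps_deriv F) (s $ j) * v $ j)) (at s)"
      unfolding has_field_derivative_def
      by (rule has_derivative_compose[rotated]) (intro bounded_linear_imp_has_derivative bounded_linear_vec_nth)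
    then have "partial_deriv i (\<lambda>s. eval_fps F (s $ j)) s = eval_fps (fps_deriv F) (s $ j) * (axis i 1 :: complex^'a) $ j"
      by (rule partial_deriv_eq) simp
    then show ?case by (simp add: axis_def)
  qed
  then have "germ_rel (partial_deriv i (\<lambda>s :: complex^'a. eval_fps F (s $ j)))
      (if i = j then (\<lambda>s. eval_fps (fps_deriv F) (s $ j)) else (\<lambda>s. 0))"
    using holo_at0_partial_deriv[OF hF] hF' by (auto simp: germ_rel_def)
  then show "germ_rel
     (partial_deriv i (if ereal (norm ((0 :: complex^'a) $ j)) < fps_conv_radius F then \<lambda>s. eval_fps F (s $ j) else (\<lambda>s. 0)))
     (if i = j then if ereal (norm ((0 :: complex^'a) $ j)) < fps_conv_radius (fps_deriv F)
           then \<lambda>s. eval_fps (fps_deriv F) (s $ j) else (\<lambda>s. 0)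
      else (\<lambda>s. 0))"
    using F by (simp flip: zero_ereal_def split: if_splits)
qed

text \<open>
  The total derivative is determined by the partial derivatives, so it vanishes on a ball, where the
  function is then constant by convexity.
\<close>

lemma germ_partial_zero_imp_const:
  assumes "\<And>i. germ_partial i f = 0"
  shows "f = germ_const (germ_at0 f)"
proof -
  have *: "\<forall>i. germ_partial i f = 0" using assms by blast
  show ?thesis using *
  proof transfer
    fix f :: "complex^'a \<Rightarrow> complex"
    assume *: "germ_rel f f" "\<forall>i. germ_rel (partial_deriv i f) (\<lambda>s. 0)"
    have h: "holo_at0 f" using *(1) by (rule germ_rel_imp_holo)
    have "\<forall>\<^sub>F s in nhds 0. \<forall>i. partial_deriv i f s = 0"
      using *(2) by (intro eventually_all_finite) (auto simp: germ_rel_def)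
    with holo_at0_eventually_linear_derivative[OF h]
    have "\<forall>\<^sub>F s in nhds 0. (f has_derivative (\<lambda>v. 0)) (at s)"
    proof eventually_elim
      case (elim s)
      then obtain f' where f': "(f has_derivative f') (at s)" "\<And>c v. f' (c *s v) = c * f' v" by metis
      have "f' v = 0" for v
      proof -
        have "f' v = f' (\<Sum>j\<in>UNIV. v $ j *s axis j 1)"
          using sum_axis_eq[of "\<lambda>j. v $ j"] by (simp only: axis_scale vec_lambda_eta)
        also have "\<dots> = (\<Sum>j\<in>UNIV. f' (v $ j *s axis j 1))"
          by (rule linear_sum[OF has_derivative_linear[OF f'(1)]])
        also have "\<dots> = 0" using elim(2) partial_deriv_eq[OF f'] by (simp add: f'(2))
        finally show ?thesis .
      qed
      then have "f' = (\<lambda>v. 0)" by (rule ext)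
      then show ?case using f'(1) by simp
    qed
    then obtain d where d: "d > 0" "\<And>s. s \<in> ball 0 d \<Longrightarrow> (f has_derivative (\<lambda>v. 0)) (at s)"
      by (auto simp: eventually_nhds_metric dist_commute)
    have "f s = f 0" if "s \<in> ball 0 d" for s
      by (rule has_derivative_zero_unique[OF convex_ball _ that])
         (use d in \<open>auto intro: has_derivative_at_withinI\<close>)
    moreover have "\<forall>\<^sub>F s in nhds 0. s \<in> ball (0 :: complex^'a) d"
      by (rule eventually_nhds_in_open) (use d(1) in auto)
    ultimately have "\<forall>\<^sub>F s in nhds 0. f s = f 0" by (simp add: eventually_mono)
    then show "germ_rel f (\<lambda>s. f 0)" by (rule germ_relI[OF h holo_at0_const])
  qed
qed

section \<open>Convergent microdifferential coefficients\<close>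

notation fls_nth (infixl "$$" 75)

lemma eventually_on_polydisk:
  assumes "\<forall>\<^sub>F s in nhds (0 :: complex^'n::finite). P s"
  obtains e where "e > 0" "\<And>s. s \<in> polydisk e \<Longrightarrow> P s"
proof -
  obtain d where d: "d > 0" "\<And>s. s \<in> ball 0 d \<Longrightarrow> P s"
    using assms by (auto simp: eventually_nhds_metric dist_commute)
  obtain e where "e > 0" "(polydisk e :: (complex^'n) set) \<subseteq> ball 0 d"
    using polydisk_subset_ball[OF d(1)] by blast
  then show thesis using d(2) that by blast
qed

lemma holo_on_subset: "holo_on f S \<Longrightarrow> T \<subseteq> S \<Longrightarrow> holo_on f T"
  unfolding holo_on_def by blast

lemma holo_on_polydisk_imp_holo_at0: "d > 0 \<Longrightarrow> holo_on f (polydisk d) \<Longrightarrow> holo_at0 f"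
  unfolding holo_at0_def by blast

lemma holo_on_const: "holo_on (\<lambda>s. c) S"
  unfolding holo_on_def by (intro ballI exI[of _ "\<lambda>v. 0"]) auto

lemma holo_on_add: "holo_on f S \<Longrightarrow> holo_on g S \<Longrightarrow> holo_on (\<lambda>s. f s + g s) S"
  unfolding holo_on_def
proof
  fix z assume "\<forall>z\<in>S. \<exists>f'. (f has_derivative f') (at z) \<and> (\<forall>c v. f' (c *s v) = c * f' v)"
    "\<forall>z\<in>S. \<exists>f'. (g has_derivative f') (at z) \<and> (\<forall>c v. f' (c *s v) = c * f' v)" "z \<in> S"
  then obtain f' g' where "(f has_derivative f') (at z)" "\<forall>c v. f' (c *s v) = c * f' v"
    "(g has_derivative g') (at z)" "\<forall>c v. g' (c *s v) = c * g' v" by metis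
  then show "\<exists>f'. ((\<lambda>s. f s + g s) has_derivative f') (at z) \<and> (\<forall>c v. f' (c *s v) = c * f' v)"
    by (intro exI[of _ "\<lambda>v. f' v + g' v"]) (auto intro!: has_derivative_add simp: algebra_simps)
qed

lemma holo_on_mult: "holo_on f S \<Longrightarrow> holo_on g S \<Longrightarrow> holo_on (\<lambda>s. f s * g s) S"
  unfolding holo_on_def
proof
  fix z assume "\<forall>z\<in>S. \<exists>f'. (f has_derivative f') (at z) \<and> (\<forall>c v. f' (c *s v) = c * f' v)"
    "\<forall>z\<in>S. \<exists>f'. (g has_derivative f') (at z) \<and> (\<forall>c v. f' (c *s v) = c * f' v)" "z \<in> S"
  then obtain f' g' where "(f has_derivative f') (at z)" "\<forall>c v. f' (c *s v) = c * f' v"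
    "(g has_derivative g') (at z)" "\<forall>c v. g' (c *s v) = c * g' v" by metis
  then show "\<exists>f'. ((\<lambda>s. f s * g s) has_derivative f') (at z) \<and> (\<forall>c v. f' (c *s v) = c * f' v)"
    by (intro exI[of _ "\<lambda>v. f z * g' v + f' v * g z"])
       (auto intro!: has_derivative_mult simp: algebra_simps)
qed

lemma holo_on_compose:
  assumes f: "holo_on f T" and \<rho>: "\<And>i. holo_on (\<rho> i) S" "\<And>s. s \<in> S \<Longrightarrow> (\<chi> i. \<rho> i s) \<in> T"
  shows "holo_on (\<lambda>s. f (\<chi> i. \<rho> i s)) S"
  unfolding holo_on_def
proof
  fix s assume s: "s \<in> S"
  obtain f' where f': "(f has_derivative f') (at (\<chi> i. \<rho> i s))" "\<And>c v. f' (c *s v) = c * f' v"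
    using f \<rho>(2)[OF s] unfolding holo_on_def by blast
  have "\<forall>i. \<exists>f'. (\<rho> i has_derivative f') (at s) \<and> (\<forall>c v. f' (c *s v) = c * f' v)"
    using \<rho>(1) s unfolding holo_on_def by blast
  then obtain \<rho>' where \<rho>': "\<And>i. (\<rho> i has_derivative \<rho>' i) (at s)" "\<And>i c v. \<rho>' i (c *s v) = c * \<rho>' i v"
    unfolding choice_iff by blast
  have "((\<lambda>s. \<Sum>i\<in>UNIV. axis i (\<rho> i s)) has_derivative (\<lambda>v. \<Sum>i\<in>UNIV. axis i (\<rho>' i v))) (at s)"
    by (intro has_derivative_sum bounded_linear.has_derivative[OF bounded_linear_axis] \<rho>')
  then have "((\<lambda>s. \<chi> i. \<rho> i s) has_derivative (\<lambda>v. \<chi> i. \<rho>' i v)) (at s)"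
    by (simp add: sum_axis_eq)
  then have "((\<lambda>s. f (\<chi> i. \<rho> i s)) has_derivative (\<lambda>v. f' (\<chi> i. \<rho>' i v))) (at s)"
    using f'(1) by (rule has_derivative_compose)
  moreover have "f' (\<chi> i. \<rho>' i (c *s v)) = c * f' (\<chi> i. \<rho>' i v)" for c v
    using f'(2)[of c "\<chi> i. \<rho>' i v"] by (simp only: \<rho>'(2)) (simp add: vector_scalar_mult_def)
  ultimately show "\<exists>f'. ((\<lambda>s. f (\<chi> i. \<rho> i s)) has_derivative f') (at s) \<and> (\<forall>c v. f' (c *s v) = c * f' v)"
    by blast
qed

lemma holo_at0_locally_bounded:
  assumes "holo_at0 (f :: complex^'n::finite \<Rightarrow> complex)"
  shows "\<forall>\<^sub>F s in nhds 0. norm (f s) \<le> norm (f 0) + 1"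
proof -
  have "filterlim f (nhds (f 0)) (nhds 0)"
    using holo_at0_continuous[OF assms] by (simp add: isCont_def tendsto_at_iff_tendsto_nhds)
  then have "\<forall>\<^sub>F s in nhds 0. dist (f s) (f 0) < 1" by (rule tendstoD) simp
  then show ?thesis
  proof eventually_elim
    case (elim s)
    then show ?case using norm_triangle_ineq2[of "f s" "f 0"] by (simp add: dist_norm)
  qed
qed

text \<open>
  Uniform convergence of \<open>\<Sum> G\<^sub>k x\<^sup>k / k!\<close> near \<open>(0, 0)\<close> amounts to a bound on the coefficients. The bound, unlike the
  convergence, passes at once to sums, multiples, shifts and pullbacks.
\<close>

definition factorial_bound :: "real \<Rightarrow> (nat \<Rightarrow> complex^'n::finite \<Rightarrow> complex) \<Rightarrow> real \<Rightarrow> real \<Rightarrow> bool" where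
  "factorial_bound d G C M \<longleftrightarrow>
     (\<forall>k. holo_on (G k) (polydisk d) \<and> (\<forall>s\<in>polydisk d. norm (G k s) \<le> C * M ^ k * fact k))"

text \<open>
  The terms of a uniformly Cauchy series are bounded by \<open>1\<close> from some index \<open>K\<close> on; this is used at \<open>x = e/2\<close>. The
  finitely many functions before \<open>K\<close> are bounded near \<open>0\<close> by continuity.
\<close>

lemma conv_ops0_imp_factorial_bound:
  fixes a :: "'n::finite hgerm fls"
  assumes "a \<in> conv_ops0"
  obtains d C M G where "d > 0" "C \<ge> 0" "M \<ge> 1" "factorial_bound d G C M" "\<And>k. a $$ int k = abs_hgerm (G k)"
proof -
  obtain d e G where d: "d > 0" and e: "e > 0"
    and G: "\<And>k. holo_on (G k) (polydisk d)" "\<And>k. a $$ int k = abs_hgerm (G k)"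
    and conv: "uniformly_convergent_on (polydisk d \<times> ball 0 e) (\<lambda>N (s, x). \<Sum>k<N. G k s * x ^ k / fact k)"
    using assms unfolding conv_ops0_def by blast
  from conv have "uniformly_Cauchy_on (polydisk d \<times> ball 0 e) (\<lambda>N (s, x). \<Sum>k<N. G k s * x ^ k / fact k)"
    by (simp add: uniformly_convergent_eq_Cauchy)
  then obtain K where K: "\<And>m n s x. m \<ge> K \<Longrightarrow> n \<ge> K \<Longrightarrow> s \<in> polydisk d \<Longrightarrow> x \<in> ball 0 e \<Longrightarrow>
      dist (\<Sum>k<m. G k s * x ^ k / fact k) (\<Sum>k<n. G k s * x ^ k / fact k) < 1"
    unfolding uniformly_Cauchy_on_def by (elim allE[of _ 1]) force
  have large: "norm (G k s) \<le> (2 / e) ^ k * fact k" if "k \<ge> K" "s \<in> polydisk d" for k s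
  proof -
    have "norm (G k s * of_real (e / 2) ^ k / fact k) < 1"
      using K[of "Suc k" k s "of_real (e / 2)"] that e by (simp add: dist_norm)
    then show ?thesis using e by (simp add: norm_mult norm_divide norm_power field_simps)
  qed
  have "\<forall>\<^sub>F s in nhds 0. \<forall>k\<in>{..<K}. norm (G k s) \<le> norm (G k 0) + 1"
    by (intro eventually_ball_finite ballI holo_at0_locally_bounded holo_on_polydisk_imp_holo_at0[OF d G(1)]) simp
  then obtain d' where d': "d' > 0" "\<And>s. s \<in> polydisk d' \<Longrightarrow> \<forall>k\<in>{..<K}. norm (G k s) \<le> norm (G k 0) + 1"
    by (rule eventually_on_polydisk) blast
  define C where "C = 1 + (\<Sum>k<K. norm (G k 0) + 1)"
  define M where "M = max 1 (2 / e)"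
  have C1: "C \<ge> 1" unfolding C_def by (simp add: sum_nonneg)
  have "factorial_bound (min d d') G C M"
    unfolding factorial_bound_def
  proof (intro allI conjI ballI)
    fix k
    show "holo_on (G k) (polydisk (min d d'))"
      by (rule holo_on_subset[OF G(1) polydisk_mono]) simp
    fix s :: "complex^'n" assume "s \<in> polydisk (min d d')"
    then have s: "s \<in> polydisk d" "s \<in> polydisk d'"
      using polydisk_mono[of "min d d'" d] polydisk_mono[of "min d d'" d'] by auto
    have M: "M ^ k \<ge> 1" "(2 / e) ^ k \<le> M ^ k" using e by (auto simp: M_def intro!: one_le_power power_mono)
    show "norm (G k s) \<le> C * M ^ k * fact k"
    proof (cases "k < K")
      case True
      have "norm (G k s) \<le> norm (G k 0) + 1" using d'(2)[OF s(2)] True by auto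
      also have "\<dots> \<le> (\<Sum>k<K. norm (G k 0) + 1)"
        using True by (intro member_le_sum) auto
      also have "\<dots> \<le> C" by (simp add: C_def)
      also have "C \<le> C * (M ^ k * fact k)"
        using C1 M(1) mult_mono[of 1 "M ^ k" 1 "fact k :: real"] by (simp add: fact_ge_1)
      finally show ?thesis by (simp add: mult.assoc)
    next
      case False
      then have "norm (G k s) \<le> (2 / e) ^ k * fact k" using large s by simp
      also have "\<dots> \<le> M ^ k * fact k" using M(2) by (intro mult_right_mono) auto
      also have "\<dots> \<le> C * (M ^ k * fact k)"
        using mult_right_mono[OF C1, of "M ^ k * fact k"] M(1) by simp
      finally show ?thesis by (simp add: mult.assoc)
    qed
  qed
  then show thesis using that[of "min d d'" C M G] d d'(1) C1 G(2) by (simp add: M_def)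
qed

text \<open>On the disk of radius \<open>1 / (2 M)\<close> the bound gives the geometric majorant \<open>C / 2\<^sup>k\<close>.\<close>

lemma conv_ops0I:
  fixes a :: "'n::finite hgerm fls"
  assumes "\<And>k. k < 0 \<Longrightarrow> a $$ k = 0" and "d > 0" "M > 0" and G: "factorial_bound d G C M"
    and "\<And>k. a $$ int k = abs_hgerm (G k)"
  shows "a \<in> conv_ops0"
proof -
  have "uniform_limit (polydisk d \<times> ball 0 (1 / (2 * M)))
      (\<lambda>N p. \<Sum>k<N. (\<lambda>k (s, x). G k s * x ^ k / fact k) k p)
      (\<lambda>p. suminf (\<lambda>k. (\<lambda>k (s, x). G k s * x ^ k / fact k) k p)) sequentially"
  proof (rule Weierstrass_m_test)
    show "summable (\<lambda>k. C * (1 / 2) ^ k :: real)" by (intro summable_mult summable_geometric) simp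
    fix k :: nat and p :: "(complex^'n) \<times> complex"
    assume p: "p \<in> polydisk d \<times> ball 0 (1 / (2 * M))"
    obtain s x where sx: "p = (s, x)" "s \<in> polydisk d" "norm x \<le> 1 / (2 * M)" using p by (cases p) auto
    have *: "norm (G k s) \<le> C * M ^ k * fact k" using G sx(2) by (simp add: factorial_bound_def)
    have **: "norm x ^ k \<le> (1 / (2 * M)) ^ k" using sx(3) by (intro power_mono) auto
    have "norm (G k s * x ^ k / fact k) = norm (G k s) * norm x ^ k / fact k"
      by (simp add: norm_mult norm_divide norm_power)
    also have "\<dots> \<le> (C * M ^ k * fact k) * (1 / (2 * M)) ^ k / fact k"
      using * ** by (intro divide_right_mono mult_mono) (auto intro: order_trans[OF norm_ge_zero *])
    also have "\<dots> = C * (1 / 2) ^ k" using \<open>M > 0\<close> by (simp add: power_divide power_mult_distrib)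
    finally show "norm ((\<lambda>(s, x). G k s * x ^ k / fact k) p) \<le> C * (1 / 2) ^ k"
      by (simp add: sx(1))
  qed
  then have "uniformly_convergent_on (polydisk d \<times> ball 0 (1 / (2 * M)))
      (\<lambda>N (s, x). \<Sum>k<N. G k s * x ^ k / fact k)"
    by (auto simp: uniformly_convergent_on_def case_prod_unfold)
  moreover have "1 / (2 * M) > 0" using \<open>M > 0\<close> by simp
  moreover have "\<forall>k. holo_on (G k) (polydisk d) \<and> a $$ int k = abs_hgerm (G k)"
    using G assms(5) by (simp add: factorial_bound_def)
  ultimately show ?thesis using assms(1,2) unfolding conv_ops0_def by blast
qed

lemma conv_ops0_neg: "a \<in> conv_ops0 \<Longrightarrow> k < 0 \<Longrightarrow> a $$ k = 0"
  by (simp add: conv_ops0_def)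

lemma factorial_bound_mono:
  assumes "factorial_bound d G C M" "d' \<le> d" "C \<le> C'" "M \<le> M'" "C \<ge> 0" "M \<ge> 0"
  shows "factorial_bound d' G C' M'"
  unfolding factorial_bound_def
proof (intro allI conjI ballI)
  fix k
  show "holo_on (G k) (polydisk d')"
    using assms(1) polydisk_mono[OF assms(2)] holo_on_subset unfolding factorial_bound_def by blast
  fix s :: "complex^'a" assume "s \<in> polydisk d'"
  then have "norm (G k s) \<le> C * M ^ k * fact k"
    using assms(1) polydisk_mono[OF assms(2)] unfolding factorial_bound_def by blast
  also have "\<dots> \<le> C' * M' ^ k * fact k"
    using assms by (intro mult_right_mono mult_mono power_mono) auto
  finally show "norm (G k s) \<le> C' * M' ^ k * fact k" .
qed

lemma conv_ops0_add:
  assumes "a \<in> conv_ops0" "b \<in> conv_ops0" shows "a + b \<in> conv_ops0"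
proof -
  obtain d C M G where G: "d > 0" "C \<ge> 0" "M \<ge> 1" "factorial_bound d G C M" "\<And>k. a $$ int k = abs_hgerm (G k)"
    using conv_ops0_imp_factorial_bound[OF assms(1)] by blast
  obtain d' C' M' G' where G': "d' > 0" "C' \<ge> 0" "M' \<ge> 1" "factorial_bound d' G' C' M'" "\<And>k. b $$ int k = abs_hgerm (G' k)"
    using conv_ops0_imp_factorial_bound[OF assms(2)] by blast
  let ?d = "min d d'" and ?M = "max M M'"
  have F: "factorial_bound ?d G C ?M" "factorial_bound ?d G' C' ?M"
    by (rule factorial_bound_mono[OF G(4)] factorial_bound_mono[OF G'(4)]; use G G' in simp)+
  have "factorial_bound ?d (\<lambda>k s. G k s + G' k s) (C + C') ?M"
    unfolding factorial_bound_def
  proof (intro allI conjI ballI)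
    fix k
    show "holo_on (\<lambda>s. G k s + G' k s) (polydisk ?d)"
      using F by (intro holo_on_add) (auto simp: factorial_bound_def)
    fix s :: "complex^'a" assume "s \<in> polydisk ?d"
    then have "norm (G k s) \<le> C * ?M ^ k * fact k" "norm (G' k s) \<le> C' * ?M ^ k * fact k"
      using F by (auto simp: factorial_bound_def)
    then show "norm (G k s + G' k s) \<le> (C + C') * ?M ^ k * fact k"
      using norm_triangle_ineq[of "G k s" "G' k s"] by (simp add: distrib_right)
  qed
  moreover have "(a + b) $$ int k = abs_hgerm (\<lambda>s. G k s + G' k s)" for k
    using G(4) G'(4) G(1) G'(1)
    by (simp add: G(5) G'(5) abs_hgerm_ops holo_on_polydisk_imp_holo_at0 factorial_bound_def)
  ultimately show ?thesis
    by (rule conv_ops0I[rotated 3]) (use assms G G' in \<open>auto simp: conv_ops0_neg\<close>)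
qed

lemma scalar_times_conv_ops0:
  assumes "a \<in> conv_ops0" shows "scalar g * a \<in> conv_ops0"
proof -
  obtain d C M G where G: "d > 0" "C \<ge> 0" "M \<ge> 1" "factorial_bound d G C M" "\<And>k. a $$ int k = abs_hgerm (G k)"
    using conv_ops0_imp_factorial_bound[OF assms(1)] by blast
  obtain f where f: "holo_at0 f" "g = abs_hgerm f" by (rule hgerm_cases)
  obtain d1 where d1: "d1 > 0" "holo_on f (polydisk d1)" using f(1) by (auto simp: holo_at0_def)
  obtain d2 where d2: "d2 > 0" "\<And>s. s \<in> polydisk d2 \<Longrightarrow> norm (f s) \<le> norm (f 0) + 1"
    using eventually_on_polydisk[OF holo_at0_locally_bounded[OF f(1)]] by blast
  let ?d = "min d (min d1 d2)"
  have F: "factorial_bound ?d G C M" by (rule factorial_bound_mono[OF G(4)]) (use G in auto)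
  have "factorial_bound ?d (\<lambda>k s. f s * G k s) ((norm (f 0) + 1) * C) M"
    unfolding factorial_bound_def
  proof (intro allI conjI ballI)
    fix k
    show "holo_on (\<lambda>s. f s * G k s) (polydisk ?d)"
      using F holo_on_subset[OF d1(2) polydisk_mono[of ?d]] by (intro holo_on_mult) (auto simp: factorial_bound_def)
    fix s :: "complex^'a" assume s: "s \<in> polydisk ?d"
    then have "norm (G k s) \<le> C * M ^ k * fact k" using F by (auto simp: factorial_bound_def)
    moreover have "norm (f s) \<le> norm (f 0) + 1" using d2(2) s by (simp add: polydisk_def)
    ultimately have "norm (f s) * norm (G k s) \<le> (norm (f 0) + 1) * (C * M ^ k * fact k)"
      by (intro mult_mono) auto
    then show "norm (f s * G k s) \<le> (norm (f 0) + 1) * C * M ^ k * fact k"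
      by (simp add: norm_mult mult_ac)
  qed
  moreover have "(scalar g * a) $$ int k = abs_hgerm (\<lambda>s. f s * G k s)" for k
    using G(4) G(1) f by (simp add: G(5) abs_hgerm_ops holo_on_polydisk_imp_holo_at0 factorial_bound_def)
  ultimately show ?thesis
    by (rule conv_ops0I[rotated 3]) (use assms G d1 d2 in \<open>auto simp: conv_ops0_neg\<close>)
qed

lemma conv_ops0_1: "1 \<in> conv_ops0"
  by (rule conv_ops0I[of _ 1 1 "\<lambda>k s. if k = 0 then 1 else 0" 1])
     (simp_all add: factorial_bound_def holo_on_const one_hgerm_def zero_hgerm_def)

lemma conv_ops0_0: "0 \<in> conv_ops0"
  using scalar_times_conv_ops0[OF conv_ops0_1, of 0] by simp

lemma conv_ops0_diff: "a \<in> conv_ops0 \<Longrightarrow> b \<in> conv_ops0 \<Longrightarrow> a - b \<in> conv_ops0"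
proof -
  assume ab: "a \<in> conv_ops0" "b \<in> conv_ops0"
  have "scalar (- 1) * b = - b" by (rule fls_eqI) simp
  then show ?thesis using conv_ops0_add[OF ab(1) scalar_times_conv_ops0[OF ab(2), of "- 1"]] by simp
qed

lemma conv_ops0_sum: "(\<And>i. i \<in> I \<Longrightarrow> f i \<in> conv_ops0) \<Longrightarrow> sum f I \<in> conv_ops0"
  by (induction I rule: infinite_finite_induct) (auto intro: conv_ops0_add conv_ops0_0)

text \<open>
  Shifting the coefficients differentiates or integrates \<open>\<Sum> g\<^sub>k x\<^sup>k / k!\<close>. A derivative costs the factor
  \<open>k + 1 \<le> 2\<^sup>k\<close>, which is absorbed by doubling \<open>M\<close>.
\<close>

lemma conv_ops0_shift_left:
  assumes "a \<in> conv_ops0" "a $$ 0 = 0" shows "fls_shift 1 a \<in> conv_ops0"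
proof -
  obtain d C M G where G: "d > 0" "C \<ge> 0" "M \<ge> 1" "factorial_bound d G C M" "\<And>k. a $$ int k = abs_hgerm (G k)"
    using conv_ops0_imp_factorial_bound[OF assms(1)] by blast
  have "factorial_bound d (\<lambda>k. G (Suc k)) (C * M) (2 * M)"
    unfolding factorial_bound_def
  proof (intro allI conjI ballI)
    fix k
    show "holo_on (G (Suc k)) (polydisk d)" using G(4) by (simp add: factorial_bound_def)
    fix s :: "complex^'a" assume s: "s \<in> polydisk d"
    have "Suc k \<le> 2 ^ k" by (induction k) auto
    then have *: "real k + 1 \<le> 2 ^ k" by (metis Suc_eq_plus1 of_nat_Suc of_nat_le_iff of_nat_numeral of_nat_power add.commute)
    have "norm (G (Suc k) s) \<le> C * M ^ Suc k * fact (Suc k)"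
      using G(4) s unfolding factorial_bound_def by blast
    also have "\<dots> = C * M ^ Suc k * (real k + 1) * fact k" by (simp add: algebra_simps)
    also have "\<dots> \<le> C * M ^ Suc k * 2 ^ k * fact k"
      using * G(2,3) by (intro mult_right_mono mult_left_mono) auto
    also have "\<dots> = C * M * (2 * M) ^ k * fact k" by (simp add: power_mult_distrib)
    finally show "norm (G (Suc k) s) \<le> C * M * (2 * M) ^ k * fact k" .
  qed
  moreover have "fls_shift 1 a $$ int k = abs_hgerm (G (Suc k))" for k
    using G(5)[of "Suc k"] by (simp add: add.commute)
  ultimately show ?thesis
  proof (rule conv_ops0I[rotated 3])
    fix k :: int assume "k < 0"
    then show "fls_shift 1 a $$ k = 0" using assms by (cases "k = -1") (auto simp: conv_ops0_neg)
  qed (use G in auto)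
qed

lemma conv_ops0_shift_right:
  assumes "a \<in> conv_ops0" shows "fls_shift (-1) a \<in> conv_ops0"
proof -
  obtain d C M G where G: "d > 0" "C \<ge> 0" "M \<ge> 1" "factorial_bound d G C M" "\<And>k. a $$ int k = abs_hgerm (G k)"
    using conv_ops0_imp_factorial_bound[OF assms(1)] by blast
  have "factorial_bound d (\<lambda>k. if k = 0 then \<lambda>s. 0 else G (k - 1)) C M"
    unfolding factorial_bound_def
  proof (intro allI conjI ballI)
    fix k
    show "holo_on (if k = 0 then \<lambda>s. 0 else G (k - 1)) (polydisk d)"
      using G(4) by (simp add: factorial_bound_def holo_on_const)
    fix s :: "complex^'a" assume s: "s \<in> polydisk d"
    show "norm ((if k = 0 then \<lambda>s. 0 else G (k - 1)) s) \<le> C * M ^ k * fact k"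
    proof (cases k)
      case (Suc m)
      have "norm (G m s) \<le> C * M ^ m * fact m" using G(4) s by (auto simp: factorial_bound_def)
      also have "\<dots> \<le> C * M ^ Suc m * fact (Suc m)"
        using G(2,3) by (intro mult_mono power_increasing fact_mono mult_left_mono) auto
      finally show ?thesis using Suc by simp
    qed (use G(2) in simp)
  qed
  moreover have "fls_shift (-1) a $$ int k = abs_hgerm (if k = 0 then \<lambda>s. 0 else G (k - 1))" for k
    using assms G(5)[of "k - 1"] by (cases k) (auto simp: conv_ops0_neg zero_hgerm_def)
  ultimately show ?thesis
    by (rule conv_ops0I[rotated 3]) (use assms G in \<open>auto simp: conv_ops0_neg\<close>)
qed

lemma conv_ops0_shift:
  assumes "a \<in> conv_ops0" "\<And>k. k < m \<Longrightarrow> a $$ k = 0" shows "fls_shift m a \<in> conv_ops0"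
proof (cases "m \<le> 0")
  case True
  have "fls_shift (- int n) a \<in> conv_ops0" for n
  proof (induction n)
    case (Suc n)
    then show ?case using conv_ops0_shift_right[OF Suc] by (simp add: algebra_simps)
  qed (use assms in simp)
  from this[of "nat (- m)"] True show ?thesis by simp
next
  case False
  have "int n \<le> m \<Longrightarrow> fls_shift (int n) a \<in> conv_ops0" for n
  proof (induction n)
    case (Suc n)
    then have "fls_shift 1 (fls_shift (int n) a) \<in> conv_ops0"
      using assms(2) by (intro conv_ops0_shift_left) auto
    then show ?case by (simp add: algebra_simps)
  qed (use assms in simp)
  from this[of "nat m"] False show ?thesis by simp
qed

lemma conv_ops0_shift_up: "a \<in> conv_ops0 \<Longrightarrow> fls_shift (- int m) a \<in> conv_ops0"
  by (rule conv_ops0_shift) (simp_all add: conv_ops0_neg)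

lemma conv_ops0_subset_conv_ops: "a \<in> conv_ops0 \<Longrightarrow> a \<in> conv_ops"
  unfolding conv_ops_def by (intro CollectI exI[of _ 0]) simp

lemma conv_ops_iff_shift: "a \<in> conv_ops \<longleftrightarrow> (\<exists>m. fls_shift (- int m) a \<in> conv_ops0)"
  by (simp add: conv_ops_def fls_X_power_times_conv_shift)

lemma conv_ops_shift_mono:
  assumes "fls_shift (- int m) a \<in> conv_ops0" "m \<le> n" shows "fls_shift (- int n) a \<in> conv_ops0"
proof -
  have "fls_shift (- int (n - m)) (fls_shift (- int m) a) \<in> conv_ops0"
    by (rule conv_ops0_shift_up[OF assms(1)])
  then show ?thesis using assms(2) by (simp add: of_nat_diff)
qed

lemma conv_ops_add:
  assumes "a \<in> conv_ops" "b \<in> conv_ops" shows "a + b \<in> conv_ops"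
proof -
  obtain m n where "fls_shift (- int m) a \<in> conv_ops0" "fls_shift (- int n) b \<in> conv_ops0"
    using assms by (auto simp: conv_ops_iff_shift)
  then have "fls_shift (- int (max m n)) a \<in> conv_ops0" "fls_shift (- int (max m n)) b \<in> conv_ops0"
    by (auto intro: conv_ops_shift_mono)
  then show ?thesis using conv_ops0_add unfolding conv_ops_iff_shift fls_shift_plus by (intro exI)
qed

lemma scalar_times_conv_ops:
  assumes "a \<in> conv_ops" shows "scalar g * a \<in> conv_ops"
proof -
  obtain m where m: "fls_shift (- int m) a \<in> conv_ops0" using assms by (auto simp: conv_ops_iff_shift)
  have "fls_shift (- int m) (scalar g * a) = scalar g * fls_shift (- int m) a"
    by (rule fls_eqI) simp
  then show ?thesis using scalar_times_conv_ops0[OF m, of g] unfolding conv_ops_iff_shift by metis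
qed

lemma conv_ops_sum: "(\<And>i. i \<in> I \<Longrightarrow> f i \<in> conv_ops) \<Longrightarrow> sum f I \<in> conv_ops"
  by (induction I rule: infinite_finite_induct)
     (auto intro: conv_ops_add conv_ops0_subset_conv_ops[OF conv_ops0_0])

lemma fls_nth_map_coefficients:
  assumes "f 0 = 0" shows "Abs_fls (\<lambda>k. f (a $$ k)) $$ n = f (a $$ n)"
  by (rule nth_Abs_fls_lower_bound[of "fls_subdegree a"]) (auto simp: assms)

text \<open>The bound is a supremum bound, so it holds with the same constants wherever \<open>\<rho>\<close> maps into the old polydisk.\<close>

lemma pullback_conv_ops0:
  assumes "a \<in> conv_ops0" and \<rho>: "\<And>i. germ_at0 (\<rho> i) = 0"
  shows "Abs_fls (\<lambda>k. germ_comp (a $$ k) \<rho>) \<in> conv_ops0"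
proof -
  obtain d C M G where G: "d > 0" "C \<ge> 0" "M \<ge> 1" "factorial_bound d G C M" "\<And>k. a $$ int k = abs_hgerm (G k)"
    using conv_ops0_imp_factorial_bound[OF assms(1)] by blast
  obtain R where R: "\<And>i. holo_at0 (R i)" "\<rho> = (\<lambda>i. abs_hgerm (R i))" by (rule hgerm_family_cases) blast
  have R0: "R i 0 = 0" for i using \<rho>[of i] R by (simp add: abs_hgerm_ops)
  have "\<forall>\<^sub>F s in nhds 0. \<exists>f'. (R i has_derivative f') (at s) \<and> (\<forall>c v. f' (c *s v) = c * f' v)" for i
    by (rule holo_at0_eventually_linear_derivative[OF R(1)])
  then have ev1: "\<forall>\<^sub>F s in nhds 0. \<forall>i. \<exists>f'. (R i has_derivative f') (at s) \<and> (\<forall>c v. f' (c *s v) = c * f' v)"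
    by (rule eventually_all_finite)
  have ev2: "\<forall>\<^sub>F s in nhds 0. (\<chi> i. R i s) \<in> polydisk d"
    using topological_tendstoD[OF tendsto_vec_lambda_holo[OF R(1) R0] open_polydisk] G(1) by simp
  obtain d' where d': "d' > 0"
    "\<And>s. s \<in> polydisk d' \<Longrightarrow> (\<forall>i. \<exists>f'. (R i has_derivative f') (at s) \<and> (\<forall>c v. f' (c *s v) = c * f' v)) \<and>
        (\<chi> i. R i s) \<in> polydisk d"
    using eventually_on_polydisk[OF eventually_conj[OF ev1 ev2]] by blast
  have R_holo: "holo_on (R i) (polydisk d')" for i
    unfolding holo_on_def using d'(2) by blast
  have "factorial_bound d' (\<lambda>k s. G k (\<chi> i. R i s)) C M"
    unfolding factorial_bound_def
  proof (intro allI conjI ballI)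
    fix k
    show "holo_on (\<lambda>s. G k (\<chi> i. R i s)) (polydisk d')"
      by (rule holo_on_compose[of _ "polydisk d", OF _ R_holo])
         (use G(4) d'(2) in \<open>simp_all add: factorial_bound_def\<close>)
    fix s :: "complex^'a" assume "s \<in> polydisk d'"
    then have "(\<chi> i. R i s) \<in> polydisk d" using d'(2) by blast
    then show "norm (G k (\<chi> i. R i s)) \<le> C * M ^ k * fact k"
      using G(4) by (simp add: factorial_bound_def)
  qed
  moreover have "Abs_fls (\<lambda>k. germ_comp (a $$ k) \<rho>) $$ int k = abs_hgerm (\<lambda>s. G k (\<chi> i. R i s))" for k
  proof -
    have "holo_at0 (G k)" using G(1,4) by (auto simp: factorial_bound_def intro: holo_on_polydisk_imp_holo_at0)
    then have "germ_comp (a $$ int k) \<rho> = abs_hgerm (\<lambda>s. G k (\<chi> i. R i s))"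
      unfolding G(5) R(2) by (rule germ_comp_abs_hgerm[OF _ R(1) R0])
    then show ?thesis
      by (subst fls_nth_map_coefficients) (simp_all add: germ_comp_simps \<rho>)
  qed
  ultimately show ?thesis
  proof (rule conv_ops0I[rotated 3])
    fix k :: int assume "k < 0"
    then show "Abs_fls (\<lambda>k. germ_comp (a $$ k) \<rho>) $$ k = 0"
      by (subst fls_nth_map_coefficients) (simp_all add: germ_comp_simps \<rho> conv_ops0_neg assms)
  qed (use G d' in auto)
qed

section \<open>The coefficient equations of the lattice\<close>

lemma sum_fun_app: "(\<Sum>j\<in>A. f j) l = (\<Sum>j\<in>A. f j l)"
  by (induction A rule: infinite_finite_induct) (auto simp: plus_fun_def zero_fun_def)

text \<open>
  For \<open>S j = s\<^sub>j\<close>, \<open>H = h(s\<^sub>1)\<close>, \<open>D = h'(s\<^sub>1)\<close> these equations cut out the lattice of \<open>h\<close>. They come from eliminating the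
  multipliers \<open>a\<^sub>j\<close> from \<open>u = \<Sum> a\<^sub>j v\<^sub>j\<close>: the coefficients \<open>u 0 $$ 0\<close> and \<open>u 0 $$ 1\<close> are those of \<open>a\<^sub>0\<close>, and
  \<open>u 1 $$ 1 - u 0 $$ 1 * S 1\<close> is the constant term of \<open>a\<^sub>1\<close>. With arbitrary parameters the same equations describe the
  lattice in another basis and its pullbacks.
\<close>

definition lattice_eqs ::
  "nat \<Rightarrow> (nat \<Rightarrow> 'a::comm_ring_1) \<Rightarrow> 'a \<Rightarrow> 'a \<Rightarrow> (nat \<Rightarrow> 'a fls) \<Rightarrow> bool" where
  "lattice_eqs r S H D u \<longleftrightarrow>
     u 1 $$ 0 = u 0 $$ 0 * S 1 \<and>
     u 2 $$ 0 = u 0 $$ 0 * H \<and>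
     u 2 $$ 1 = u 0 $$ 0 * S 2 + u 0 $$ 1 * H + (u 1 $$ 1 - u 0 $$ 1 * S 1) * D \<and>
     (\<forall>j\<in>{3..r}. (\<forall>k<int j - 1. u j $$ k = 0) \<and> u j $$ (int j - 1) = u 0 $$ 0 * S j)"

text \<open>The section \<open>v\<^sub>0\<close>, with the parameters \<open>S\<close> and \<open>H\<close> of \<open>lattice_eqs\<close>.\<close>

definition section_form :: "nat \<Rightarrow> (nat \<Rightarrow> 'a::comm_ring_1) \<Rightarrow> 'a \<Rightarrow> nat \<Rightarrow> 'a fls" where
  "section_form r S H l =
     (if l = 0 then 1
      else if l \<le> r then fls_shift (1 - int l) (fls_const (S l)) + (if l = 2 then fls_const H else 0)
      else 0)"

lemma section_form_nth:
  "section_form r S H l $$ k =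
     (if l = 0 then if k = 0 then 1 else 0
      else if l \<le> r then (if k = int l - 1 then S l else 0) + (if l = 2 \<and> k = 0 then H else 0)
      else 0)"
  by (auto simp: section_form_def)

lemma times_dt_pow: "x * dt_pow m = fls_shift m x" "dt_pow m * x = fls_shift m x"
  unfolding dt_pow_def fls_X_intpow_times_conv_shift by simp_all

lemma vsec0_eq_section_form:
  assumes "2 \<le> r"
  shows "vsec0 r ix h = section_form r (\<lambda>j. germ_coord (ix j)) (germ_fps h (germ_coord (ix 1)))"
proof (rule ext, rule fls_eqI)
  fix l k
  have "vsec0 r ix h l = scalar (germ_const (evec 0 l))
      + (\<Sum>j = 1..r. scalar (germ_coord (ix j)) * dt_pow (1 - int j) * scalar (germ_const (evec j l)))
      + scalar (germ_fps h (germ_coord (ix 1))) * scalar (germ_const (evec 2 l))"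
    by (simp add: vsec0_def smul_def incl_def plus_fun_def sum_fun_app)
  also have "(\<Sum>j = 1..r. scalar (germ_coord (ix j)) * dt_pow (1 - int j) * scalar (germ_const (evec j l)))
     = (\<Sum>j = 1..r. if j = l then scalar (germ_coord (ix l)) * dt_pow (1 - int l) else 0)"
    by (intro sum.cong) (auto simp: evec_def germ_const_simps)
  also have "\<dots> = (if l \<in> {1..r} then fls_shift (1 - int l) (scalar (germ_coord (ix l))) else 0)"
    by (auto simp: times_dt_pow)
  finally show "vsec0 r ix h l $$ k
      = section_form r (\<lambda>j. germ_coord (ix j)) (germ_fps h (germ_coord (ix 1))) l $$ k"
    using assms by (auto simp: section_form_def evec_def germ_const_simps)
qed

lemma vsec_component:
  assumes "2 \<le> r" "inj_on ix {1..r}" "fps_conv_radius h > 0" "j \<in> {1..r}"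
  shows "vsec r ix h j l = (if l = j then fls_shift (- int j) 1 else 0)
     + (if j = 1 \<and> l = 2 then fls_shift (- 1) (scalar (germ_fps (fps_deriv h) (germ_coord (ix 1)))) else 0)"
    (is "_ = ?R")
proof (rule fls_eqI)
  fix k
  have ix: "ix j = ix i \<longleftrightarrow> j = i" if "i \<in> {1..r}" for i
    using assms(2,4) that by (auto dest: inj_onD)
  have "vsec r ix h j l $$ k = germ_partial (ix j)
      (section_form r (\<lambda>j. germ_coord (ix j)) (germ_fps h (germ_coord (ix 1))) l $$ (k - 1))"
    using assms(4)
    by (simp add: vsec_def smul_def times_dt_pow ds_act_def vsec0_eq_section_form[OF assms(1)]
        fls_nth_map_coefficients germ_partial_simps)
  also have "\<dots> = ?R $$ k"
    using assms(1,3,4) ix[of l] ix[of 1]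
    by (auto simp: section_form_nth germ_partial_simps germ_partial_germ_fps_coord)
  finally show "vsec r ix h j l $$ k = ?R $$ k" .
qed

lemma brieskorn_combination:
  assumes "2 \<le> r" "inj_on ix {1..r}" "fps_conv_radius h > 0"
  shows "(\<Sum>j = 0..r. smul (a j) (vsec r ix h j)) l =
     a 0 * section_form r (\<lambda>j. germ_coord (ix j)) (germ_fps h (germ_coord (ix 1))) l
     + (if l \<in> {1..r} then fls_shift (- int l) (a l) else 0)
     + (if l = 2 then scalar (germ_fps (fps_deriv h) (germ_coord (ix 1))) * fls_shift (- 1) (a 1) else 0)"
    (is "_ = a 0 * ?v l + _ + (if l = 2 then scalar ?D * _ else 0)")
proof -
  have "(\<Sum>j = 0..r. smul (a j) (vsec r ix h j)) l = (\<Sum>j = 0..r. a j * vsec r ix h j l)"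
    by (simp add: sum_fun_app smul_def)
  also have "\<dots> = a 0 * ?v l + (\<Sum>j = 1..r. a j * vsec r ix h j l)"
    by (simp add: sum.atLeast_Suc_atMost vsec_def vsec0_eq_section_form[OF assms(1)])
  also have "(\<Sum>j = 1..r. a j * vsec r ix h j l) =
      (\<Sum>j = 1..r. (if j = l then fls_shift (- int l) (a l) else 0)
         + (if j = 1 then if l = 2 then scalar ?D * fls_shift (- 1) (a 1) else 0 else 0))"
  proof (rule sum.cong[OF refl])
    fix j assume "j \<in> {1..r}"
    note v = vsec_component[OF assms this]
    have *: "x * fls_shift m y = fls_shift m (x * y)" "fls_shift m y * x = fls_shift m (x * y)"
      for x y :: "'a hgerm fls" and m
      by (simp_all add: fls_shifted_times_simps mult.commute)
    show "a j * vsec r ix h j l = (if j = l then fls_shift (- int l) (a l) else 0)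
         + (if j = 1 then if l = 2 then scalar ?D * fls_shift (- 1) (a 1) else 0 else 0)"
      unfolding v by (auto simp: distrib_left * mult.commute)
  qed
  also have "\<dots> = (if l \<in> {1..r} then fls_shift (- int l) (a l) else 0)
     + (if l = 2 then scalar ?D * fls_shift (- 1) (a 1) else 0)"
    using assms(1) by (simp add: sum.distrib)
  finally show ?thesis by (simp add: add.assoc)
qed

lemma section_form_times_nth:
  "(x * section_form r S H l) $$ k =
     (if l = 0 then x $$ k
      else if l \<le> r then S l * x $$ (k + 1 - int l) + (if l = 2 then H * x $$ k else 0)
      else 0)"
proof -
  have "x * fls_shift m (fls_const s) = fls_shift m (fls_const s * x)" for m s
    by (simp add: fls_shifted_times_simps mult.commute)
  then show ?thesis by (simp add: section_form_def distrib_left mult.commute add_diff_eq)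
qed

lemma section_form_times_conv_ops0:
  assumes "x \<in> conv_ops0" shows "x * section_form r S H l \<in> conv_ops0"
proof (cases "l = 0 \<or> r < l")
  case False
  then have "x * section_form r S H l =
      scalar (S l) * fls_shift (- int (l - 1)) x + scalar (if l = 2 then H else 0) * x"
    by (intro fls_eqI) (simp add: section_form_times_nth of_nat_diff algebra_simps)
  then show ?thesis by (simp only:) (intro conv_ops0_add scalar_times_conv_ops0 conv_ops0_shift_up assms)
qed (auto simp: section_form_def assms conv_ops0_0)

text \<open>
  Both inclusions read off coefficients. In a combination of the generators \<open>v\<^sub>j\<close> the multipliers of \<open>v\<^sub>j\<close>,
  \<open>j \<ge> 1\<close>, enter only coefficients that the equations leave free, except that the constant term of the multiplier of \<open>v\<^sub>1\<close>
  enters the equation for \<open>u 2 $$ 1\<close>, where it is expressed by \<open>u 1 $$ 1\<close>. So the multipliers can be solved for.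
\<close>

lemma brieskorn_iff:
  fixes ix :: "nat \<Rightarrow> 'n::finite"
  assumes r: "2 \<le> r" "inj_on ix {1..r}" "fps_conv_radius h > 0"
  shows "u \<in> brieskorn r ix h \<longleftrightarrow> (\<forall>j\<le>r. u j \<in> conv_ops0) \<and> (\<forall>j>r. u j = 0) \<and>
     lattice_eqs r (\<lambda>j. germ_coord (ix j)) (germ_fps h (germ_coord (ix 1)))
       (germ_fps (fps_deriv h) (germ_coord (ix 1))) u"
    (is "_ \<longleftrightarrow> _ \<and> _ \<and> lattice_eqs r ?S ?H ?D u")
proof
  assume "u \<in> brieskorn r ix h"
  then obtain a where a: "\<And>j. j \<le> r \<Longrightarrow> a j \<in> conv_ops0" and u: "u = (\<Sum>j = 0..r. smul (a j) (vsec r ix h j))"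
    unfolding brieskorn_def by blast
  have u_eq: "u l = a 0 * section_form r ?S ?H l + (if l \<in> {1..r} then fls_shift (- int l) (a l) else 0)
     + (if l = 2 then scalar ?D * fls_shift (- 1) (a 1) else 0)" for l
    unfolding u by (rule brieskorn_combination[OF r])
  have neg: "a j $$ k = 0" if "j \<le> r" "k < 0" for j k using a[OF that(1)] that(2) by (rule conv_ops0_neg)
  have "a 0 * section_form r ?S ?H l \<in> conv_ops0" for l by (rule section_form_times_conv_ops0[OF a]) simp
  then have "u l \<in> conv_ops0" if "l \<le> r" for l
    unfolding u_eq using that a r(1) conv_ops0_shift_up[of "a 1" 1] conv_ops0_shift_up[of "a l" l]
    by (auto intro!: conv_ops0_add scalar_times_conv_ops0 simp: conv_ops0_0)
  moreover have "u l = 0" if "l > r" for l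
    unfolding u_eq using that r(1) by (simp add: section_form_def)
  moreover have "lattice_eqs r ?S ?H ?D u"
    unfolding lattice_eqs_def u_eq using r(1) neg
    by (auto simp: section_form_times_nth algebra_simps)
  ultimately show "(\<forall>j\<le>r. u j \<in> conv_ops0) \<and> (\<forall>j>r. u j = 0) \<and> lattice_eqs r ?S ?H ?D u" by blast
next
  assume *: "(\<forall>j\<le>r. u j \<in> conv_ops0) \<and> (\<forall>j>r. u j = 0) \<and> lattice_eqs r ?S ?H ?D u"
  then have conv: "\<And>j. j \<le> r \<Longrightarrow> u j \<in> conv_ops0" and zero: "\<And>j. j > r \<Longrightarrow> u j = 0"
    and E: "lattice_eqs r ?S ?H ?D u" by auto
  have neg: "u j $$ k = 0" if "j \<le> r" "k < 0" for j k using conv[OF that(1)] that(2) by (rule conv_ops0_neg)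
  have sec: "u 0 * section_form r ?S ?H l \<in> conv_ops0" for l by (rule section_form_times_conv_ops0[OF conv]) simp
  define a1 where "a1 = fls_shift 1 (u 1 - u 0 * section_form r ?S ?H 1)"
  have a1: "a1 \<in> conv_ops0"
    unfolding a1_def
  proof (rule conv_ops0_shift)
    show "u 1 - u 0 * section_form r ?S ?H 1 \<in> conv_ops0" using conv sec r(1) by (intro conv_ops0_diff) auto
    fix k :: int assume "k < 1"
    then show "(u 1 - u 0 * section_form r ?S ?H 1) $$ k = 0"
      using E r(1) neg by (cases "k = 0") (auto simp: section_form_times_nth lattice_eqs_def algebra_simps)
  qed
  \<comment> \<open>\<open>b l\<close> is what the generator \<open>v\<^sub>l\<close> has to contribute to the component \<open>l\<close>, namely \<open>\<partial>\<^sub>t\<^sup>-\<^sup>l a\<^sub>l\<close>\<close>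
  define b where "b l = u l - u 0 * section_form r ?S ?H l - (if l = 2 then scalar ?D * fls_shift (- 1) a1 else 0)" for l
  have b: "fls_shift (int l) (b l) \<in> conv_ops0" if "l \<le> r" "l \<noteq> 0" for l
  proof (rule conv_ops0_shift)
    show "b l \<in> conv_ops0"
      unfolding b_def using conv sec a1 that conv_ops0_shift_up[of a1 1]
      by (intro conv_ops0_diff) (auto intro: scalar_times_conv_ops0 conv_ops0_0)
    fix k :: int assume k: "k < int l"
    have "l = 1 \<or> l = 2 \<or> l \<ge> 3" using that by linarith
    then consider "l = 1" | "l = 2" | "l \<ge> 3" by blast
    then show "b l $$ k = 0"
    proof cases
      case 1
      then show ?thesis using E r(1) neg k
        by (cases "k = 0") (auto simp: b_def section_form_times_nth lattice_eqs_def algebra_simps)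
    next
      case 2
      have "k < 0 \<or> k = 0 \<or> k = 1" using k 2 by auto
      moreover have a1_0: "a1 $$ 0 = u 1 $$ 1 - u 0 $$ 1 * ?S 1"
        using r(1) by (simp add: a1_def section_form_times_nth mult.commute)
      moreover have "b 2 $$ k = u 2 $$ k - (?S 2 * u 0 $$ (k - 1) + ?H * u 0 $$ k) - ?D * a1 $$ (k - 1)"
        using r(1) by (simp add: b_def section_form_times_nth)
      moreover have "a1 $$ n = 0" if "n < 0" for n using a1 that by (rule conv_ops0_neg)
      ultimately show ?thesis using E r(1) neg unfolding lattice_eqs_def 2
        by (elim disjE) (simp_all add: mult.commute)
    next
      case 3
      then have "(\<forall>k<int l - 1. u l $$ k = 0) \<and> u l $$ (int l - 1) = u 0 $$ 0 * ?S l"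
        using E that by (auto simp: lattice_eqs_def)
      moreover have "k < int l - 1 \<or> k = int l - 1" using k by auto
      ultimately show ?thesis using r(1) neg 3 that
        by (auto simp: b_def section_form_times_nth mult.commute)
    qed
  qed
  define a where "a l = (if l = 0 then u 0 else fls_shift (int l) (b l))" for l
  have a_1: "a 1 = a1" by (simp add: a_def b_def a1_def)
  have "u = (\<Sum>j = 0..r. smul (a j) (vsec r ix h j))"
  proof
    fix l
    show "u l = (\<Sum>j = 0..r. smul (a j) (vsec r ix h j)) l"
      unfolding brieskorn_combination[OF r] a_1 using zero[of l] r(1)
      by (auto simp: a_def b_def section_form_def)
  qed
  moreover have "a j \<in> conv_ops0" if "j \<le> r" for j
    using that conv b by (auto simp: a_def)
  ultimately show "u \<in> brieskorn r ix h" unfolding brieskorn_def by blast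
qed

section \<open>Unitriangular changes of basis\<close>

definition unitriangular :: "nat \<Rightarrow> (nat \<Rightarrow> nat \<Rightarrow> complex) \<Rightarrow> bool" where
  "unitriangular r B \<longleftrightarrow> (\<forall>i j. \<not> (j \<le> i \<and> i \<le> r) \<longrightarrow> B i j = 0) \<and> (\<forall>i\<le>r. B i i = 1)"

definition mat_prod :: "nat \<Rightarrow> (nat \<Rightarrow> nat \<Rightarrow> complex) \<Rightarrow> (nat \<Rightarrow> nat \<Rightarrow> complex) \<Rightarrow> nat \<Rightarrow> nat \<Rightarrow> complex" where
  "mat_prod r A B i k = (\<Sum>j = 0..r. A i j * B j k)"

definition mat_id :: "nat \<Rightarrow> nat \<Rightarrow> nat \<Rightarrow> complex" where
  "mat_id r i k = (if i = k \<and> i \<le> r then 1 else 0)"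

lemma unitriangular_zero: "unitriangular r B \<Longrightarrow> i < j \<Longrightarrow> B i j = 0"
  and unitriangular_diag: "unitriangular r B \<Longrightarrow> i \<le> r \<Longrightarrow> B i i = 1"
  by (simp_all add: unitriangular_def)

lemma mat_prod_assoc: "mat_prod r (mat_prod r A B) C = mat_prod r A (mat_prod r B C)"
proof (intro ext)
  fix i k
  have "mat_prod r (mat_prod r A B) C i k = (\<Sum>j = 0..r. \<Sum>l = 0..r. A i l * B l j * C j k)"
    by (simp add: mat_prod_def sum_distrib_right)
  also have "\<dots> = (\<Sum>l = 0..r. \<Sum>j = 0..r. A i l * B l j * C j k)" by (rule sum.swap)
  finally show "mat_prod r (mat_prod r A B) C i k = mat_prod r A (mat_prod r B C) i k"
    by (simp add: mat_prod_def sum_distrib_left mult.assoc)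
qed

lemma mat_prod_id:
  assumes "unitriangular r A"
  shows "mat_prod r A (mat_id r) = A" "mat_prod r (mat_id r) A = A"
proof -
  have "mat_prod r A (mat_id r) i k = (\<Sum>j = 0..r. if j = k then A i k else 0)" for i k
    unfolding mat_prod_def by (intro sum.cong) (auto simp: mat_id_def)
  then show "mat_prod r A (mat_id r) = A"
    using assms by (intro ext) (auto simp: unitriangular_def)
  have "mat_prod r (mat_id r) A i k = (\<Sum>j = 0..r. if j = i then A i k else 0)" for i k
    unfolding mat_prod_def by (intro sum.cong) (auto simp: mat_id_def)
  then show "mat_prod r (mat_id r) A = A"
    using assms by (intro ext) (auto simp: unitriangular_def)
qed

text \<open>Forward substitution, row by row: the unit diagonal makes every row of the inverse solvable.\<close>

lemma unitriangular_right_inverse: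
  assumes A: "unitriangular r A"
  obtains B where "unitriangular r B" "mat_prod r A B = mat_id r"
proof -
  have "\<exists>B. unitriangular r B \<and> (\<forall>i<n. \<forall>k. mat_prod r A B i k = mat_id r i k)" for n
  proof (induction n)
    case 0
    show ?case by (intro exI[of _ "mat_id r"]) (auto simp: unitriangular_def mat_id_def)
  next
    case (Suc n)
    then obtain B where B: "unitriangular r B" "\<And>i k. i < n \<Longrightarrow> mat_prod r A B i k = mat_id r i k" by blast
    show ?case
    proof (cases "n \<le> r")
      case False
      then have "mat_prod r A B n k = mat_id r n k" for k
        using A by (simp add: mat_prod_def mat_id_def unitriangular_def)
      with B show ?thesis by (metis less_Suc_eq)
    next
      case True
      define row where "row k = mat_id r n k - (\<Sum>j\<in>{0..r} - {n}. A n j * B j k)" for k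
      define B' where "B' = B(n := row)"
      have A0: "A i n = 0" if "i < n" for i using A that by (rule unitriangular_zero)
      have sum_split: "mat_prod r A C i k = A i n * C n k + (\<Sum>j\<in>{0..r} - {n}. A i j * C j k)" for C i k
        unfolding mat_prod_def using True by (subst sum.remove[of _ n]) auto
      have same: "(\<Sum>j\<in>{0..r} - {n}. A i j * B' j k) = (\<Sum>j\<in>{0..r} - {n}. A i j * B j k)" for i k
        by (intro sum.cong) (auto simp: B'_def)
      have zero: "A n j * B j k = 0" if "j \<noteq> n" "n \<le> k" for j k
      proof (cases "j < n")
        case True
        then show ?thesis using B(1) that by (simp add: unitriangular_def)
      next
        case False
        then show ?thesis using A that by (simp add: unitriangular_def)
      qed
      have row: "row k = mat_id r n k" if "n \<le> k" for k
        unfolding row_def using zero that by (subst sum.neutral) auto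
      have "unitriangular r B'"
        using B(1) row True by (auto simp: unitriangular_def B'_def mat_id_def)
      moreover have "mat_prod r A B' i k = mat_id r i k" if "i < Suc n" for i k
      proof (cases "i = n")
        case True
        then show ?thesis
          using \<open>n \<le> r\<close> unitriangular_diag[OF A] by (simp add: sum_split same) (simp add: B'_def row_def)
      next
        case False
        then show ?thesis using that B(2)[of i k] A0[of i] by (simp add: sum_split same)
      qed
      ultimately show ?thesis by blast
    qed
  qed
  from this[of "Suc r"] obtain B where B: "unitriangular r B" "\<forall>i<Suc r. \<forall>k. mat_prod r A B i k = mat_id r i k"
    by blast
  have "mat_prod r A B i k = mat_id r i k" for i k
    using B(2) A by (cases "i \<le> r") (auto simp: mat_prod_def mat_id_def unitriangular_def)
  then show thesis using that B(1) by (metis (no_types) ext)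
qed

definition mutually_inverse :: "nat \<Rightarrow> (nat \<Rightarrow> nat \<Rightarrow> complex) \<Rightarrow> (nat \<Rightarrow> nat \<Rightarrow> complex) \<Rightarrow> bool" where
  "mutually_inverse r A B \<longleftrightarrow> unitriangular r A \<and> unitriangular r B \<and>
     mat_prod r A B = mat_id r \<and> mat_prod r B A = mat_id r"

lemma mutually_inverse_sym: "mutually_inverse r A B \<Longrightarrow> mutually_inverse r B A"
  by (auto simp: mutually_inverse_def)

text \<open>A right inverse has itself a right inverse, which must be the given matrix.\<close>

lemma unitriangular_inverse:
  assumes "unitriangular r A"
  obtains B where "mutually_inverse r A B"
proof -
  obtain B where B: "unitriangular r B" "mat_prod r A B = mat_id r"
    using unitriangular_right_inverse[OF assms] by blast
  obtain C where C: "unitriangular r C" "mat_prod r B C = mat_id r"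
    using unitriangular_right_inverse[OF B(1)] by blast
  have "A = mat_prod r (mat_prod r A B) C"
    using mat_prod_id[OF assms] by (simp add: mat_prod_assoc C(2))
  also have "\<dots> = C" by (simp add: B(2) mat_prod_id[OF C(1)])
  finally show thesis using that[of B] assms B C by (simp add: mutually_inverse_def)
qed

lemma inverse_low_entries:
  assumes "mutually_inverse r A B" "2 \<le> r"
  shows "B 1 0 = - A 1 0" "B 2 1 = - A 2 1" "B 2 0 = A 2 1 * A 1 0 - A 2 0"
proof -
  have T: "unitriangular r A" "unitriangular r B" using assms by (auto simp: mutually_inverse_def)
  have prod: "mat_prod r A B i k = (\<Sum>j\<in>{k..i}. A i j * B j k)" if "i \<le> r" for i k
    unfolding mat_prod_def
    by (rule sum.mono_neutral_right) (use T that in \<open>auto simp: unitriangular_def\<close>)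
  have id: "mat_prod r A B i k = (if i = k then 1 else 0)" if "i \<le> r" for i k
    using assms that by (simp add: mutually_inverse_def mat_id_def)
  have d: "A 0 0 = 1" "A 1 1 = 1" "A 2 2 = 1" "B 0 0 = 1" "B 1 1 = 1" "B 2 2 = 1"
    using T assms(2) by (auto simp: unitriangular_def)
  have s: "{0..1} = {0, 1 :: nat}" "{1..2} = {1, 2 :: nat}" "{0..2} = {0, 1, 2 :: nat}" by auto
  have e: "A 1 0 + B 1 0 = 0" "A 2 1 + B 2 1 = 0" "A 2 0 + A 2 1 * B 1 0 + B 2 0 = 0"
    using prod[of 1 0] id[of 1 0] prod[of 2 1] id[of 2 1] prod[of 2 0] id[of 2 0] assms(2) d
    unfolding s by (auto simp: add.assoc)
  show *: "B 1 0 = - A 1 0" "B 2 1 = - A 2 1" using e(1,2) by (auto simp: add_eq_0_iff)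
  show "B 2 0 = A 2 1 * A 1 0 - A 2 0" using e(3) unfolding * by (simp add: add_eq_0_iff)
qed

text \<open>The coordinates of a section in the basis \<open>e\<close>, given its coordinates \<open>w\<close> in the basis \<open>\<Sum>\<^sub>l B\<^sub>i\<^sub>l e\<^sub>l\<close>.\<close>

definition base_change :: "nat \<Rightarrow> (nat \<Rightarrow> nat \<Rightarrow> complex) \<Rightarrow> 'n::finite gm \<Rightarrow> 'n gm" where
  "base_change r B w = (\<lambda>l. \<Sum>i = 0..r. scalar (germ_const (B i l)) * w i)"

lemma base_change_nth: "base_change r B w l $$ n = (\<Sum>i = 0..r. germ_const (B i l) * w i $$ n)"
  by (simp add: base_change_def fls_nth_sum)

lemma base_change_base_change:
  "base_change r B (base_change r A w) = base_change r (mat_prod r A B) w"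
proof (intro ext fls_eqI)
  fix l n
  have "base_change r B (base_change r A w) l $$ n
      = (\<Sum>i = 0..r. \<Sum>k = 0..r. germ_const (A k i * B i l) * w k $$ n)"
    by (simp add: base_change_nth sum_distrib_left germ_const_simps mult_ac)
  also have "\<dots> = (\<Sum>k = 0..r. \<Sum>i = 0..r. germ_const (A k i * B i l) * w k $$ n)" by (rule sum.swap)
  also have "\<dots> = base_change r (mat_prod r A B) w l $$ n"
    by (simp add: base_change_nth mat_prod_def germ_const_sum sum_distrib_right)
  finally show "base_change r B (base_change r A w) l $$ n = base_change r (mat_prod r A B) w l $$ n" .
qed

lemma base_change_id:
  assumes "\<And>j. j > r \<Longrightarrow> w j = 0" shows "base_change r (mat_id r) w = w"
proof
  fix l
  have "base_change r (mat_id r) w l = (\<Sum>i = 0..r. if i = l then w l else 0)"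
    unfolding base_change_def by (intro sum.cong) (auto simp: mat_id_def germ_const_simps)
  then show "base_change r (mat_id r) w l = w l" using assms by (auto simp: not_le)
qed

lemma base_change_inverse:
  assumes "mutually_inverse r A B" "\<And>j. j > r \<Longrightarrow> w j = 0"
  shows "base_change r B (base_change r A w) = w"
  using assms base_change_id[of r w] by (simp add: base_change_base_change mutually_inverse_def)

lemma base_change_beyond: "unitriangular r B \<Longrightarrow> l > r \<Longrightarrow> base_change r B w l = 0"
  by (auto simp: base_change_def unitriangular_def germ_const_simps intro!: sum.neutral)

lemma base_change_conv_ops0:
  "(\<And>j. j \<le> r \<Longrightarrow> w j \<in> conv_ops0) \<Longrightarrow> base_change r B w l \<in> conv_ops0"
  unfolding base_change_def by (intro conv_ops0_sum scalar_times_conv_ops0) auto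

lemma base_change_conv_ops:
  "(\<And>j. j \<le> r \<Longrightarrow> w j \<in> conv_ops) \<Longrightarrow> base_change r B w l \<in> conv_ops"
  unfolding base_change_def by (intro conv_ops_sum scalar_times_conv_ops) auto

lemma base_change_carrier:
  "unitriangular r B \<Longrightarrow> w \<in> gm_carrier r \<Longrightarrow> base_change r B w \<in> gm_carrier r"
  by (auto simp: gm_carrier_def base_change_beyond base_change_conv_ops)

subsection \<open>The lattice equations in another basis\<close>

lemma base_change_low_coefficients:
  assumes "unitriangular r B" "2 \<le> r" "\<And>j. j \<in> {3..r} \<Longrightarrow> w j $$ n = 0"
  shows "base_change r B w 0 $$ n = w 0 $$ n + germ_const (B 1 0) * w 1 $$ n + germ_const (B 2 0) * w 2 $$ n"
    "base_change r B w 1 $$ n = w 1 $$ n + germ_const (B 2 1) * w 2 $$ n"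
    "base_change r B w 2 $$ n = w 2 $$ n"
proof -
  have "base_change r B w l $$ n = (\<Sum>i\<in>{0, 1, 2}. germ_const (B i l) * w i $$ n)" for l
    unfolding base_change_nth
  proof (rule sum.mono_neutral_right)
    show "\<forall>i\<in>{0..r} - {0, 1, 2}. germ_const (B i l) * w i $$ n = 0"
    proof
      fix i assume "i \<in> {0..r} - {0, 1, 2}"
      then have "i \<in> {3..r}" by auto
      then show "germ_const (B i l) * w i $$ n = 0" using assms(3) by simp
    qed
  qed (use assms(2) in auto)
  then show "base_change r B w 0 $$ n = w 0 $$ n + germ_const (B 1 0) * w 1 $$ n + germ_const (B 2 0) * w 2 $$ n"
    "base_change r B w 1 $$ n = w 1 $$ n + germ_const (B 2 1) * w 2 $$ n"
    "base_change r B w 2 $$ n = w 2 $$ n"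
    using assms(1,2) by (simp_all add: unitriangular_def germ_const_simps add.assoc)
qed

lemma base_change_high_coefficients:
  assumes B: "unitriangular r B" and w: "\<And>i k. i \<in> {3..r} \<Longrightarrow> k < int i - 1 \<Longrightarrow> w i $$ k = 0"
    and j: "j \<in> {3..r}" and k: "k \<le> int j - 1"
  shows "base_change r B w j $$ k = w j $$ k"
proof -
  have "base_change r B w j $$ k = (\<Sum>i\<in>{j}. germ_const (B i j) * w i $$ k)"
    unfolding base_change_nth
  proof (rule sum.mono_neutral_right)
    show "\<forall>i\<in>{0..r} - {j}. germ_const (B i j) * w i $$ k = 0"
    proof
      fix i assume i: "i \<in> {0..r} - {j}"
      show "germ_const (B i j) * w i $$ k = 0"
      proof (cases "i < j")
        case True
        then show ?thesis using unitriangular_zero[OF B] by (simp add: germ_const_simps)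
      next
        case False
        then show ?thesis using i j k w[of i k] by auto
      qed
    qed
  qed (use j in auto)
  then show ?thesis using B j by (simp add: unitriangular_def germ_const_simps)
qed

text \<open>
  If the lattice with data \<open>S, H, D\<close> is rewritten in the basis given by \<open>B\<close>, it is again a lattice of
  the same shape, with data \<open>S', H', D'\<close>. Here \<open>p\<close> is the factor by which the leading coefficient
  \<open>u 0 $$ 0\<close> changes, and \<open>Q\<close> is the factor that appears when the equation for \<open>u 2 $$ 1\<close>, which
  contains itself through \<open>u 0 $$ 1\<close> and \<open>u 1 $$ 1\<close>, is solved. Both are units.
\<close>

definition adapted_data ::
  "nat \<Rightarrow> (nat \<Rightarrow> nat \<Rightarrow> complex) \<Rightarrow> (nat \<Rightarrow> 'n::finite hgerm) \<Rightarrow> 'n hgerm \<Rightarrow> 'n hgerm \<Rightarrow>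
     (nat \<Rightarrow> 'n hgerm) \<Rightarrow> 'n hgerm \<Rightarrow> 'n hgerm \<Rightarrow> bool" where
  "adapted_data r B S H D S' H' D' \<longleftrightarrow> (\<exists>p p' Q Q'. p * p' = 1 \<and> Q * Q' = 1 \<and>
     Q = 1 - germ_const (B 2 0) * (H - S 1 * D) - germ_const (B 2 1) * D \<and>
     p = 1 + germ_const (B 1 0) * S' 1 + germ_const (B 2 0) * H' \<and>
     S' 1 = p * (S 1 - germ_const (B 2 1) * H) \<and> H' = p * H \<and>
     Q * S' 2 = p * S 2 \<and> (\<forall>j\<in>{3..r}. S' j = p * S j) \<and>
     Q * D' = D + germ_const (B 1 0) * (H - S 1 * D))"

lemma unit_cancel:
  fixes p :: "'a::comm_ring_1"
  assumes "p * p' = 1" shows "p * x = p * y \<longleftrightarrow> x = y"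
proof
  assume "p * x = p * y"
  then have "p' * (p * x) = p' * (p * y)" by simp
  moreover have "p' * (p * z) = z" for z using assms by (simp add: mult.assoc[symmetric] mult.commute)
  ultimately show "x = y" by simp
qed simp

text \<open>
  For \<open>j \<ge> 3\<close> the component \<open>j\<close> starts at order \<open>j - 1 \<ge> 2\<close>. So in orders \<open>0\<close> and \<open>1\<close> the change of basis
  only mixes the components \<open>0, 1, 2\<close>, through \<open>B 1 0\<close>, \<open>B 2 0\<close>, \<open>B 2 1\<close>, and in order \<open>j - 1\<close> it fixes the component
  \<open>j\<close>. The equations for \<open>u 1 $$ 0\<close> and \<open>u 2 $$ 0\<close> then translate by the definition of \<open>p\<close>. The one for
  \<open>u 2 $$ 1\<close> is linear in \<open>w 0 $$ 0\<close>, \<open>w 0 $$ 1\<close>, \<open>w 1 $$ 1\<close>, and comparing the three factors after multiplication by \<open>Q\<close> needs,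
  besides the formulas for \<open>S' 2\<close> and \<open>D'\<close>, that \<open>H - S\<^sub>1 D\<close> transforms by \<open>Q (H' - S\<^sub>1' D') = H - S\<^sub>1 D\<close>.
\<close>

lemma lattice_eqs_base_change:
  assumes AB: "mutually_inverse r A B" and r: "2 \<le> r"
    and u: "u = base_change r B w" and w: "w = base_change r A u"
    and data: "adapted_data r B S H D S' H' D'"
  shows "lattice_eqs r S H D u \<longleftrightarrow> lattice_eqs r S' H' D' w"
proof -
  have A: "unitriangular r A" and B: "unitriangular r B" using AB by (auto simp: mutually_inverse_def)
  define a b c where "a = (germ_const (B 1 0) :: 'a hgerm)" and "b = (germ_const (B 2 0) :: 'a hgerm)"
    and "c = (germ_const (B 2 1) :: 'a hgerm)"
  obtain p p' Q Q' where pp': "p * p' = 1" and QQ': "Q * Q' = 1"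
    and Q: "Q = 1 - b * (H - S 1 * D) - c * D"
    and p: "p = 1 + a * S' 1 + b * H'" and S1: "S' 1 = p * (S 1 - c * H)" and H': "H' = p * H"
    and S2: "Q * S' 2 = p * S 2" and Sj: "\<forall>j\<in>{3..r}. S' j = p * S j"
    and D': "Q * D' = D + a * (H - S 1 * D)"
    using data unfolding adapted_data_def a_def b_def c_def by blast
  have Q_euler: "Q * (H' - S' 1 * D') = H - S 1 * D"
  proof -
    have p_eq: "p * (1 - a * (S 1 - c * H) - b * H) = 1"
      using p unfolding S1 H' by (simp add: algebra_simps)
    have "Q * (H' - S' 1 * D') = p * (Q * H - (S 1 - c * H) * (Q * D'))"
      unfolding S1 H' by (simp add: algebra_simps)
    also have "\<dots> = (H - S 1 * D) * (p * (1 - a * (S 1 - c * H) - b * H))"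
      unfolding D' unfolding Q by (simp add: algebra_simps)
    finally show ?thesis unfolding p_eq by simp
  qed
  let ?high = "\<lambda>x. \<forall>j\<in>{3..r}. \<forall>k<int j - 1. x j $$ k = 0"
  have high_iff: "?high u \<longleftrightarrow> ?high w"
  proof
    assume h: "?high u"
    show "?high w" by (subst w) (use h base_change_high_coefficients[OF A, of u] in auto)
  next
    assume h: "?high w"
    show "?high u" by (subst u) (use h base_change_high_coefficients[OF B, of w] in auto)
  qed
  show ?thesis
  proof (cases "?high w")
    case False
    then show ?thesis using high_iff unfolding lattice_eqs_def by blast
  next
    case hw: True
    have low: "w j $$ n = 0" if "j \<in> {3..r}" "n \<in> {0, 1}" for j n
      using hw that by auto
    have u0: "u 0 $$ n = w 0 $$ n + a * w 1 $$ n + b * w 2 $$ n"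
      and u1: "u 1 $$ n = w 1 $$ n + c * w 2 $$ n"
      and u2: "u 2 $$ n = w 2 $$ n" if "n \<in> {0, 1}" for n
      using base_change_low_coefficients[OF B r, of w n] low that unfolding u a_def b_def c_def by blast+
    have uj: "u j $$ (int j - 1) = w j $$ (int j - 1)" if "j \<in> {3..r}" for j
      using base_change_high_coefficients[OF B, of w j] hw that unfolding u by auto
    \<comment> \<open>the six coefficients of \<open>w\<close> that the first three equations see\<close>
    define x y z where "x = w 0 $$ 0" and "y = w 1 $$ 0" and "z = w 2 $$ 0"
    define x1 y1 z1 where "x1 = w 0 $$ 1" and "y1 = w 1 $$ 1" and "z1 = w 2 $$ 1"
    have low_eqs: "u 0 $$ 0 = x + a * y + b * z" "u 1 $$ 0 = y + c * z" "u 2 $$ 0 = z"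
      "u 0 $$ 1 = x1 + a * y1 + b * z1" "u 1 $$ 1 = y1 + c * z1" "u 2 $$ 1 = z1"
      using u0 u1 u2 by (simp_all add: x_def y_def z_def x1_def y1_def z1_def)
    have first: "(y + c * z = (x + a * y + b * z) * S 1 \<and> z = (x + a * y + b * z) * H)
        \<longleftrightarrow> (y = x * S' 1 \<and> z = x * H')"
    proof
      assume l: "y + c * z = (x + a * y + b * z) * S 1 \<and> z = (x + a * y + b * z) * H"
      define X where "X = x + a * y + b * z"
      have z: "z = X * H" using l unfolding X_def by (rule conjunct2)
      have "y = X * S 1 - c * z" using l unfolding X_def by (metis add_diff_cancel_right')
      then have y: "y = X * (S 1 - c * H)" unfolding z by (simp add: algebra_simps)
      have "p * x = p * X - a * (X * (p * (S 1 - c * H))) - b * (X * (p * H))"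
      proof -
        have "x = X - a * y - b * z" by (simp add: X_def)
        then have "p * x = p * (X - a * y - b * z)" by (rule arg_cong)
        then show ?thesis unfolding y z by (simp add: algebra_simps)
      qed
      also have "\<dots> = X * (p - a * S' 1 - b * H')" unfolding S1 H' by (simp add: algebra_simps)
      also have "\<dots> = X" using p by simp
      finally have pX: "X = p * x" by simp
      show "y = x * S' 1 \<and> z = x * H'" unfolding S1 H' y z pX by (simp add: algebra_simps)
    next
      assume l: "y = x * S' 1 \<and> z = x * H'"
      have X: "x + a * y + b * z = x * p" using l by (subst p) (simp add: algebra_simps)
      show "y + c * z = (x + a * y + b * z) * S 1 \<and> z = (x + a * y + b * z) * H"
      proof -
        have y: "y = x * (p * (S 1 - c * H))" and z: "z = x * (p * H)" using l unfolding S1 H' by auto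
        show ?thesis unfolding X unfolding y z by (simp add: algebra_simps)
      qed
    qed
    have rest: "(z1 = (x + a * y + b * z) * S 2 + (x1 + a * y1 + b * z1) * H
          + (y1 + c * z1 - (x1 + a * y1 + b * z1) * S 1) * D)
        \<longleftrightarrow> z1 = x * S' 2 + x1 * H' + (y1 - x1 * S' 1) * D'" (is "?l \<longleftrightarrow> ?r")
      and X: "x + a * y + b * z = p * x"
      if "y = x * S' 1" "z = x * H'"
    proof -
      show X: "x + a * y + b * z = p * x" using that by (subst p) (simp add: algebra_simps)
      have "?l \<longleftrightarrow> Q * z1 = x * (p * S 2) + x1 * (H - S 1 * D) + y1 * (D + a * (H - S 1 * D))"
        unfolding X Q by (auto simp: algebra_simps)
      also have "\<dots> \<longleftrightarrow> Q * z1 = x * (Q * S' 2) + x1 * (Q * (H' - S' 1 * D')) + y1 * (Q * D')"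
        by (simp only: Q_euler S2 D')
      also have "\<dots> \<longleftrightarrow> Q * z1 = Q * (x * S' 2 + x1 * H' + (y1 - x1 * S' 1) * D')"
        by (simp add: algebra_simps)
      also have "\<dots> \<longleftrightarrow> ?r" by (rule unit_cancel[OF QQ'])
      finally show "?l \<longleftrightarrow> ?r" .
    qed
    have hu: "?high u" using hw high_iff by blast
    have "lattice_eqs r S H D u \<longleftrightarrow>
        (y + c * z = (x + a * y + b * z) * S 1 \<and> z = (x + a * y + b * z) * H) \<and>
        z1 = (x + a * y + b * z) * S 2 + (x1 + a * y1 + b * z1) * H
          + (y1 + c * z1 - (x1 + a * y1 + b * z1) * S 1) * D \<and>
        (\<forall>j\<in>{3..r}. w j $$ (int j - 1) = (x + a * y + b * z) * S j)"
      unfolding lattice_eqs_def low_eqs using hu uj by auto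
    also have "\<dots> \<longleftrightarrow> (y = x * S' 1 \<and> z = x * H') \<and> z1 = x * S' 2 + x1 * H' + (y1 - x1 * S' 1) * D' \<and>
        (\<forall>j\<in>{3..r}. w j $$ (int j - 1) = x * S' j)"
      unfolding first using rest X Sj by (auto simp: mult_ac)
    also have "\<dots> \<longleftrightarrow> lattice_eqs r S' H' D' w"
      unfolding lattice_eqs_def x_def y_def z_def x1_def y1_def z1_def using hw by auto
    finally show ?thesis .
  qed
qed

section \<open>The transformed coordinates and the transformed series\<close>

text \<open>
  Up to factors \<open>s\<^sub>j\<close>, all functions that occur are power series in \<open>s\<^sub>1\<close>. The series \<open>scale_series\<close> is the factor \<open>p\<close>,
  and \<open>coord_series\<close>, \<open>slope_series\<close> are the new first coordinate and the factor \<open>Q\<close> of \<open>adapted_data\<close>.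
\<close>

definition scale_series :: "complex fps \<Rightarrow> (nat \<Rightarrow> nat \<Rightarrow> complex) \<Rightarrow> complex fps" where
  "scale_series h B =
     inverse (1 - fps_const (B 1 0) * (fps_X - fps_const (B 2 1) * h) - fps_const (B 2 0) * h)"

definition coord_series :: "complex fps \<Rightarrow> (nat \<Rightarrow> nat \<Rightarrow> complex) \<Rightarrow> complex fps" where
  "coord_series h B = scale_series h B * (fps_X - fps_const (B 2 1) * h)"

definition slope_series :: "complex fps \<Rightarrow> (nat \<Rightarrow> nat \<Rightarrow> complex) \<Rightarrow> complex fps" where
  "slope_series h B =
     1 - fps_const (B 2 0) * (h - fps_X * fps_deriv h) - fps_const (B 2 1) * fps_deriv h"

text \<open>The solution \<open>k\<close> of \<open>k(G) = P h\<close> for the new coordinate \<open>G\<close>.\<close>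

definition transformed_series :: "complex fps \<Rightarrow> (nat \<Rightarrow> nat \<Rightarrow> complex) \<Rightarrow> complex fps" where
  "transformed_series h B = (scale_series h B * h) oo fps_inv (coord_series h B)"

lemma admissibleD:
  assumes "admissible h"
  shows "fps_conv_radius h > 0" "fps_nth h 0 = 0" "fps_nth h 1 = 0"
  using assms by (auto simp: admissible_def)

lemma scale_series_inverse:
  assumes "admissible h"
  shows "scale_series h B * (1 - fps_const (B 1 0) * (fps_X - fps_const (B 2 1) * h) - fps_const (B 2 0) * h) = 1"
  unfolding scale_series_def by (rule inverse_mult_eq_1) (use admissibleD[OF assms] in simp)

lemma slope_series_inverse:
  assumes "admissible h"
  shows "slope_series h B * inverse (slope_series h B) = 1"
  by (rule inverse_mult_eq_1') (use admissibleD[OF assms] in \<open>simp add: slope_series_def\<close>)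

lemma series_convergent:
  assumes "admissible h"
  shows "fps_conv_radius (scale_series h B) > 0" "fps_conv_radius (coord_series h B) > 0"
    "fps_conv_radius (slope_series h B) > 0" "fps_conv_radius (inverse (slope_series h B)) > 0"
proof -
  note h = admissibleD[OF assms]
  note conv = fps_conv_radius_pos_add fps_conv_radius_pos_diff fps_conv_radius_pos_mult fps_conv_radius_pos_deriv
  have N: "fps_conv_radius (1 - fps_const (B 1 0) * (fps_X - fps_const (B 2 1) * h) - fps_const (B 2 0) * h) > 0"
    using h(1) by (intro conv) auto
  show P: "fps_conv_radius (scale_series h B) > 0"
    unfolding scale_series_def by (rule fps_conv_radius_inverse_pos[OF _ N]) (use h in simp)
  show "fps_conv_radius (coord_series h B) > 0"
    unfolding coord_series_def using h(1) by (intro conv P) auto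
  show Q: "fps_conv_radius (slope_series h B) > 0"
    unfolding slope_series_def using h(1) by (intro conv) auto
  show "fps_conv_radius (inverse (slope_series h B)) > 0"
    by (rule fps_conv_radius_inverse_pos[OF _ Q]) (use h in \<open>simp add: slope_series_def\<close>)
qed

lemma scale_series_nth_0: "admissible h \<Longrightarrow> fps_nth (scale_series h B) 0 = 1"
  by (simp add: scale_series_def admissibleD)

lemma slope_series_nth_0: "admissible h \<Longrightarrow> fps_nth (slope_series h B) 0 = 1"
  using admissibleD[of h] by (simp add: slope_series_def)

lemma coord_series_nth:
  assumes "admissible h" shows "fps_nth (coord_series h B) 0 = 0" "fps_nth (coord_series h B) 1 = 1"
  using admissibleD[OF assms] scale_series_nth_0[OF assms]
  by (simp_all add: coord_series_def fps_mult_nth)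

lemma transformed_series:
  assumes "admissible h"
  shows "admissible (transformed_series h B)"
    and "transformed_series h B oo coord_series h B = scale_series h B * h"
proof -
  note h = admissibleD[OF assms] and G = coord_series_nth[OF assms, of B]
  have G1: "fps_nth (coord_series h B) 1 \<noteq> 0" using G by simp
  let ?I = "fps_inv (coord_series h B)"
  have I0: "fps_nth ?I 0 = 0" by (simp add: fps_inv_def)
  have "fps_conv_radius (transformed_series h B) > 0"
    unfolding transformed_series_def
    by (intro fps_compose_convergent fps_conv_radius_pos_mult series_convergent h(1) I0
        fps_conv_radius_pos_fps_inv G G1 assms)
  then show "admissible (transformed_series h B)"
    using h by (simp add: admissible_def transformed_series_def fps_compose_nth fps_mult_nth)
  have "transformed_series h B oo coord_series h B = (scale_series h B * h) oo (?I oo coord_series h B)"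
    unfolding transformed_series_def by (rule fps_compose_assoc[symmetric, OF G(1) I0])
  then show "transformed_series h B oo coord_series h B = scale_series h B * h"
    by (simp add: fps_inv[OF G(1) G1])
qed

text \<open>
  Differentiating \<open>k(G) = P h\<close> gives \<open>k'(G) G' = (P h)'\<close>; both
  \<open>G'\<close> and \<open>(P h)'\<close> contain the factor \<open>P\<^sup>2\<close>, and \<open>G' = P\<^sup>2 Q\<close>.
\<close>

lemma transformed_series_deriv:
  assumes "admissible h"
  shows "slope_series h B * (fps_deriv (transformed_series h B) oo coord_series h B) =
     fps_deriv h + fps_const (B 1 0) * (h - fps_X * fps_deriv h)"
proof -
  define a b c where "a = fps_const (B 1 0)" and "b = fps_const (B 2 0)" and "c = fps_const (B 2 1)"
  define N where "N = 1 - a * (fps_X - c * h) - b * h"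
  let ?P = "scale_series h B" and ?G = "coord_series h B" and ?k = "transformed_series h B"
  have P: "?P = inverse N" by (simp add: scale_series_def N_def a_def b_def c_def)
  have PN: "?P * N = 1" using scale_series_inverse[OF assms, of B] by (simp add: N_def a_def b_def c_def)
  have N0: "fps_nth N 0 \<noteq> 0" using admissibleD[OF assms] by (simp add: N_def a_def b_def c_def)
  have dN: "fps_deriv N = - a * (1 - c * fps_deriv h) - b * fps_deriv h"
  proof -
    have d0: "fps_deriv a = 0" "fps_deriv b = 0" "fps_deriv c = 0" by (simp_all add: a_def b_def c_def)
    show ?thesis
      unfolding N_def fps_deriv_sub fps_deriv_mult d0 by (simp add: algebra_simps)
  qed
  have dP: "fps_deriv ?P = - fps_deriv N * ?P\<^sup>2"
    unfolding P using N0 by (simp add: fps_inverse_deriv)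
  have deriv_mult: "fps_deriv (?P * x) = ?P\<^sup>2 * (N * fps_deriv x - fps_deriv N * x)" for x
  proof -
    have "fps_deriv (?P * x) = ?P * (?P * N) * fps_deriv x - fps_deriv N * ?P\<^sup>2 * x"
      by (simp add: dP PN)
    then show ?thesis by (simp add: power2_eq_square algebra_simps)
  qed
  have dG: "fps_deriv ?G = ?P\<^sup>2 * slope_series h B"
  proof -
    have slope: "slope_series h B = 1 - b * (h - fps_X * fps_deriv h) - c * fps_deriv h"
      by (simp add: slope_series_def b_def c_def)
    have d: "fps_deriv (fps_X - c * h) = 1 - c * fps_deriv h" by (simp add: c_def)
    have "N * fps_deriv (fps_X - c * h) - fps_deriv N * (fps_X - c * h) = slope_series h B"
      unfolding dN slope d by (simp add: N_def algebra_simps)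
    then show ?thesis unfolding coord_series_def c_def[symmetric] deriv_mult by (simp only:)
  qed
  have "?P\<^sup>2 * (slope_series h B * (fps_deriv ?k oo ?G)) = (fps_deriv ?k oo ?G) * fps_deriv ?G"
    by (simp add: dG algebra_simps)
  also have "\<dots> = fps_deriv (?k oo ?G)"
    using fps_compose_deriv[OF coord_series_nth(1)[OF assms], of ?k] by simp
  also have "\<dots> = ?P\<^sup>2 * (N * fps_deriv h - fps_deriv N * h)"
    unfolding transformed_series(2)[OF assms] by (rule deriv_mult)
  also have "N * fps_deriv h - fps_deriv N * h = fps_deriv h + a * (h - fps_X * fps_deriv h)"
    unfolding dN by (simp add: N_def algebra_simps)
  finally show ?thesis using PN by (auto simp: a_def)
qed

text \<open>The map germ with components \<open>G(s\<^sub>1)\<close>, \<open>s\<^sub>2 (P/Q)(s\<^sub>1)\<close> and \<open>s\<^sub>j P(s\<^sub>1)\<close> for \<open>j \<ge> 3\<close>.\<close>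

definition adapted_map ::
  "(nat \<Rightarrow> 'n::finite) \<Rightarrow> complex fps \<Rightarrow> (nat \<Rightarrow> nat \<Rightarrow> complex) \<Rightarrow> 'n \<Rightarrow> 'n hgerm" where
  "adapted_map ix h B i =
     (if i = ix 1 then germ_fps (coord_series h B) (germ_coord (ix 1))
      else germ_coord i * germ_fps
        (if i = ix 2 then scale_series h B * inverse (slope_series h B) else scale_series h B) (germ_coord (ix 1)))"

lemma germ_fps_adapted_coord:
  assumes "admissible h" "fps_conv_radius F > 0"
  shows "germ_fps F (adapted_map ix h B (ix 1)) = germ_fps (F oo coord_series h B) (germ_coord (ix 1))"
  using assms series_convergent[OF assms(1)] coord_series_nth[OF assms(1)]
  by (simp add: adapted_map_def germ_fps_compose)

text \<open>
  Every equation of \<open>adapted_data\<close> is an identity between power series evaluated at \<open>s\<^sub>1\<close>, up to factors \<open>s\<^sub>j\<close>. The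
  one for \<open>D'\<close> is \<open>transformed_series_deriv\<close>.
\<close>

lemma adapted_data_transformed:
  fixes ix :: "nat \<Rightarrow> 'n::finite"
  assumes r: "2 \<le> r" and ix: "inj_on ix {1..r}" and h: "admissible h"
  shows "adapted_data r B (\<lambda>j. germ_coord (ix j)) (germ_fps h (germ_coord (ix 1)))
     (germ_fps (fps_deriv h) (germ_coord (ix 1)))
     (\<lambda>j. adapted_map ix h B (ix j)) (germ_fps (transformed_series h B) (adapted_map ix h B (ix 1)))
     (germ_fps (fps_deriv (transformed_series h B)) (adapted_map ix h B (ix 1)))"
proof -
  let ?E = "\<lambda>F. germ_fps F (germ_coord (ix 1))" and ?k = "transformed_series h B"
  let ?P = "scale_series h B" and ?G = "coord_series h B" and ?Q = "slope_series h B"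
  define N where "N = 1 - fps_const (B 1 0) * (fps_X - fps_const (B 2 1) * h) - fps_const (B 2 0) * h"
  note conv = fps_conv_radius_pos_add fps_conv_radius_pos_diff fps_conv_radius_pos_mult fps_conv_radius_pos_deriv
    series_convergent[OF h] admissibleD(1)[OF h]
  note E = germ_fps_simps[of "germ_coord (ix 1)", simplified]
  note k = transformed_series[OF h, of B]
  have ne: "ix i = ix j \<longleftrightarrow> i = j" if "i \<in> {1..r}" "j \<in> {1..r}" for i j
    using ix that by (auto dest: inj_onD)
  have H': "germ_fps ?k (adapted_map ix h B (ix 1)) = ?E (?P * h)"
    unfolding germ_fps_adapted_coord[OF h admissibleD(1)[OF k(1)]] k(2) by (rule refl)
  have D': "germ_fps (fps_deriv ?k) (adapted_map ix h B (ix 1)) = ?E (fps_deriv ?k oo ?G)"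
    using germ_fps_adapted_coord[OF h fps_conv_radius_pos_deriv[OF admissibleD(1)[OF k(1)]]] .
  have dkG: "fps_conv_radius (fps_deriv ?k oo ?G) > 0"
    by (intro fps_compose_convergent conv coord_series_nth h admissibleD(1)[OF k(1)])
  have N_conv: "fps_conv_radius N > 0" unfolding N_def by (intro conv) auto
  have "?P * N = 1" unfolding N_def by (rule scale_series_inverse[OF h])
  moreover have "?E (?P * N) = ?E ?P * ?E N" using N_conv by (simp add: E conv)
  ultimately have "?E ?P * ?E N = 1" by (simp add: E)
  moreover have "?E ?Q * ?E (inverse ?Q) = 1"
    using arg_cong[OF slope_series_inverse[OF h, of B], of ?E] by (simp add: E conv)
  moreover have "?E ?Q = 1 - germ_const (B 2 0) * (?E h - germ_coord (ix 1) * ?E (fps_deriv h))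
      - germ_const (B 2 1) * ?E (fps_deriv h)"
    unfolding slope_series_def by (subst E conv | simp add: conv)+
  moreover have "?E ?P = 1 + germ_const (B 1 0) * adapted_map ix h B (ix 1) + germ_const (B 2 0) * ?E (?P * h)"
  proof -
    have "?P = 1 + fps_const (B 1 0) * ?G + fps_const (B 2 0) * (?P * h)"
      using scale_series_inverse[OF h, of B] by (simp add: coord_series_def algebra_simps)
    then have "?E ?P = ?E (1 + fps_const (B 1 0) * ?G + fps_const (B 2 0) * (?P * h))" by simp
    also have "\<dots> = 1 + germ_const (B 1 0) * ?E ?G + germ_const (B 2 0) * ?E (?P * h)"
      by (subst E conv | simp add: conv)+
    finally show ?thesis by (simp add: adapted_map_def)
  qed
  moreover have "adapted_map ix h B (ix 1) = ?E ?P * (germ_coord (ix 1) - germ_const (B 2 1) * ?E h)"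
    unfolding adapted_map_def coord_series_def by (subst if_P, rule refl) (subst E conv | simp add: conv)+
  moreover have "?E (?P * h) = ?E ?P * ?E h" by (simp add: E conv)
  moreover have "?E ?Q * adapted_map ix h B (ix 2) = ?E ?P * germ_coord (ix 2)"
  proof -
    have "?E ?Q * adapted_map ix h B (ix 2) = germ_coord (ix 2) * ?E ?P * (?E ?Q * ?E (inverse ?Q))"
      using ne[of 2 1] r by (simp add: adapted_map_def E conv mult_ac)
    then show ?thesis using \<open>?E ?Q * ?E (inverse ?Q) = 1\<close> by (simp add: mult.commute)
  qed
  moreover have "\<forall>j\<in>{3..r}. adapted_map ix h B (ix j) = ?E ?P * germ_coord (ix j)"
    using ne[of _ 1] ne[of _ 2] r by (auto simp: adapted_map_def mult.commute)
  moreover have "?E ?Q * ?E (fps_deriv ?k oo ?G) = ?E (fps_deriv h)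
      + germ_const (B 1 0) * (?E h - germ_coord (ix 1) * ?E (fps_deriv h))"
  proof -
    have "?E ?Q * ?E (fps_deriv ?k oo ?G) = ?E (?Q * (fps_deriv ?k oo ?G))" by (simp add: E conv dkG)
    also have "\<dots> = ?E (fps_deriv h) + germ_const (B 1 0) * (?E h - germ_coord (ix 1) * ?E (fps_deriv h))"
      unfolding transformed_series_deriv[OF h] by (subst E conv | simp add: conv)+
    finally show ?thesis .
  qed
  ultimately show ?thesis unfolding adapted_data_def H' D' by blast
qed

text \<open>
  The first coordinate is changed by a series in \<open>s\<^sub>1\<close> alone and the others are multiplied by units
  in \<open>s\<^sub>1\<close>, so inverting the map germ needs only the inverse of one series in one variable.
\<close>

lemma germ_iso_fibred:
  fixes i1 :: "'n::finite" and M :: "'n \<Rightarrow> complex fps"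
  assumes G: "fps_conv_radius G > 0" "fps_nth G 0 = 0" "fps_nth G 1 \<noteq> 0"
    and M: "\<And>i. fps_conv_radius (M i) > 0" "\<And>i. fps_nth (M i) 0 \<noteq> 0"
  shows "germ_iso (\<lambda>i. if i = i1 then germ_fps G (germ_coord i1) else germ_coord i * germ_fps (M i) (germ_coord i1))"
    (is "germ_iso ?\<rho>")
proof -
  let ?I = "fps_inv G"
  have I: "fps_conv_radius ?I > 0" "fps_nth ?I 0 = 0"
    using fps_conv_radius_pos_fps_inv[OF G] by (auto simp: fps_inv_def)
  have IM: "fps_conv_radius (inverse (M i)) > 0" "fps_conv_radius (inverse (M i) oo ?I) > 0" for i
    using fps_conv_radius_inverse_pos[OF M(2,1)] fps_compose_convergent(1)[OF _ I] by auto
  define \<tau> where "\<tau> i = (if i = i1 then germ_fps ?I (germ_coord i1)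
    else germ_coord i * germ_fps (inverse (M i) oo ?I) (germ_coord i1))" for i
  have \<rho>0: "germ_at0 (?\<rho> i) = 0" for i using G by (simp add: germ_fps_simps)
  have \<tau>0: "germ_at0 (\<tau> i) = 0" for i using I by (simp add: germ_fps_simps \<tau>_def)
  have "germ_comp (?\<rho> i) \<tau> = germ_coord i" for i
  proof (cases "i = i1")
    case True
    have "germ_comp (?\<rho> i) \<tau> = germ_fps G (germ_fps ?I (germ_coord i1))"
      using True G by (simp add: germ_comp_germ_fps germ_comp_simps \<tau>0) (simp add: \<tau>_def)
    also have "\<dots> = germ_fps (G oo ?I) (germ_coord i1)" using G I by (simp add: germ_fps_compose)
    finally show ?thesis using True by (simp add: fps_inv_right[OF G(2,3)] germ_fps_simps)
  next
    case False
    have "germ_comp (?\<rho> i) \<tau> = germ_coord i *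
        (germ_fps (inverse (M i) oo ?I) (germ_coord i1) * germ_fps (M i) (germ_fps ?I (germ_coord i1)))"
      using False M by (simp add: germ_comp_germ_fps germ_comp_simps \<tau>0) (simp add: \<tau>_def mult_ac)
    also have "germ_fps (inverse (M i) oo ?I) (germ_coord i1) * germ_fps (M i) (germ_fps ?I (germ_coord i1))
        = germ_fps ((inverse (M i) oo ?I) * (M i oo ?I)) (germ_coord i1)"
      using M I IM by (simp add: germ_fps_simps germ_fps_compose fps_compose_convergent)
    also have "(inverse (M i) oo ?I) * (M i oo ?I) = 1"
      using inverse_mult_eq_1[OF M(2)[of i]] by (simp add: fps_compose_mult_distrib[OF I(2), symmetric])
    finally show ?thesis by (simp add: germ_fps_simps)
  qed
  moreover have "germ_comp (\<tau> i) ?\<rho> = germ_coord i" for i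
  proof (cases "i = i1")
    case True
    have "germ_comp (\<tau> i) ?\<rho> = germ_fps ?I (germ_fps G (germ_coord i1))"
      using True I \<rho>0 by (simp add: \<tau>_def germ_comp_germ_fps germ_comp_simps)
    also have "\<dots> = germ_fps (?I oo G) (germ_coord i1)" using G I by (simp add: germ_fps_compose)
    finally show ?thesis using True by (simp add: fps_inv[OF G(2,3)] germ_fps_simps)
  next
    case False
    have "germ_comp (\<tau> i) ?\<rho> = germ_coord i *
        (germ_fps (M i) (germ_coord i1) * germ_fps (inverse (M i) oo ?I) (germ_fps G (germ_coord i1)))"
      using False IM \<rho>0 by (simp add: \<tau>_def germ_comp_germ_fps germ_comp_simps mult_ac)
    also have "germ_fps (inverse (M i) oo ?I) (germ_fps G (germ_coord i1))
        = germ_fps ((inverse (M i) oo ?I) oo G) (germ_coord i1)"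
      using IM G by (simp add: germ_fps_compose)
    also have "(inverse (M i) oo ?I) oo G = inverse (M i) oo (?I oo G)"
      by (rule fps_compose_assoc[symmetric, OF G(2) I(2)])
    also have "\<dots> = inverse (M i)" by (simp add: fps_inv[OF G(2,3)])
    also have "germ_fps (M i) (germ_coord i1) * germ_fps (inverse (M i)) (germ_coord i1)
        = germ_fps (M i * inverse (M i)) (germ_coord i1)" using M IM by (simp add: germ_fps_simps)
    also have "M i * inverse (M i) = 1" using inverse_mult_eq_1'[OF M(2)[of i]] .
    finally show ?thesis by (simp add: germ_fps_simps)
  qed
  ultimately show ?thesis unfolding germ_iso_def using \<rho>0 \<tau>0 by blast
qed

lemma germ_iso_adapted_map:
  assumes h: "admissible h" shows "germ_iso (adapted_map ix h B)"
proof -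
  have "germ_iso (\<lambda>i. if i = ix 1 then germ_fps (coord_series h B) (germ_coord (ix 1))
      else germ_coord i * germ_fps ((\<lambda>i. if i = ix 2 then scale_series h B * inverse (slope_series h B)
        else scale_series h B) i) (germ_coord (ix 1)))"
    by (rule germ_iso_fibred)
       (use series_convergent[OF h, of B] coord_series_nth[OF h, of B] scale_series_nth_0[OF h, of B]
          slope_series_nth_0[OF h, of B] in \<open>auto intro: fps_conv_radius_pos_mult\<close>)
  then show ?thesis by (simp add: adapted_map_def[abs_def])
qed

section \<open>Opposite filtrations and unitriangular matrices\<close>

lemma module_functions: "module (\<lambda>(c :: complex) (x :: nat \<Rightarrow> complex) i. c * x i)"
  by unfold_locales (auto simp: algebra_simps fun_eq_iff)

lemmas subspace_functions_def = module.subspace_def[OF module_functions]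

lemma opposite_subspace: "opposite r U \<Longrightarrow> module.subspace (\<lambda>c x i. c * x i) (U p)"
  by (simp add: opposite_def decreasing_filtration_def)

text \<open>Two candidates differ by an element of \<open>F\<^sub>0\<^sub>,\<^sub>j\<^sub>-\<^sub>1 \<inter> U\<^sup>j = 0\<close>.\<close>

lemma opposite_adapted_unique:
  assumes U: "opposite r U"
    and x: "x \<in> U (int j)" "x - evec j \<in> F0 r (int j - 1)"
    and y: "y \<in> U (int j)" "y - evec j \<in> F0 r (int j - 1)"
  shows "x = y"
proof -
  have sub: "0 \<in> U (int j)" "\<And>a b. a \<in> U (int j) \<Longrightarrow> b \<in> U (int j) \<Longrightarrow> a + b \<in> U (int j)"
    "\<And>c a. a \<in> U (int j) \<Longrightarrow> (\<lambda>i. c * a i) \<in> U (int j)"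
    using opposite_subspace[OF U, of "int j"] by (auto simp: subspace_functions_def)
  have "(\<lambda>i. - 1 * y i) = - y" by (simp add: fun_eq_iff)
  then have "- y \<in> U (int j)" using sub(3)[OF y(1), of "- 1"] by (simp del: mult_minus1)
  then have "x - y \<in> U (int j)" using sub(2)[OF x(1), of "- y"] by simp
  moreover have "x - y \<in> F0 r (int j - 1)"
    using x(2) y(2) by (auto simp: F0_def Hspace_def evec_def)
  moreover have "F0 r (int j - 1) \<inter> U (int j - 1 + 1) = {0}" using U unfolding opposite_def by blast
  ultimately have "x - y \<in> {0}" by (metis IntI diff_add_cancel)
  then show ?thesis by simp
qed

lemma ebasis_eqI:
  assumes "opposite r U" "x \<in> U (int j)" "x \<in> F0 r (int j)" "x - evec j \<in> F0 r (int j - 1)"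
  shows "ebasis r U j = x"
  unfolding ebasis_def
  by (rule the_equality) (use assms opposite_adapted_unique[OF assms(1)] in blast)+

text \<open>Existence: split \<open>e\<^sub>j\<close> along \<open>F\<^sub>0\<^sub>,\<^sub>j\<^sub>-\<^sub>1 \<oplus> U\<^sup>j\<close> and take the part in \<open>U\<^sup>j\<close>.\<close>

lemma ebasis_triangular:
  assumes U: "opposite r U" and j: "j \<le> r"
  shows "ebasis r U j j = 1" and "j < i \<Longrightarrow> ebasis r U j i = 0"
proof -
  have "evec j \<in> Hspace r" using j by (auto simp: Hspace_def evec_def)
  moreover have "{x + y | x y. x \<in> F0 r (int j - 1) \<and> y \<in> U (int j - 1 + 1)} = Hspace r"
    using U by (simp only: opposite_def)
  ultimately have "evec j \<in> {x + y | x y. x \<in> F0 r (int j - 1) \<and> y \<in> U (int j - 1 + 1)}" by simp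
  then obtain x y where xy: "evec j = x + y" "x \<in> F0 r (int j - 1)" "y \<in> U (int j)" by auto
  have y: "y i = evec j i - x i" for i using xy(1) by (simp add: fun_eq_iff)
  have "ebasis r U j = y"
    by (rule ebasis_eqI[OF U xy(3)]) (use xy(2) j in \<open>auto simp: F0_def Hspace_def y evec_def\<close>)
  then show "ebasis r U j j = 1" "j < i \<Longrightarrow> ebasis r U j i = 0"
    using xy(2) by (auto simp: y evec_def F0_def)
qed

text \<open>Rows beyond \<open>r\<close> are set to zero, since \<open>ebasis\<close> is unspecified there.\<close>

definition basis_matrix :: "nat \<Rightarrow> (int \<Rightarrow> (nat \<Rightarrow> complex) set) \<Rightarrow> nat \<Rightarrow> nat \<Rightarrow> complex" where
  "basis_matrix r U j = (if j \<le> r then ebasis r U j else 0)"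

lemma unitriangular_basis_matrix: "opposite r U \<Longrightarrow> unitriangular r (basis_matrix r U)"
  using ebasis_triangular[of r U] by (auto simp: unitriangular_def basis_matrix_def not_le)

text \<open>The relations defining \<open>A\<close> say that \<open>A B = 1\<close>, and this has only one solution.\<close>

lemma Amatrix_inverse:
  assumes U: "opposite r U"
  shows "mutually_inverse r (Amatrix r U) (basis_matrix r U)"
proof -
  let ?B = "basis_matrix r U"
  have B: "unitriangular r ?B" by (rule unitriangular_basis_matrix[OF U])
  obtain A where BA: "mutually_inverse r ?B A" using unitriangular_inverse[OF B] by blast
  have expand: "(\<Sum>j = 0..i. (\<lambda>l. A' i j * ebasis r U j l)) l = mat_prod r A' ?B i l"
    if "unitriangular r A'" "i \<le> r" for A' i l
  proof -
    have "(\<Sum>j = 0..i. (\<lambda>l. A' i j * ebasis r U j l)) l = (\<Sum>j = 0..i. A' i j * ?B j l)"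
      unfolding sum_fun_app by (intro sum.cong) (use that(2) in \<open>auto simp: basis_matrix_def\<close>)
    also have "\<dots> = mat_prod r A' ?B i l"
      unfolding mat_prod_def
      by (rule sum.mono_neutral_left) (use that in \<open>auto simp: unitriangular_def\<close>)
    finally show ?thesis .
  qed
  have rows: "(\<forall>i\<le>r. evec i = (\<Sum>j = 0..i. (\<lambda>l. A' i j * ebasis r U j l))) \<longleftrightarrow> mat_prod r A' ?B = mat_id r"
    if A': "unitriangular r A'" for A'
  proof -
    have "mat_prod r A' ?B i l = mat_id r i l" if "\<not> i \<le> r" for i l
      using A' that by (auto simp: mat_prod_def mat_id_def unitriangular_def)
    moreover have "mat_id r i l = evec i l" if "i \<le> r" for i l using that by (simp add: mat_id_def evec_def)
    ultimately show ?thesis unfolding fun_eq_iff using expand[OF A'] by (metis (no_types, lifting))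
  qed
  have "Amatrix r U = A"
    unfolding Amatrix_def
  proof (rule the_equality)
    have A: "unitriangular r A" "mat_prod r A ?B = mat_id r" using BA by (auto simp: mutually_inverse_def)
    then show "(\<forall>i j. \<not> (j \<le> i \<and> i \<le> r) \<longrightarrow> A i j = 0) \<and> (\<forall>i\<le>r. A i i = 1) \<and>
        (\<forall>i\<le>r. evec i = (\<Sum>j = 0..i. (\<lambda>l. A i j * ebasis r U j l)))"
      using rows[OF A(1)] by (simp add: unitriangular_def)
    fix A' assume A': "(\<forall>i j. \<not> (j \<le> i \<and> i \<le> r) \<longrightarrow> A' i j = 0) \<and> (\<forall>i\<le>r. A' i i = 1) \<and>
        (\<forall>i\<le>r. evec i = (\<Sum>j = 0..i. (\<lambda>l. A' i j * ebasis r U j l)))"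
    then have T: "unitriangular r A'" by (simp add: unitriangular_def)
    have id: "mat_prod r A' ?B = mat_id r" using rows[OF T] A' by blast
    have "A' = mat_prod r A' (mat_prod r ?B A)" using BA mat_prod_id[OF T] by (simp add: mutually_inverse_def)
    also have "\<dots> = mat_prod r (mat_id r) A" by (simp add: mat_prod_assoc[symmetric] id)
    also have "\<dots> = A" by (rule mat_prod_id[OF A(1)])
    finally show "A' = A" .
  qed
  then show ?thesis using BA by (simp add: mutually_inverse_sym)
qed

definition vec_mat :: "nat \<Rightarrow> (nat \<Rightarrow> complex) \<Rightarrow> (nat \<Rightarrow> nat \<Rightarrow> complex) \<Rightarrow> nat \<Rightarrow> complex" where
  "vec_mat r x M j = (\<Sum>i = 0..r. x i * M i j)"

lemma vec_mat_vec_mat: "vec_mat r (vec_mat r x A) B = vec_mat r x (mat_prod r A B)"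
proof
  fix k
  have "vec_mat r (vec_mat r x A) B k = (\<Sum>j = 0..r. \<Sum>i = 0..r. x i * A i j * B j k)"
    by (simp add: vec_mat_def sum_distrib_right)
  also have "\<dots> = (\<Sum>i = 0..r. \<Sum>j = 0..r. x i * A i j * B j k)" by (rule sum.swap)
  finally show "vec_mat r (vec_mat r x A) B k = vec_mat r x (mat_prod r A B) k"
    by (simp add: vec_mat_def mat_prod_def sum_distrib_left mult.assoc)
qed

lemma vec_mat_linear:
  "vec_mat r (x + y) M j = vec_mat r x M j + vec_mat r y M j"
  "vec_mat r (\<lambda>i. c * x i) M j = c * vec_mat r x M j"
  "vec_mat r 0 M j = 0"
  by (simp_all add: vec_mat_def distrib_right sum.distrib sum_distrib_left mult.assoc)

lemma vec_mat_id:
  assumes "x \<in> Hspace r" shows "vec_mat r x (mat_id r) = x"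
proof
  fix j
  have "vec_mat r x (mat_id r) j = (\<Sum>i = 0..r. if i = j then x j else 0)"
    unfolding vec_mat_def by (intro sum.cong) (auto simp: mat_id_def)
  then show "vec_mat r x (mat_id r) j = x j" using assms by (auto simp: Hspace_def)
qed

lemma vec_mat_inverse:
  "mutually_inverse r A B \<Longrightarrow> x \<in> Hspace r \<Longrightarrow> vec_mat r (vec_mat r x A) B = x"
  by (simp add: vec_mat_vec_mat mutually_inverse_def vec_mat_id)

lemma vec_mat_Hspace: "unitriangular r B \<Longrightarrow> vec_mat r x B \<in> Hspace r"
  by (auto simp: Hspace_def vec_mat_def unitriangular_def intro!: sum.neutral)

lemma vec_mat_F0:
  assumes "unitriangular r B" "\<And>i. int i > p \<Longrightarrow> x i = 0" shows "vec_mat r x B \<in> F0 r p"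
proof -
  have "vec_mat r x B j = 0" if "int j > p" for j
    unfolding vec_mat_def
  proof (rule sum.neutral, rule ballI)
    fix i
    show "x i * B i j = 0"
      using assms that by (cases "int i > p") (auto simp: unitriangular_def)
  qed
  then show ?thesis using vec_mat_Hspace[OF assms(1)] by (simp add: F0_def)
qed

text \<open>
  The step \<open>U\<^sup>p\<close> of the filtration is spanned by the rows \<open>B\<^sub>j\<close> with \<open>j \<ge> p\<close>. The description by vanishing coordinates with respect to the
  rows makes the direct sum visible: \<open>F\<^sub>0\<^sub>,\<^sub>p\<close> is the span of the rows \<open>j \<le> p\<close> because \<open>A\<close> and \<open>B\<close> are triangular.
\<close>

lemma opposite_filtration_of_matrix:
  assumes AB: "mutually_inverse r A B"
  obtains U where "opposite r U" "basis_matrix r U = B" "Amatrix r U = A"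
proof -
  have A: "unitriangular r A" and B: "unitriangular r B" using AB by (auto simp: mutually_inverse_def)
  define U where "U p = {x \<in> Hspace r. \<forall>j. int j < p \<longrightarrow> vec_mat r x A j = 0}" for p
  have dec: "decreasing_filtration r U"
    unfolding decreasing_filtration_def subspace_functions_def
    by (auto simp: U_def Hspace_def vec_mat_linear)
  have opp: "F0 r p \<inter> U (p + 1) = {0} \<and> {x + y | x y. x \<in> F0 r p \<and> y \<in> U (p + 1)} = Hspace r" for p
  proof (intro conjI set_eqI iffI)
    fix x assume x: "x \<in> F0 r p \<inter> U (p + 1)"
    have "vec_mat r x A \<in> F0 r p" by (rule vec_mat_F0[OF A]) (use x in \<open>auto simp: F0_def\<close>)
    then have "vec_mat r x A j = 0" for j using x by (cases "int j > p") (auto simp: F0_def U_def)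
    then have eq0: "vec_mat r x A = 0" by (simp add: fun_eq_iff)
    have "vec_mat r (vec_mat r x A) B = 0" unfolding eq0 by (simp add: fun_eq_iff vec_mat_linear)
    then show "x \<in> {0}" using vec_mat_inverse[OF AB, of x] x by (simp add: F0_def)
  next
    fix x :: "nat \<Rightarrow> complex" assume "x \<in> {0}"
    then show "x \<in> F0 r p \<inter> U (p + 1)" by (auto simp: F0_def U_def Hspace_def vec_mat_def)
  next
    fix x assume "x \<in> {x + y | x y. x \<in> F0 r p \<and> y \<in> U (p + 1)}"
    then show "x \<in> Hspace r" by (auto simp: F0_def U_def Hspace_def)
  next
    fix x assume x: "x \<in> Hspace r"
    \<comment> \<open>split the coordinates of \<open>x\<close> in the adapted basis at \<open>p\<close>\<close>
    define c d where "c j = (if int j \<le> p then vec_mat r x A j else 0)"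
      and "d j = (if int j \<le> p then 0 else vec_mat r x A j)" for j
    have H: "vec_mat r x A \<in> Hspace r" using A by (rule vec_mat_Hspace)
    have "x = vec_mat r (c + d) B"
    proof -
      have "c + d = vec_mat r x A" by (auto simp: c_def d_def fun_eq_iff)
      then show ?thesis using vec_mat_inverse[OF AB x] by simp
    qed
    also have "\<dots> = vec_mat r c B + vec_mat r d B"
      by (simp add: fun_eq_iff vec_mat_linear)
    finally have "x = vec_mat r c B + vec_mat r d B" .
    moreover have "vec_mat r c B \<in> F0 r p" by (rule vec_mat_F0[OF B]) (simp add: c_def)
    moreover have "vec_mat r d B \<in> U (p + 1)"
    proof -
      have "d \<in> Hspace r" using H by (auto simp: d_def Hspace_def)
      then have "vec_mat r (vec_mat r d B) A = d" by (rule vec_mat_inverse[OF mutually_inverse_sym[OF AB]])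
      then show ?thesis using vec_mat_Hspace[OF B] by (auto simp: U_def d_def)
    qed
    ultimately show "x \<in> {x + y | x y. x \<in> F0 r p \<and> y \<in> U (p + 1)}" by blast
  qed
  have U: "opposite r U" unfolding opposite_def using dec opp by blast
  have "ebasis r U j = B j" if j: "j \<le> r" for j
  proof (rule ebasis_eqI[OF U])
    have "vec_mat r (B j) A k = mat_prod r B A j k" for k by (simp add: vec_mat_def mat_prod_def)
    then have "vec_mat r (B j) A k = mat_id r j k" for k using AB by (simp add: mutually_inverse_def)
    then show "B j \<in> U (int j)" using B j by (auto simp: U_def Hspace_def unitriangular_def mat_id_def)
    show "B j \<in> F0 r (int j)" "B j - evec j \<in> F0 r (int j - 1)"
      using B j by (auto simp: F0_def Hspace_def unitriangular_def evec_def)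
  qed
  then have BU: "basis_matrix r U = B"
    using B by (auto simp: basis_matrix_def unitriangular_def fun_eq_iff)
  have "Amatrix r U = mat_prod r (Amatrix r U) (mat_prod r B A)"
    using AB Amatrix_inverse[OF U] mat_prod_id by (simp add: mutually_inverse_def)
  also have "\<dots> = mat_prod r (mat_id r) A"
    using Amatrix_inverse[OF U] by (simp add: mat_prod_assoc[symmetric] BU mutually_inverse_def)
  also have "\<dots> = A" by (rule mat_prod_id[OF A])
  finally show thesis using that U BU by blast
qed

section \<open>The adapted section and the series attached to a filtration\<close>

lemma incl_ebasis: "j \<le> r \<Longrightarrow> incl (ebasis r U j) l = scalar (germ_const (basis_matrix r U j l))"
  by (simp add: incl_def basis_matrix_def)

text \<open>
  The coordinates, in the adapted basis, of the elements among which \<open>v'\<^sub>0\<close> is sought: the component \<open>i \<ge> 1\<close> has only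
  the orders \<open>0, \<dots>, i - 1\<close>.
\<close>

definition adapted_shape :: "nat \<Rightarrow> 'n::finite gm \<Rightarrow> bool" where
  "adapted_shape r W \<longleftrightarrow> W 0 = 1 \<and> (\<forall>j>r. W j = 0) \<and>
     (\<forall>i\<in>{1..r}. \<forall>n. \<not> (0 \<le> n \<and> n < int i) \<longrightarrow> W i $$ n = 0)"

lemma adapted_shape_section_form: "2 \<le> r \<Longrightarrow> adapted_shape r (section_form r S H)"
  by (auto simp: adapted_shape_def section_form_nth) (auto simp: section_form_def)

lemma lattice_eqs_section_form: "2 \<le> r \<Longrightarrow> lattice_eqs r S H D (section_form r S H)"
  by (auto simp: lattice_eqs_def section_form_nth)

lemma section_form_beyond: "r < j \<Longrightarrow> section_form r S H j = 0"
  by (simp add: section_form_def)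

lemma section_form_conv_ops0: "section_form r S H l \<in> conv_ops0"
  using section_form_times_conv_ops0[OF conv_ops0_1, of r S H l] by simp

text \<open>The coefficients that \<open>adapted_shape\<close> allows are the ones that the lattice equations prescribe.\<close>

lemma adapted_shape_unique:
  assumes r: "2 \<le> r" and W: "adapted_shape r W" "lattice_eqs r S H D W"
  shows "W = section_form r S H"
proof (rule ext, rule fls_eqI)
  fix l n
  have W0: "W 0 $$ k = (if k = 0 then 1 else 0)" for k using W(1) by (simp add: adapted_shape_def)
  have out: "W l $$ n = 0" if "l \<in> {1..r}" "\<not> (0 \<le> n \<and> n < int l)" for l n
    using W(1) that unfolding adapted_shape_def by blast
  have eqs: "W 1 $$ 0 = S 1" "W 2 $$ 0 = H" "W 2 $$ 1 = S 2"
    "\<And>j. j \<in> {3..r} \<Longrightarrow> (\<forall>k<int j - 1. W j $$ k = 0) \<and> W j $$ (int j - 1) = S j"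
    using W(2) out[of 1 1] r unfolding lattice_eqs_def by (simp_all add: W0)
  have "l = 0 \<or> l = 1 \<or> l = 2 \<or> l \<in> {3..r} \<or> r < l" by auto
  then consider "l = 0" | "l = 1" | "l = 2" | "l \<in> {3..r}" | "r < l" by blast
  then show "W l $$ n = section_form r S H l $$ n"
  proof cases
    case 1
    then show ?thesis by (simp add: W0 section_form_nth)
  next
    case 2
    then show ?thesis using eqs(1) out[of 1 n] r by (cases "n = 0") (auto simp: section_form_nth)
  next
    case 3
    have "n = 0 \<or> n = 1 \<or> \<not> (0 \<le> n \<and> n < int 2)" by auto
    then show ?thesis using 3 eqs(2,3) out[of 2 n] r by (auto simp: section_form_nth)
  next
    case 4
    have "n < int l - 1 \<or> n = int l - 1 \<or> \<not> (0 \<le> n \<and> n < int l)" by auto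
    then show ?thesis using 4 eqs(4)[of l] out[of l n] by (auto simp: section_form_nth)
  next
    case 5
    then show ?thesis using W(1) by (simp add: adapted_shape_def section_form_nth)
  qed
qed

lemma adapted_sum:
  fixes c :: "nat \<Rightarrow> nat \<Rightarrow> 'n::finite hgerm"
  shows "incl (ebasis r U 0) + (\<Sum>k = 1..r. \<Sum>i = k..r. smul (scalar (c k i) * dt_pow (1 - int k)) (incl (ebasis r U i)))
    = base_change r (basis_matrix r U)
        (\<lambda>i. if i = 0 then 1 else if i \<le> r then \<Sum>k = 1..i. fls_shift (1 - int k) (scalar (c k i)) else 0)"
    (is "_ = base_change r ?B ?W")
proof
  fix l
  have "(\<Sum>k = 1..r. \<Sum>i = k..r. smul (scalar (c k i) * dt_pow (1 - int k)) (incl (ebasis r U i))) l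
      = (\<Sum>k = 1..r. \<Sum>i = 1..r. if k \<le> i then scalar (germ_const (?B i l)) * fls_shift (1 - int k) (scalar (c k i)) else 0)"
    unfolding sum_fun_app
  proof (rule sum.cong[OF refl])
    fix k assume k: "k \<in> {1..r}"
    show "(\<Sum>i = k..r. smul (scalar (c k i) * dt_pow (1 - int k)) (incl (ebasis r U i)) l) =
      (\<Sum>i = 1..r. if k \<le> i then scalar (germ_const (?B i l)) * fls_shift (1 - int k) (scalar (c k i)) else 0)"
      by (rule sum.mono_neutral_cong_left)
         (use k in \<open>auto simp: smul_def incl_ebasis times_dt_pow mult.commute\<close>)
  qed
  also have "\<dots> = (\<Sum>i = 1..r. \<Sum>k = 1..r. if k \<le> i then scalar (germ_const (?B i l)) * fls_shift (1 - int k) (scalar (c k i)) else 0)"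
    by (rule sum.swap)
  also have "\<dots> = (\<Sum>i = 1..r. scalar (germ_const (?B i l)) * ?W i)"
  proof (rule sum.cong[OF refl])
    fix i assume i: "i \<in> {1..r}"
    have "(\<Sum>k = 1..r. if k \<le> i then scalar (germ_const (?B i l)) * fls_shift (1 - int k) (scalar (c k i)) else 0)
        = (\<Sum>k = 1..i. scalar (germ_const (?B i l)) * fls_shift (1 - int k) (scalar (c k i)))"
      by (rule sum.mono_neutral_cong_right) (use i in auto)
    then show "(\<Sum>k = 1..r. if k \<le> i then scalar (germ_const (?B i l)) * fls_shift (1 - int k) (scalar (c k i)) else 0)
        = scalar (germ_const (?B i l)) * ?W i"
      using i by (simp add: sum_distrib_left)
  qed
  finally show "(incl (ebasis r U 0) + (\<Sum>k = 1..r. \<Sum>i = k..r.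
      smul (scalar (c k i) * dt_pow (1 - int k)) (incl (ebasis r U i)))) l = base_change r ?B ?W l"
    by (simp add: base_change_def sum.atLeast_Suc_atMost incl_ebasis)
qed

lemma adapted_section_iff:
  "(\<exists>c :: nat \<Rightarrow> nat \<Rightarrow> 'n::finite hgerm. v - incl (ebasis r U 0) =
      (\<Sum>k = 1..r. \<Sum>i = k..r. smul (scalar (c k i) * dt_pow (1 - int k)) (incl (ebasis r U i))))
   \<longleftrightarrow> (\<exists>W. adapted_shape r W \<and> v = base_change r (basis_matrix r U) W)"
  (is "(\<exists>c. v - ?e = ?sum c) \<longleftrightarrow> _")
proof
  assume "\<exists>c. v - ?e = ?sum c"
  then obtain c where "v - ?e = ?sum c" ..
  then have "v = ?e + ?sum c" by (metis add.commute diff_add_cancel)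
  moreover have "adapted_shape r (\<lambda>i. if i = 0 then 1 else if i \<le> r
      then \<Sum>k = 1..i. fls_shift (1 - int k) (scalar (c k i)) else 0)"
    by (auto simp: adapted_shape_def fls_nth_sum intro!: sum.neutral)
  ultimately show "\<exists>W. adapted_shape r W \<and> v = base_change r (basis_matrix r U) W"
    unfolding adapted_sum by blast
next
  assume "\<exists>W. adapted_shape r W \<and> v = base_change r (basis_matrix r U) W"
  then obtain W where W: "adapted_shape r W" and v: "v = base_change r (basis_matrix r U) W" by blast
  define c where "c k i = W i $$ (int k - 1)" for k i
  have "W = (\<lambda>i. if i = 0 then 1 else if i \<le> r then \<Sum>k = 1..i. fls_shift (1 - int k) (scalar (c k i)) else 0)"
  proof (rule ext, rule fls_eqI)
    fix i n
    show "W i $$ n = (if i = 0 then 1 else if i \<le> r then \<Sum>k = 1..i. fls_shift (1 - int k) (scalar (c k i)) else 0) $$ n"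
    proof (cases "i \<in> {1..r}")
      case True
      have "(\<Sum>k = 1..i. fls_shift (1 - int k) (scalar (c k i))) $$ n
          = (\<Sum>k = 1..i. if k = nat (n + 1) then if 0 \<le> n then W i $$ n else 0 else 0)"
        unfolding fls_nth_sum by (intro sum.cong) (auto simp: c_def)
      also have "\<dots> = W i $$ n"
        using W True unfolding adapted_shape_def by auto
      finally show ?thesis using True by auto
    next
      case False
      then show ?thesis using W by (auto simp: adapted_shape_def)
    qed
  qed
  then have "v = ?e + ?sum c" using v adapted_sum[of r U c] by simp
  then have "v - ?e = ?sum c" by (simp only: add_diff_cancel_left')
  then show "\<exists>c. v - ?e = ?sum c" by (rule exI[of _ c])
qed

lemma basis_components_base_change:
  assumes U: "opposite r U" and W: "\<And>j. j > r \<Longrightarrow> W j = 0"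
  shows "basis_components r U (base_change r (basis_matrix r U) W) = W"
  unfolding basis_components_def
proof (rule the_equality)
  have eq: "(\<Sum>i = 0..r. smul (a i) (incl (ebasis r U i))) = base_change r (basis_matrix r U) a" for a :: "'a gm"
    by (rule ext) (simp add: sum_fun_app smul_def base_change_def incl_ebasis mult.commute)
  show "(\<forall>i>r. W i = 0) \<and> base_change r (basis_matrix r U) W = (\<Sum>i = 0..r. smul (W i) (incl (ebasis r U i)))"
    using W by (simp add: eq)
  fix a assume "(\<forall>i>r. a i = 0) \<and> base_change r (basis_matrix r U) W = (\<Sum>i = 0..r. smul (a i) (incl (ebasis r U i)))"
  then have a: "\<And>i. i > r \<Longrightarrow> a i = 0" "base_change r (basis_matrix r U) a = base_change r (basis_matrix r U) W"
    by (auto simp: eq)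
  note inv = base_change_inverse[OF mutually_inverse_sym[OF Amatrix_inverse[OF U]]]
  have "a = base_change r (Amatrix r U) (base_change r (basis_matrix r U) a)"
    by (rule inv[symmetric]) (rule a(1))
  also have "\<dots> = W" unfolding a(2) by (rule inv) (rule W)
  finally show "a = W" .
qed

context
  fixes r :: nat and ix :: "nat \<Rightarrow> 'n::finite" and h :: "complex fps"
  assumes r: "2 \<le> r" and ix: "bij_betw ix {1..r} (UNIV :: 'n set)" and h: "admissible h"
begin

lemma inj_ix: "inj_on ix {1..r}"
  using ix by (rule bij_betw_imp_inj_on)

lemma brieskorn_base_change:
  assumes AB: "mutually_inverse r A B" and W: "\<forall>j>r. W j = 0"
  shows "base_change r B W \<in> brieskorn r ix h \<longleftrightarrow> (\<forall>j\<le>r. W j \<in> conv_ops0) \<and>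
     lattice_eqs r (\<lambda>j. adapted_map ix h B (ix j)) (germ_fps (transformed_series h B) (adapted_map ix h B (ix 1)))
       (germ_fps (fps_deriv (transformed_series h B)) (adapted_map ix h B (ix 1))) W"
proof -
  have A_B: "base_change r A (base_change r B W) = W"
    by (rule base_change_inverse[OF mutually_inverse_sym[OF AB]]) (use W in blast)
  have "(\<forall>j\<le>r. base_change r B W j \<in> conv_ops0) \<longleftrightarrow> (\<forall>j\<le>r. W j \<in> conv_ops0)"
  proof
    assume "\<forall>j\<le>r. W j \<in> conv_ops0"
    then show "\<forall>j\<le>r. base_change r B W j \<in> conv_ops0" by (simp add: base_change_conv_ops0)
  next
    assume "\<forall>j\<le>r. base_change r B W j \<in> conv_ops0"
    then have "base_change r A (base_change r B W) j \<in> conv_ops0" for j by (simp add: base_change_conv_ops0)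
    then show "\<forall>j\<le>r. W j \<in> conv_ops0" unfolding A_B by blast
  qed
  moreover have "base_change r B W j = 0" if "j > r" for j
    using AB that by (intro base_change_beyond) (auto simp: mutually_inverse_def)
  ultimately show ?thesis
    unfolding brieskorn_iff[OF r inj_ix admissibleD(1)[OF h]]
    using lattice_eqs_base_change[OF AB r refl A_B[symmetric] adapted_data_transformed[OF r inj_ix h, of B]]
    by blast
qed

text \<open>
  In the adapted basis the lattice equations have the same shape as for \<open>v\<^sub>0\<close>, so the section that they
  determine has the form of \<open>v\<^sub>0\<close>, in the new coordinates and with the transformed series.
\<close>

lemma vprime_eq:
  assumes U: "opposite r U"
  defines "B \<equiv> basis_matrix r U"
  shows "vprime r ix h U = base_change r B (section_form r (\<lambda>j. adapted_map ix h B (ix j))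
     (germ_fps (transformed_series h B) (adapted_map ix h B (ix 1))))"
  unfolding vprime_def adapted_section_iff
proof (rule the_equality)
  note AB = Amatrix_inverse[OF U, folded B_def]
  let ?S = "\<lambda>j. adapted_map ix h B (ix j)" and ?H = "germ_fps (transformed_series h B) (adapted_map ix h B (ix 1))"
  let ?W = "section_form r ?S ?H"
  have "base_change r B ?W \<in> brieskorn r ix h"
    by (subst brieskorn_base_change[OF AB])
       (auto simp: section_form_conv_ops0 lattice_eqs_section_form[OF r] intro: section_form_beyond)
  then show "base_change r B ?W \<in> brieskorn r ix h \<and>
      (\<exists>W. adapted_shape r W \<and> base_change r B ?W = base_change r (basis_matrix r U) W)"
    using adapted_shape_section_form[OF r, of ?S ?H] unfolding B_def by blast
  fix v assume "v \<in> brieskorn r ix h \<and> (\<exists>W. adapted_shape r W \<and> v = base_change r (basis_matrix r U) W)"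
  then obtain W where W: "adapted_shape r W" and v: "v = base_change r B W" "base_change r B W \<in> brieskorn r ix h"
    unfolding B_def by blast
  have "\<forall>j>r. W j = 0" using W by (simp add: adapted_shape_def)
  from brieskorn_base_change[OF AB this] v(2) have "W = ?W"
    by (intro adapted_shape_unique[OF r W]) blast
  then show "v = base_change r B ?W" using v(1) by simp
qed

lemma
  assumes U: "opposite r U"
  defines "B \<equiv> basis_matrix r U"
  shows gU_1_eq: "gU r ix h U 1 = adapted_map ix h B (ix 1)"
    and gtildeU_eq: "gtildeU r ix h U = germ_fps (transformed_series h B) (adapted_map ix h B (ix 1))"
proof -
  let ?W = "section_form r (\<lambda>j. adapted_map ix h B (ix j)) (germ_fps (transformed_series h B) (adapted_map ix h B (ix 1)))"
  have W: "basis_components r U (vprime r ix h U) = ?W"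
    unfolding vprime_eq[OF U] B_def
    by (rule basis_components_base_change[OF U]) (simp add: section_form_def)
  show "gU r ix h U 1 = adapted_map ix h B (ix 1)"
    using r by (simp add: gU_def basis_coeff_def W section_form_nth)
  show "gtildeU r ix h U = germ_fps (transformed_series h B) (adapted_map ix h B (ix 1))"
    using r by (simp add: gtildeU_def basis_coeff_def W section_form_nth)
qed

text \<open>The first adapted coordinate is an invertible series in \<open>s\<^sub>1\<close>, so it can be cancelled.\<close>

lemma germ_fps_adapted_inject:
  assumes "admissible k" "admissible k'"
    and "germ_fps k (adapted_map ix h B (ix 1)) = germ_fps k' (adapted_map ix h B (ix 1))"
  shows "k = k'"
proof -
  let ?G = "coord_series h B"
  note G = series_convergent(2)[OF h, of B] coord_series_nth[OF h, of B]
  note k = admissibleD(1)[OF assms(1)] and k' = admissibleD(1)[OF assms(2)]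
  have "k oo ?G = k' oo ?G"
    using assms(3) unfolding germ_fps_adapted_coord[OF h k] germ_fps_adapted_coord[OF h k']
    by (rule germ_fps_coord_inject[OF fps_compose_convergent(1)[OF k G(1,2)] fps_compose_convergent(1)[OF k' G(1,2)]])
  then have "(k oo ?G) oo fps_inv ?G = (k' oo ?G) oo fps_inv ?G" by simp
  moreover have "(f oo ?G) oo fps_inv ?G = f" for f
  proof -
    have "(f oo ?G) oo fps_inv ?G = f oo (?G oo fps_inv ?G)"
      by (rule fps_compose_assoc[symmetric, OF _ G(2)]) (simp add: fps_inv_def)
    then show ?thesis using fps_inv_right[OF G(2)] G(3) by simp
  qed
  ultimately show ?thesis by simp
qed

lemma transformed_series_characterization:
  assumes U: "opposite r U"
  shows "admissible k \<and> gtildeU r ix h U = germ_fps k (gU r ix h U 1) \<longleftrightarrow> k = transformed_series h (basis_matrix r U)"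
  unfolding gU_1_eq[OF U] gtildeU_eq[OF U]
  using transformed_series(1)[OF h] germ_fps_adapted_inject by metis

lemma hU_eq: "opposite r U \<Longrightarrow> hU r ix h U = transformed_series h (basis_matrix r U)"
  unfolding hU_def by (simp only: transformed_series_characterization the_eq_trivial)

end

section \<open>Normalized isomorphisms\<close>

subsection \<open>Pullback of the lattice\<close>

lemma pullback_nth:
  assumes "\<And>i. germ_at0 (\<rho> i) = 0"
  shows "pullback \<rho> u j $$ k = germ_comp (u j $$ k) \<rho>"
  unfolding pullback_def by (rule fls_nth_map_coefficients) (simp add: germ_comp_simps assms)

lemma lattice_eqs_pullback:
  assumes \<rho>: "\<And>i. germ_at0 (\<rho> i) = 0" and "lattice_eqs r S H D u"
  shows "lattice_eqs r (\<lambda>j. germ_comp (S j) \<rho>) (germ_comp H \<rho>) (germ_comp D \<rho>) (pullback \<rho> u)"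
  using assms(2) unfolding lattice_eqs_def pullback_nth[OF \<rho>]
  by (simp add: germ_comp_simps \<rho>)

lemma pullback_conv:
  assumes "\<And>i. germ_at0 (\<rho> i) = 0" "u j \<in> conv_ops0" shows "pullback \<rho> u j \<in> conv_ops0"
  unfolding pullback_def by (rule pullback_conv_ops0[OF assms(2,1)])

text \<open>Pulling back along the inverse germ recovers a section of the lattice of \<open>k\<close> from a solution of the equations.\<close>

lemma pullback_brieskorn_iff:
  fixes ix :: "nat \<Rightarrow> 'n::finite"
  assumes r: "2 \<le> r" "inj_on ix {1..r}" and k: "fps_conv_radius k > 0" and \<rho>: "germ_iso \<rho>"
  shows "w \<in> pullback \<rho> ` brieskorn r ix k \<longleftrightarrow> (\<forall>j\<le>r. w j \<in> conv_ops0) \<and> (\<forall>j>r. w j = 0) \<and>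
     lattice_eqs r (\<lambda>j. \<rho> (ix j)) (germ_fps k (\<rho> (ix 1))) (germ_fps (fps_deriv k) (\<rho> (ix 1))) w"
    (is "_ \<longleftrightarrow> ?rhs w")
proof -
  obtain \<tau> where \<rho>0: "\<And>i. germ_at0 (\<rho> i) = 0" and \<tau>0: "\<And>i. germ_at0 (\<tau> i) = 0"
    and \<rho>\<tau>: "\<And>i. germ_comp (\<rho> i) \<tau> = germ_coord i" and \<tau>\<rho>: "\<And>i. germ_comp (\<tau> i) \<rho> = germ_coord i"
    using \<rho> unfolding germ_iso_def by blast
  note k' = fps_conv_radius_pos_deriv[OF k]
  show ?thesis
  proof
    assume "w \<in> pullback \<rho> ` brieskorn r ix k"
    then obtain z where z: "z \<in> brieskorn r ix k" and w: "w = pullback \<rho> z" by blast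
    have "w j = 0" if "j > r" for j
      by (rule fls_eqI)
         (use z that in \<open>simp add: w pullback_nth[OF \<rho>0] brieskorn_iff[OF r k] germ_comp_simps \<rho>0\<close>)
    moreover have "w j \<in> conv_ops0" if "j \<le> r" for j
      unfolding w by (rule pullback_conv[OF \<rho>0]) (use z that in \<open>simp add: brieskorn_iff[OF r k]\<close>)
    moreover have "lattice_eqs r (\<lambda>j. germ_coord (ix j)) (germ_fps k (germ_coord (ix 1)))
        (germ_fps (fps_deriv k) (germ_coord (ix 1))) z"
      using z by (simp add: brieskorn_iff[OF r k])
    from lattice_eqs_pullback[of \<rho>, OF \<rho>0 this]
    have "lattice_eqs r (\<lambda>j. \<rho> (ix j)) (germ_fps k (\<rho> (ix 1))) (germ_fps (fps_deriv k) (\<rho> (ix 1))) w"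
      by (simp add: w germ_comp_simps germ_comp_germ_fps \<rho>0 k k')
    ultimately show "?rhs w" by blast
  next
    assume w: "?rhs w"
    let ?z = "pullback \<tau> w"
    have "?z j = 0" if "j > r" for j
      by (rule fls_eqI) (use w that in \<open>simp add: pullback_nth[OF \<tau>0] germ_comp_simps \<tau>0\<close>)
    moreover have "?z j \<in> conv_ops0" if "j \<le> r" for j
      by (rule pullback_conv[OF \<tau>0]) (use w that in simp)
    moreover have "lattice_eqs r (\<lambda>j. \<rho> (ix j)) (germ_fps k (\<rho> (ix 1))) (germ_fps (fps_deriv k) (\<rho> (ix 1))) w"
      using w by blast
    from lattice_eqs_pullback[of \<tau>, OF \<tau>0 this]
    have "lattice_eqs r (\<lambda>j. germ_coord (ix j)) (germ_fps k (germ_coord (ix 1)))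
        (germ_fps (fps_deriv k) (germ_coord (ix 1))) ?z"
      by (simp add: \<rho>\<tau> germ_comp_germ_fps \<rho>0 \<tau>0 k k')
    ultimately have "?z \<in> brieskorn r ix k" by (simp add: brieskorn_iff[OF r k])
    moreover have "w = pullback \<rho> ?z"
      by (rule ext, rule fls_eqI)
         (simp add: pullback_nth[OF \<rho>0] pullback_nth[OF \<tau>0] germ_comp_assoc[OF \<tau>0 \<rho>0] \<tau>\<rho> germ_comp_coord)
    ultimately show "w \<in> pullback \<rho> ` brieskorn r ix k" by blast
  qed
qed

subsection \<open>A change of basis gives a normalized isomorphism\<close>

lemma ds_act_nth: "ds_act i u j $$ k = germ_partial i (u j $$ k)"
  unfolding ds_act_def by (rule fls_nth_map_coefficients) (simp add: germ_partial_simps)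

lemma t_act_nth: "t_act u j $$ k = of_int k * u j $$ (k - 1)"
  by (simp add: t_act_def fls_X_times_conv_shift)

lemma germ_partial_sum: "germ_partial i (sum f I) = (\<Sum>j\<in>I. germ_partial i (f j))"
  by (induction I rule: infinite_finite_induct) (auto simp: germ_partial_simps)

lemma base_change_add: "base_change r A (u + v) = base_change r A u + base_change r A v"
  by (rule ext, rule fls_eqI) (simp add: base_change_nth distrib_left sum.distrib)

lemma base_change_smul: "base_change r A (smul a u) = smul a (base_change r A u)"
  by (rule ext) (simp add: base_change_def smul_def sum_distrib_left mult_ac)

lemma base_change_t_act: "base_change r A (t_act u) = t_act (base_change r A u)"
  by (rule ext, rule fls_eqI) (simp add: base_change_nth t_act_nth sum_distrib_left mult_ac)

lemma base_change_ds_act: "base_change r A (ds_act i u) = ds_act i (base_change r A u)"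
  by (rule ext, rule fls_eqI) (simp add: base_change_nth ds_act_nth germ_partial_sum germ_partial_simps)

lemma base_change_bij:
  assumes AB: "mutually_inverse r A B"
  shows "bij_betw (base_change r A) (gm_carrier r) (gm_carrier r)"
proof (rule bij_betw_byWitness[where f' = "base_change r B"])
  have T: "unitriangular r A" "unitriangular r B" using AB by (auto simp: mutually_inverse_def)
  show "\<forall>u\<in>gm_carrier r. base_change r B (base_change r A u) = u"
    by (auto simp: gm_carrier_def intro!: base_change_inverse[OF AB])
  show "\<forall>u\<in>gm_carrier r. base_change r A (base_change r B u) = u"
    by (auto simp: gm_carrier_def intro!: base_change_inverse[OF mutually_inverse_sym[OF AB]])
  show "base_change r A ` gm_carrier r \<subseteq> gm_carrier r" "base_change r B ` gm_carrier r \<subseteq> gm_carrier r"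
    using base_change_carrier T by blast+
qed

lemma base_change_incl_evec:
  assumes "i \<le> r" shows "base_change r A (incl (evec i)) l = scalar (germ_const (A i l))"
proof -
  have "base_change r A (incl (evec i)) l = (\<Sum>j = 0..r. if j = i then scalar (germ_const (A i l)) else 0)"
    unfolding base_change_def by (intro sum.cong) (auto simp: incl_def evec_def germ_const_simps)
  then show ?thesis using assms by simp
qed

lemma brieskorn_beyond:
  fixes ix :: "nat \<Rightarrow> 'n::finite"
  assumes "2 \<le> r" "inj_on ix {1..r}" "fps_conv_radius h > 0" "u \<in> brieskorn r ix h"
  shows "\<forall>j>r. u j = 0"
  using assms(4) by (simp add: brieskorn_iff[OF assms(1-3)])

text \<open>
  The isomorphism sends \<open>e\<^sub>i\<close> to \<open>\<Sum> A\<^sub>i\<^sub>j e\<^sub>j\<close>, and on the base it is the germ with components \<open>g\<^sub>j\<^sup>U\<close>. The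
  image of the one lattice and the pullback of the other are described by the same equations, by
  \<open>brieskorn_base_change\<close> and \<open>pullback_brieskorn_iff\<close>.
\<close>

lemma normalized_iso_of_filtration:
  fixes ix :: "nat \<Rightarrow> 'n::finite"
  assumes r: "2 \<le> r" and ix: "bij_betw ix {1..r} (UNIV :: 'n set)" and h: "admissible h" and U: "opposite r U"
  defines "B \<equiv> basis_matrix r U"
  shows "normalized_iso r ix h (transformed_series h B) (adapted_map ix h B) (base_change r (Amatrix r U))"
proof -
  let ?A = "Amatrix r U" and ?k = "transformed_series h B" and ?\<rho> = "adapted_map ix h B"
  note AB = Amatrix_inverse[OF U, folded B_def] and inj = bij_betw_imp_inj_on[OF ix]
  have A: "unitriangular r ?A" using AB by (simp add: mutually_inverse_def)
  note pb = pullback_brieskorn_iff[OF r inj admissibleD(1)[OF transformed_series(1)[OF h, of B]] germ_iso_adapted_map[OF h, of ix B]]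
  have "base_change r ?A ` brieskorn r ix h = pullback ?\<rho> ` brieskorn r ix ?k"
  proof (intro set_eqI iffI)
    fix w assume "w \<in> base_change r ?A ` brieskorn r ix h"
    then obtain u where u: "u \<in> brieskorn r ix h" and w: "w = base_change r ?A u" by blast
    have w0: "\<forall>j>r. w j = 0" unfolding w by (blast intro: base_change_beyond[OF A])
    have "base_change r B w = u"
      unfolding w by (rule base_change_inverse[OF AB]) (use brieskorn_beyond[OF r inj admissibleD(1)[OF h] u] in blast)
    then show "w \<in> pullback ?\<rho> ` brieskorn r ix ?k"
      unfolding pb using brieskorn_base_change[OF r ix h AB w0] u w0 by simp
  next
    fix w assume w: "w \<in> pullback ?\<rho> ` brieskorn r ix ?k"
    then have w0: "\<forall>j>r. w j = 0" unfolding pb by blast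
    have "base_change r B w \<in> brieskorn r ix h"
      unfolding brieskorn_base_change[OF r ix h AB w0] using w unfolding pb by blast
    moreover have "w = base_change r ?A (base_change r B w)"
      by (rule base_change_inverse[OF mutually_inverse_sym[OF AB], symmetric]) (use w0 in blast)
    ultimately show "w \<in> base_change r ?A ` brieskorn r ix h" by blast
  qed
  moreover have "base_change r ?A (incl (evec i) :: 'n gm) i = 1" if "i \<le> r" for i
    using that A by (simp add: base_change_incl_evec unitriangular_diag germ_const_simps)
  moreover have "bij_betw (base_change r ?A :: 'n gm \<Rightarrow> 'n gm) (gm_carrier r) (gm_carrier r)"
    by (rule base_change_bij[OF AB])
  ultimately show ?thesis
    unfolding normalized_iso_def using germ_iso_adapted_map[OF h]
    by (simp add: base_change_add base_change_smul base_change_t_act base_change_ds_act)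
qed

subsection \<open>Every normalized isomorphism is a change of basis\<close>

lemma zero_conv_ops: "0 \<in> conv_ops"
  by (rule conv_ops0_subset_conv_ops[OF conv_ops0_0])

lemma incl_evec_carrier: "i \<le> r \<Longrightarrow> incl (evec i) \<in> gm_carrier r"
  by (auto simp: gm_carrier_def incl_def evec_def germ_const_simps zero_conv_ops
      conv_ops0_subset_conv_ops[OF conv_ops0_1])

lemma gm_carrier_add: "u \<in> gm_carrier r \<Longrightarrow> v \<in> gm_carrier r \<Longrightarrow> u + v \<in> gm_carrier r"
  by (auto simp: gm_carrier_def conv_ops_add)

lemma gm_carrier_zero: "0 \<in> gm_carrier r"
  by (auto simp: gm_carrier_def zero_conv_ops)

lemma smul_incl_evec: "smul a (incl (evec i)) = (\<lambda>j. if j = i then a else 0)"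
  by (rule ext) (simp add: smul_def incl_def evec_def germ_const_simps)

lemma smul_evec_carrier: "i \<le> r \<Longrightarrow> a \<in> conv_ops \<Longrightarrow> smul a (incl (evec i)) \<in> gm_carrier r"
  by (auto simp: smul_incl_evec gm_carrier_def zero_conv_ops)

lemma fls_X_conv_ops: "fls_X \<in> conv_ops"
proof -
  have "fls_shift (- 1) 1 \<in> conv_ops0" by (rule conv_ops0_shift[OF conv_ops0_1]) auto
  then show ?thesis unfolding fls_X_conv_shift_1 by (rule conv_ops0_subset_conv_ops)
qed

lemma of_int_times_germ_eq_0:
  fixes f :: "'n::finite hgerm"
  assumes "of_int m * f = 0" "m \<noteq> 0" shows "f = 0"
proof -
  have "germ_const (1 / of_int m) * (of_int m * f) = germ_const (1 / of_int m * of_int m) * f"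
    by (simp only: germ_const_simps germ_const_of_int mult.assoc)
  also have "1 / of_int m * of_int m = (1 :: complex)" using assms(2) by simp
  finally show ?thesis using assms(1) by (simp add: germ_const_simps)
qed

text \<open>
  From \<open>t e = \<partial>\<^sub>t\<^sup>-\<^sup>1 e\<close> the coefficients of \<open>\<phi>(e)\<close> at all nonzero powers of \<open>\<partial>\<^sub>t\<^sup>-\<^sup>1\<close> vanish, and from
  \<open>\<partial>\<^sub>s e = 0\<close> the remaining ones are constants.
\<close>

lemma horizontal_section_constant:
  assumes t: "t_act w = smul fls_X w" and ds: "\<And>i. ds_act i w = 0"
  shows "w j = scalar (germ_const (germ_at0 (w j $$ 0)))"
proof (rule fls_eqI)
  fix n
  have "t_act w j $$ (n + 1) = smul fls_X w j $$ (n + 1)" by (simp add: t)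
  then have "of_int (n + 1) * w j $$ n = w j $$ n"
    unfolding t_act_nth smul_def fls_X_times_conv_shift by simp
  then have "of_int n * w j $$ n = 0" by (simp add: distrib_right)
  then have "n \<noteq> 0 \<Longrightarrow> w j $$ n = 0" by (rule of_int_times_germ_eq_0)
  moreover have "w j $$ 0 = germ_const (germ_at0 (w j $$ 0))"
  proof (rule germ_partial_zero_imp_const)
    fix i
    have "ds_act i w j $$ 0 = 0" by (simp add: ds)
    then show "germ_partial i (w j $$ 0) = 0" by (simp only: ds_act_nth)
  qed
  ultimately show "w j $$ n = scalar (germ_const (germ_at0 (w j $$ 0))) $$ n" by simp
qed

lemma normalized_iso_is_base_change:
  assumes iso: "normalized_iso r ix h h' \<rho> \<phi>"
  obtains A where "\<forall>i j. \<not> (i \<le> r \<and> j \<le> r) \<longrightarrow> A i j = 0" "\<forall>i\<le>r. A i i = 1"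
    "\<And>u. u \<in> gm_carrier r \<Longrightarrow> \<phi> u = base_change r A u"
proof -
  have bij: "bij_betw \<phi> (gm_carrier r) (gm_carrier r)"
    and add: "\<And>u v. u \<in> gm_carrier r \<Longrightarrow> v \<in> gm_carrier r \<Longrightarrow> \<phi> (u + v) = \<phi> u + \<phi> v"
    and smul: "\<And>a u. a \<in> conv_ops \<Longrightarrow> u \<in> gm_carrier r \<Longrightarrow> \<phi> (smul a u) = smul a (\<phi> u)"
    and t: "\<And>u. u \<in> gm_carrier r \<Longrightarrow> \<phi> (t_act u) = t_act (\<phi> u)"
    and ds: "\<And>i u. u \<in> gm_carrier r \<Longrightarrow> \<phi> (ds_act i u) = ds_act i (\<phi> u)"
    and diag: "\<And>i. i \<le> r \<Longrightarrow> \<phi> (incl (evec i)) i = 1"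
    using iso unfolding normalized_iso_def by simp_all
  have \<phi>0: "\<phi> 0 = 0" using add[OF gm_carrier_zero gm_carrier_zero] by simp
  let ?e = "\<lambda>i. incl (evec i) :: 'a gm"
  define A where "A i j = (if i \<le> r \<and> j \<le> r then germ_at0 (\<phi> (?e i) j $$ 0) else 0)" for i j
  have \<phi>e: "\<phi> (?e i) j = scalar (germ_const (A i j))" if i: "i \<le> r" for i j
  proof (cases "j \<le> r")
    case True
    have "t_act (?e i) = smul fls_X (?e i)"
      by (rule ext, rule fls_eqI) (simp add: t_act_nth smul_def fls_X_times_conv_shift incl_def)
    then have "t_act (\<phi> (?e i)) = smul fls_X (\<phi> (?e i))"
      using t[OF incl_evec_carrier[OF i]] smul[OF fls_X_conv_ops incl_evec_carrier[OF i]] by simp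
    moreover have "ds_act l (?e i) = 0" for l
      by (rule ext, rule fls_eqI) (simp add: ds_act_nth incl_def germ_partial_simps)
    then have "ds_act l (\<phi> (?e i)) = 0" for l
      using ds[OF incl_evec_carrier[OF i], of l] \<phi>0 by simp
    ultimately show ?thesis using horizontal_section_constant[of "\<phi> (?e i)" j] True i by (simp add: A_def)
  next
    case False
    have "\<phi> (?e i) \<in> gm_carrier r" using bij incl_evec_carrier[OF i] by (rule bij_betw_apply)
    then show ?thesis using False by (simp add: gm_carrier_def A_def germ_const_simps)
  qed
  have sum: "sum u I \<in> gm_carrier r \<and> \<phi> (sum u I) = (\<Sum>i\<in>I. \<phi> (u i))"
    if "finite I" "\<And>i. i \<in> I \<Longrightarrow> u i \<in> gm_carrier r" for u :: "nat \<Rightarrow> 'a gm" and I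
    using that by (induction I) (auto simp: \<phi>0 gm_carrier_zero gm_carrier_add add)
  have "\<phi> u = base_change r A u" if u: "u \<in> gm_carrier r" for u
  proof -
    have conv: "u i \<in> conv_ops" if "i \<le> r" for i using u that by (simp add: gm_carrier_def)
    have "u = (\<Sum>i = 0..r. smul (u i) (?e i))"
      using u by (auto simp: fun_eq_iff sum_fun_app smul_incl_evec gm_carrier_def not_le)
    then have "\<phi> u = \<phi> (\<Sum>i = 0..r. smul (u i) (?e i))" by (rule arg_cong)
    also have "\<dots> = (\<Sum>i = 0..r. \<phi> (smul (u i) (?e i)))"
    proof -
      have "smul (u i) (?e i) \<in> gm_carrier r" if "i \<in> {0..r}" for i
        using that conv smul_evec_carrier by auto
      from sum[of "{0..r}" "\<lambda>i. smul (u i) (?e i)", OF finite_atLeastAtMost this] show ?thesis by blast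
    qed
    also have "\<dots> = (\<Sum>i = 0..r. smul (u i) (\<phi> (?e i)))"
      by (intro sum.cong refl smul conv incl_evec_carrier) auto
    also have "\<dots> = base_change r A u"
      by (rule ext) (simp add: sum_fun_app smul_def base_change_def \<phi>e mult.commute)
    finally show ?thesis .
  qed
  moreover have "A i i = 1" if "i \<le> r" for i
  proof -
    have "scalar (germ_const (A i i)) = (1 :: 'a hgerm fls)"
      using diag[OF that] \<phi>e[OF that, of i] by (simp only:)
    then have "scalar (germ_const (A i i)) $$ 0 = (1 :: 'a hgerm fls) $$ 0" by (rule arg_cong)
    then have "germ_const (A i i) = (germ_const 1 :: 'a hgerm)" by (simp add: germ_const_simps)
    then show ?thesis by (simp only: germ_const_inject)
  qed
  moreover have "\<forall>i j. \<not> (i \<le> r \<and> j \<le> r) \<longrightarrow> A i j = 0" by (simp add: A_def)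
  ultimately show thesis using that by blast
qed

lemma vsec_in_brieskorn:
  fixes ix :: "nat \<Rightarrow> 'n::finite"
  assumes "i \<le> r" shows "vsec r ix h i \<in> brieskorn r ix h"
proof -
  have "vsec r ix h i = (\<Sum>j = 0..r. smul (if j = i then 1 else 0) (vsec r ix h j))"
  proof
    fix l
    have "(\<Sum>j = 0..r. smul (if j = i then 1 else 0) (vsec r ix h j)) l
        = (\<Sum>j = 0..r. if j = i then vsec r ix h i l else 0)"
      unfolding sum_fun_app by (intro sum.cong) (auto simp: smul_def)
    then show "vsec r ix h i l = (\<Sum>j = 0..r. smul (if j = i then 1 else 0) (vsec r ix h j)) l"
      using assms by simp
  qed
  moreover have "(if j = i then 1 else 0 :: 'n hgerm fls) \<in> conv_ops0" for j by (simp add: conv_ops0_1 conv_ops0_0)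
  ultimately show ?thesis
    unfolding brieskorn_def by (intro CollectI exI[of _ "\<lambda>j. if j = i then 1 else 0"] conjI) simp_all
qed

text \<open>
  Triangularity is read off from the images of the generators. The generator \<open>v\<^sub>i\<close>, \<open>i \<ge> 1\<close>, starts at order \<open>i\<close> in \<open>\<partial>\<^sub>t\<^sup>-\<^sup>1\<close>,
  whereas for \<open>j \<ge> 3\<close> the component \<open>j\<close> of a section \<open>w\<close> of the pulled back lattice starts at order \<open>j - 1\<close>, with a
  multiple of \<open>w 0 $$ 0\<close>. The entries that this leaves open are values at \<open>s = 0\<close> of coefficients of orders \<open>0\<close> and \<open>1\<close>, and these
  coefficients are combinations of \<open>\<rho>\<^sub>1, \<rho>\<^sub>2\<close>, of the series of the target at \<open>\<rho>\<^sub>1\<close> and of its derivative at \<open>\<rho>\<^sub>1\<close>, or zero.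
\<close>

lemma normalized_iso_triangular:
  fixes ix :: "nat \<Rightarrow> 'n::finite"
  assumes r: "2 \<le> r" and ix: "inj_on ix {1..r}" and h: "admissible h" "admissible h'" and \<rho>: "germ_iso \<rho>"
    and A: "\<forall>i j. \<not> (i \<le> r \<and> j \<le> r) \<longrightarrow> A i j = 0" "\<forall>i\<le>r. A i i = 1"
    and sub: "base_change r A ` brieskorn r ix h \<subseteq> pullback \<rho> ` brieskorn r ix h'"
  shows "unitriangular r A"
proof -
  let ?H = "germ_fps h' (\<rho> (ix 1))" and ?D = "germ_fps (fps_deriv h') (\<rho> (ix 1))"
  let ?c = "\<lambda>x. germ_const x :: 'n hgerm"
  let ?h1 = "germ_fps (fps_deriv h) (germ_coord (ix 1))"
  have \<rho>0: "germ_at0 (\<rho> i) = 0" for i using \<rho> unfolding germ_iso_def by blast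
  note adm = admissibleD[OF h(1)] admissibleD[OF h(2)]
  have at0: "germ_at0 ?H = 0" "germ_at0 ?D = 0" "germ_at0 ?h1 = 0" "germ_at0 (germ_fps h (germ_coord (ix 1))) = 0"
    using adm \<rho>0 by (simp_all add: germ_fps_simps fps_conv_radius_pos_deriv)
  have eqs: "lattice_eqs r (\<lambda>j. \<rho> (ix j)) ?H ?D (base_change r A u)" if "u \<in> brieskorn r ix h" for u
    using sub that pullback_brieskorn_iff[OF r ix adm(4) \<rho>, of "base_change r A u"] by blast
  have high: "A i j = 0" if i: "2 \<le> i" "i \<le> r" and j: "i < j" "j \<le> r" for i j
  proof -
    have comp: "base_change r A (vsec r ix h i) l $$ n = (if n = int i then ?c (A i l) else 0)" for l n
    proof -
      have "base_change r A (vsec r ix h i) l $$ n = (\<Sum>k = 0..r. if k = i then if n = int i then ?c (A i l) else 0 else 0)"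
        unfolding base_change_nth
        by (intro sum.cong) (use i in \<open>auto simp: vsec_component[OF r ix adm(1)]\<close>)
      then show ?thesis using i by simp
    qed
    have j3: "j \<in> {3..r}" using i j by auto
    have *: "(\<forall>k<int j - 1. base_change r A (vsec r ix h i) j $$ k = 0) \<and>
        base_change r A (vsec r ix h i) j $$ (int j - 1) = base_change r A (vsec r ix h i) 0 $$ 0 * \<rho> (ix j)"
      using eqs[OF vsec_in_brieskorn[OF i(2)]] j3 unfolding lattice_eqs_def by blast
    have "?c (A i j) = 0"
    proof (cases "int i < int j - 1")
      case True
      then show ?thesis using *[unfolded comp] by auto
    next
      case False
      then have "int j - 1 = int i" using j by auto
      then show ?thesis using *[unfolded comp] i by auto
    qed
    then show ?thesis by (metis germ_at0_simps(1,3))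
  qed
  have one: "A 1 j = 0" if j: "1 < j" "j \<le> r" for j
  proof -
    let ?w = "base_change r A (vsec r ix h 1)"
    have comp: "?w l $$ n = (if n = 1 then ?c (A 1 l) + ?c (A 2 l) * ?h1 else 0)" for l n
    proof -
      have "?w l $$ n = (\<Sum>k = 0..r. (if k = 1 then if n = 1 then ?c (A 1 l) else 0 else 0)
          + (if k = 2 then if n = 1 then ?c (A 2 l) * ?h1 else 0 else 0))"
        unfolding base_change_nth
        by (intro sum.cong) (use r in \<open>auto simp: vsec_component[OF r ix adm(1)]\<close>)
      then show ?thesis using r by (simp add: sum.distrib)
    qed
    have E: "lattice_eqs r (\<lambda>j. \<rho> (ix j)) ?H ?D ?w" by (rule eqs[OF vsec_in_brieskorn]) (use r in simp)
    show ?thesis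
    proof (cases "j = 2")
      case True
      have "?w 2 $$ 1 = ?w 0 $$ 0 * \<rho> (ix 2) + ?w 0 $$ 1 * ?H + (?w 1 $$ 1 - ?w 0 $$ 1 * \<rho> (ix 1)) * ?D"
        using E unfolding lattice_eqs_def by blast
      then have "germ_at0 (?w 2 $$ 1) = 0" by (simp add: at0 \<rho>0 del: One_nat_def)
      then show ?thesis using True unfolding comp by (simp add: at0 del: One_nat_def)
    next
      case False
      then have "1 < int j - 1" "j \<in> {3..r}" using j by auto
      then have "?w j $$ 1 = 0" using E unfolding lattice_eqs_def by blast
      then have "germ_at0 (?w j $$ 1) = 0" by simp
      then show ?thesis unfolding comp by (simp add: at0 del: One_nat_def)
    qed
  qed
  have zero: "A 0 j = 0" if j: "0 < j" "j \<le> r" for j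
  proof -
    let ?w = "base_change r A (vsec r ix h 0)"
    have E: "lattice_eqs r (\<lambda>j. \<rho> (ix j)) ?H ?D ?w" by (rule eqs[OF vsec_in_brieskorn]) simp
    have val: "germ_at0 (?w l $$ 0) = A 0 l" for l
    proof -
      have "germ_at0 (germ_const (A k l) * vsec r ix h 0 k $$ 0) = (if k = 0 then A 0 l else 0)" for k
        by (simp add: vsec_def vsec0_eq_section_form[OF r] section_form_nth at0 del: One_nat_def)
      moreover have "germ_at0 (sum f I) = (\<Sum>i\<in>I. germ_at0 (f i))" for f :: "nat \<Rightarrow> 'n hgerm" and I
        by (induction I rule: infinite_finite_induct) auto
      ultimately show ?thesis by (simp add: base_change_nth)
    qed
    have "germ_at0 (?w j $$ 0) = 0"
    proof -
      have "j = 1 \<or> j = 2 \<or> (j \<in> {3..r} \<and> 0 < int j - 1)" using j by auto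
      then have "?w j $$ 0 = ?w 0 $$ 0 * \<rho> (ix 1) \<or> ?w j $$ 0 = ?w 0 $$ 0 * ?H \<or> ?w j $$ 0 = 0"
        using E unfolding lattice_eqs_def by blast
      then show ?thesis using at0 \<rho>0 by auto
    qed
    then show ?thesis using val by simp
  qed
  have "A i j = 0" if "i < j" for i j
  proof (cases "j \<le> r")
    case True
    have "i = 0 \<or> i = 1 \<or> 2 \<le> i" by auto
    then show ?thesis using that True zero[of j] one[of j] high[of i j] by auto
  next
    case False
    then show ?thesis using A(1) by blast
  qed
  then show ?thesis using A unfolding unitriangular_def by (metis not_le_imp_less)
qed

text \<open>
  Let \<open>w\<close> be the pullback of the section \<open>v\<^sub>0\<close> of the target. Its preimage under \<open>\<phi>\<close> lies in the lattice of \<open>h\<close>, so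
  \<open>w\<close> satisfies the equations with the first coordinate \<open>g\<^sub>1\<^sup>U\<close> and the series \<open>h\<^sup>U\<close>. As \<open>w\<close> has leading
  coefficients \<open>1, \<rho>\<^sub>1, h'(\<rho>\<^sub>1)\<close>, where \<open>h'\<close> is the series of the target, they give \<open>\<rho>\<^sub>1 = g\<^sub>1\<^sup>U\<close> and
  \<open>h'(g\<^sub>1\<^sup>U) = h\<^sup>U(g\<^sub>1\<^sup>U)\<close>.
\<close>

lemma filtration_of_normalized_iso:
  fixes ix :: "nat \<Rightarrow> 'n::finite"
  assumes r: "2 \<le> r" and ix: "bij_betw ix {1..r} (UNIV :: 'n set)" and h: "admissible h" "admissible h'"
    and iso: "normalized_iso r ix h h' \<rho> \<phi>"
  shows "\<exists>U. opposite r U \<and> h' = hU r ix h U"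
proof -
  note inj = bij_betw_imp_inj_on[OF ix] and adm = admissibleD(1)[OF h(1)] admissibleD(1)[OF h(2)]
  obtain A where A: "\<forall>i j. \<not> (i \<le> r \<and> j \<le> r) \<longrightarrow> A i j = 0" "\<forall>i\<le>r. A i i = 1"
    and \<phi>: "\<And>u. u \<in> gm_carrier r \<Longrightarrow> \<phi> u = base_change r A u"
    using normalized_iso_is_base_change[OF iso] by blast
  have \<rho>: "germ_iso \<rho>" and img: "\<phi> ` brieskorn r ix h = pullback \<rho> ` brieskorn r ix h'"
    using iso unfolding normalized_iso_def by simp_all
  have "u \<in> gm_carrier r" if "u \<in> brieskorn r ix h" for u
    using that by (simp add: brieskorn_iff[OF r inj adm(1)] gm_carrier_def conv_ops0_subset_conv_ops)
  then have "base_change r A ` brieskorn r ix h = \<phi> ` brieskorn r ix h"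
    using \<phi> by (intro image_cong refl) simp
  then have img': "base_change r A ` brieskorn r ix h = pullback \<rho> ` brieskorn r ix h'"
    using img by simp
  have "unitriangular r A" by (rule normalized_iso_triangular[OF r inj h \<rho> A]) (simp add: img')
  then obtain B where AB: "mutually_inverse r A B" using unitriangular_inverse by blast
  obtain U where U: "opposite r U" "basis_matrix r U = B" using opposite_filtration_of_matrix[OF AB] by blast
  have \<rho>0: "germ_at0 (\<rho> i) = 0" for i using \<rho> unfolding germ_iso_def by blast
  let ?z = "vsec r ix h' 0"
  let ?w = "pullback \<rho> ?z"
  have z: "?z \<in> brieskorn r ix h'" by (rule vsec_in_brieskorn) simp
  have w0: "\<forall>j>r. ?w j = 0" using z pullback_brieskorn_iff[OF r inj adm(2) \<rho>, of ?w] by blast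
  from z img' obtain u where u: "u \<in> brieskorn r ix h" "?w = base_change r A u" by blast
  have "base_change r B ?w = u"
    unfolding u(2) by (rule base_change_inverse[OF AB]) (use brieskorn_beyond[OF r inj adm(1) u(1)] in blast)
  then have E: "lattice_eqs r (\<lambda>j. adapted_map ix h B (ix j)) (germ_fps (transformed_series h B) (adapted_map ix h B (ix 1)))
       (germ_fps (fps_deriv (transformed_series h B)) (adapted_map ix h B (ix 1))) ?w"
    using brieskorn_base_change[OF r ix h(1) AB w0] u(1) by simp
  have coeffs: "?w 0 $$ 0 = 1" "?w 1 $$ 0 = \<rho> (ix 1)" "?w 2 $$ 0 = germ_fps h' (\<rho> (ix 1))"
    using r adm(2)
    by (simp_all add: pullback_nth[OF \<rho>0] vsec_def vsec0_eq_section_form[OF r] section_form_nth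
        germ_comp_simps germ_comp_germ_fps \<rho>0)
  have "\<rho> (ix 1) = adapted_map ix h B (ix 1)"
    "germ_fps h' (\<rho> (ix 1)) = germ_fps (transformed_series h B) (adapted_map ix h B (ix 1))"
    using E unfolding lattice_eqs_def coeffs mult_1 by blast+
  then have "h' = transformed_series h B"
    by (intro germ_fps_adapted_inject[OF r ix h(1) h(2) transformed_series(1)[OF h(1)]]) simp
  then have "h' = hU r ix h U" using hU_eq[OF r ix h(1) U(1)] U(2) by simp
  then show ?thesis using U(1) by blast
qed

section \<open>The ambiguity of the series\<close>

lemma transformed_series_cong:
  assumes "B 1 0 = B' 1 0" "B 2 0 = B' 2 0" "B 2 1 = B' 2 1"
  shows "transformed_series h B = transformed_series h B'"
  using assms by (simp add: transformed_series_def scale_series_def coord_series_def)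

theorem theorem1:
  fixes r :: nat and ix :: "nat \<Rightarrow> 'n::finite" and h :: "complex fps"
  assumes "2 \<le> r" and "bij_betw ix {1..r} (UNIV :: 'n set)" and "admissible h"
  shows
    "(\<forall>U. opposite r U \<longrightarrow>
        (\<exists>!k. admissible k \<and> gtildeU r ix h U = germ_fps k (gU r ix h U 1))) \<and>
     (\<forall>h'. admissible h' \<longrightarrow>
        ((\<exists>\<rho> \<phi>. normalized_iso r ix h h' \<rho> \<phi>) \<longleftrightarrow>
           (\<exists>U. opposite r U \<and> h' = hU r ix h U))) \<and>
     (\<forall>U U'. opposite r U \<and> opposite r U' \<and>
        Amatrix r U 1 0 = Amatrix r U' 1 0 \<and> Amatrix r U 2 0 = Amatrix r U' 2 0 \<and>
        Amatrix r U 2 1 = Amatrix r U' 2 1 \<longrightarrow> hU r ix h U = hU r ix h U') \<and>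
     (\<forall>a b c. \<exists>U. opposite r U \<and>
        Amatrix r U 1 0 = a \<and> Amatrix r U 2 0 = b \<and> Amatrix r U 2 1 = c)"
proof (intro conjI allI impI)
  fix U assume "opposite r U"
  then show "\<exists>!k. admissible k \<and> gtildeU r ix h U = germ_fps k (gU r ix h U 1)"
    by (simp only: transformed_series_characterization[OF assms] ex1_eq)
next
  fix h' assume h': "admissible h'"
  show "(\<exists>\<rho> \<phi>. normalized_iso r ix h h' \<rho> \<phi>) \<longleftrightarrow> (\<exists>U. opposite r U \<and> h' = hU r ix h U)"
  proof
    assume "\<exists>\<rho> \<phi>. normalized_iso r ix h h' \<rho> \<phi>"
    then show "\<exists>U. opposite r U \<and> h' = hU r ix h U"
      using filtration_of_normalized_iso[OF assms h'] by blast
  next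
    assume "\<exists>U. opposite r U \<and> h' = hU r ix h U"
    then obtain U where U: "opposite r U" "h' = transformed_series h (basis_matrix r U)"
      using hU_eq[OF assms] by auto
    then show "\<exists>\<rho> \<phi>. normalized_iso r ix h h' \<rho> \<phi>"
      using normalized_iso_of_filtration[OF assms U(1)] by blast
  qed
next
  fix U U' assume U: "opposite r U \<and> opposite r U' \<and>
    Amatrix r U 1 0 = Amatrix r U' 1 0 \<and> Amatrix r U 2 0 = Amatrix r U' 2 0 \<and>
    Amatrix r U 2 1 = Amatrix r U' 2 1"
  then have "opposite r U" "opposite r U'" by auto
  note entries = inverse_low_entries[OF Amatrix_inverse[OF this(1)] assms(1)]
    inverse_low_entries[OF Amatrix_inverse[OF this(2)] assms(1)]
  have "transformed_series h (basis_matrix r U) = transformed_series h (basis_matrix r U')"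
    by (rule transformed_series_cong) (use U in \<open>simp_all only: entries\<close>)
  then show "hU r ix h U = hU r ix h U'" using U hU_eq[OF assms] by simp
next
  fix a b c :: complex
  define A where "A i j = (if i = j \<and> i \<le> r then 1 else if i = 1 \<and> j = 0 then a
    else if i = 2 \<and> j = 0 then b else if i = 2 \<and> j = 1 then c else 0)" for i j :: nat
  have "unitriangular r A" using assms(1) by (auto simp: unitriangular_def A_def)
  then obtain B where "mutually_inverse r A B" using unitriangular_inverse by blast
  then obtain U where "opposite r U" "Amatrix r U = A" using opposite_filtration_of_matrix by blast
  then show "\<exists>U. opposite r U \<and> Amatrix r U 1 0 = a \<and> Amatrix r U 2 0 = b \<and> Amatrix r U 2 1 = c"
    by (intro exI[of _ U]) (simp add: A_def)
qed

end
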